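(* Let $\nu\in(-1,0)$, $\beta\in(0,1)$, let $X$ be the skew two-sided Bessel process with parameter $\nu$ and skewness parameter $\beta$, started at $0$, and let $A_1:=\mathrm{Leb}\{s\in[0,1]:X_s\ge0\}$. Then for any $n\ge1$, $$\mathbf{E}_0(A_1^n)=\sum_{k=0}^{n-1}\sum_{j=0}^{k}\frac{(-1)^j\,j!}{(n-1)!}\genfrac{[}{]}{0pt}{}{n}{k+1}\genfrac{\{}{\}}{0pt}{}{k+1}{j+1}\,\nu^k\beta^{j+1}.$$
   Context: The skew two-sided Bessel process with parameter $\nu\in(-1,0)$ and skewness parameter $\beta\in(0,1)$ is the regular diffusion on $\mathbb{R}$ with speed measure $m_\nu(\mathrm{d}x)=4\beta x^{2\nu+1}\mathrm{d}x$ for $x>0$ and $m_\nu(\mathrm{d}x)=4(1-\beta)|x|^{2\nu+1}\mathrm{d}x$ for $x<0$ (no mass at $0$), and scale function $S_\nu(x)=-\frac{1}{4\beta\nu}x^{-2\nu}$ for $x\ge0$, $S_\nu(x)=\frac{1}{4(1-\beta)\nu}|x|^{-2\nu}$ for $x\le0$. Its generator is $\mathcal{G}f(x)=\frac12f''(x)+\frac{2\nu+1}{2x}f'(x)$ for $x\ne0$, $\mathcal{G}f(0)=\mathcal{G}f(0+)=\mathcal{G}f(0-)$, with domain $\{f: f,\mathcal{G}f\in\mathcal{C}_b(\mathbb{R}),\ \frac{\mathrm{d}f}{\mathrm{d}S_\nu}(0+)=\frac{\mathrm{d}f}{\mathrm{d}S_\nu}(0-)\}$. $\mathbf{E}_0$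 is expectation for the process started at $0$; $\mathrm{Leb}$ is Lebesgue measure. $\genfrac{[}{]}{0pt}{}{n}{k}$ denotes the unsigned Stirling numbers of the first kind and $\genfrac{\{}{\}}{0pt}{}{n}{k}$ the Stirling numbers of the second kind, defined by $\genfrac{[}{]}{0pt}{}{n+1}{k}=n\genfrac{[}{]}{0pt}{}{n}{k}+\genfrac{[}{]}{0pt}{}{n}{k-1}$, $\genfrac{\{}{\}}{0pt}{}{n+1}{k}=k\genfrac{\{}{\}}{0pt}{}{n}{k}+\genfrac{\{}{\}}{0pt}{}{n}{k-1}$, with both equal to $1$ at $(n,k)=(0,0)$ and equal to $0$ when exactly one of $n,k$ is $0$. *)

theory Defs
  imports "HOL-Probability.Probability" "HOL-Combinatorics.Stirling"
begin

text \<open>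
  A conservative diffusion on the real line is a family \<open>P\<close> of probability measures on one
  measurable space \<open>M\<close>, with \<open>P x\<close> the law of the process started at \<open>x\<close>, and one real process \<open>X\<close>
  with continuous paths. Times of the process are real numbers \<open>t \<ge> 0\<close>; random times live in
  \<^typ>\<open>ennreal\<close> so that they may be infinite.
\<close>

definition natural_filtration :: "'a measure \<Rightarrow> (real \<Rightarrow> 'a \<Rightarrow> real) \<Rightarrow> ennreal \<Rightarrow> 'a measure" where
  "natural_filtration M X t =
     sigma (space M) {X s -` B \<inter> space M | s B. 0 \<le> s \<and> ennreal s \<le> t \<and> B \<in> sets borel}"

definition path_after :: "(real \<Rightarrow> 'a \<Rightarrow> real) \<Rightarrow> real \<Rightarrow> 'a \<Rightarrow> (real \<Rightarrow> real)" where
  "path_after X t \<omega> = (\<lambda>s\<in>{0..}. X (t + s) \<omega>)"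

definition hitting_time :: "(real \<Rightarrow> 'a \<Rightarrow> real) \<Rightarrow> real \<Rightarrow> 'a \<Rightarrow> ennreal" where
  "hitting_time X y \<omega> = Inf {ennreal t | t. 0 \<le> t \<and> X t \<omega> = y}"

text \<open>
  The strong Markov property, for stopping times of the uncompleted natural filtration: on
  \<open>{T < \<infinity>}\<close>, the path after \<open>T\<close> has conditional law given the \<open>\<sigma>\<close>-algebra of \<open>T\<close> equal to the
  law of the whole path under \<open>P\<close> started at \<open>X\<^sub>T\<close>.
\<close>

definition strong_Markov ::
    "'a measure \<Rightarrow> (real \<Rightarrow> 'a measure) \<Rightarrow> (real \<Rightarrow> 'a \<Rightarrow> real) \<Rightarrow> bool" where
  "strong_Markov M P X \<longleftrightarrow>
     (\<forall>x T. stopping_time (natural_filtration M X) T \<longrightarrow>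
       (\<forall>A \<in> sets (filtration.pre_sigma (space M) (natural_filtration M X) T).
        \<forall>D \<in> sets (PiM {0..} (\<lambda>_. borel)).
          emeasure (P x) {\<omega> \<in> A. T \<omega> < \<infinity> \<and> path_after X (enn2real (T \<omega>)) \<omega> \<in> D}
            = (\<integral>\<^sup>+\<omega>\<in>{\<omega> \<in> A. T \<omega> < \<infinity>}.
                 emeasure (P (X (enn2real (T \<omega>)) \<omega>)) {\<omega>' \<in> space M. path_after X 0 \<omega>' \<in> D} \<partial>P x)))"

definition regular_diffusion ::
    "'a measure \<Rightarrow> (real \<Rightarrow> 'a measure) \<Rightarrow> (real \<Rightarrow> 'a \<Rightarrow> real) \<Rightarrow> bool" where
  "regular_diffusion M P X \<longleftrightarrow>
     P \<in> borel \<rightarrow>\<^sub>M prob_algebra M \<and>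
     (\<forall>t\<ge>0. X t \<in> borel_measurable M) \<and>
     (\<forall>\<omega>\<in>space M. continuous_on {0..} (\<lambda>t. X t \<omega>)) \<and>
     (\<forall>x. AE \<omega> in P x. X 0 \<omega> = x) \<and>
     strong_Markov M P X \<and>
     (\<forall>x y. emeasure (P x) {\<omega> \<in> space M. hitting_time X y \<omega> < \<infinity>} > 0)"

definition has_scale_function ::
    "'a measure \<Rightarrow> (real \<Rightarrow> 'a measure) \<Rightarrow> (real \<Rightarrow> 'a \<Rightarrow> real) \<Rightarrow> (real \<Rightarrow> real) \<Rightarrow> bool" where
  "has_scale_function M P X S \<longleftrightarrow>
     strict_mono S \<and> continuous_on UNIV S \<and>
     (\<forall>a x b. a < x \<and> x < b \<longrightarrow>
        measure (P x) {\<omega> \<in> space M. hitting_time X b \<omega> < hitting_time X a \<omega>}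
          = (S x - S a) / (S b - S a))"

definition green_function :: "(real \<Rightarrow> real) \<Rightarrow> real \<Rightarrow> real \<Rightarrow> real \<Rightarrow> real \<Rightarrow> real" where
  "green_function S a b x y = (S (min x y) - S a) * (S b - S (max x y)) / (S b - S a)"

text \<open>
  The speed measure \<open>m\<close> belonging to the scale function \<open>S\<close>: mean exit times from bounded intervals
  are the integrals of the Green function. There is no factor \<open>2\<close> in front of \<open>m\<close>; in
  this normalisation the generator is \<open>d/dm d/dS\<close>, and Brownian motion has \<open>S x = x\<close>, \<open>m(dx) = 2 dx\<close>.
\<close>

definition has_speed_measure ::
    "'a measure \<Rightarrow> (real \<Rightarrow> 'a measure) \<Rightarrow> (real \<Rightarrow> 'a \<Rightarrow> real) \<Rightarrow> (real \<Rightarrow> real) \<Rightarrow> real measure \<Rightarrow> bool"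
  where
  "has_speed_measure M P X S m \<longleftrightarrow>
     sets m = sets borel \<and>
     (\<forall>a x b. a < x \<and> x < b \<longrightarrow>
        (\<integral>\<^sup>+\<omega>. min (hitting_time X a \<omega>) (hitting_time X b \<omega>) \<partial>P x)
          = (\<integral>\<^sup>+y\<in>{a<..<b}. ennreal (green_function S a b x y) \<partial>m))"

definition skew_bessel_scale :: "real \<Rightarrow> real \<Rightarrow> real \<Rightarrow> real" where
  "skew_bessel_scale \<nu> \<beta> x =
     (if x \<ge> 0 then - (1 / (4 * \<beta> * \<nu>)) * x powr (- 2 * \<nu>)
      else 1 / (4 * (1 - \<beta>) * \<nu>) * \<bar>x\<bar> powr (- 2 * \<nu>))"

definition skew_bessel_speed :: "real \<Rightarrow> real \<Rightarrow> real measure" where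
  "skew_bessel_speed \<nu> \<beta> = density lborel (\<lambda>x. ennreal
     (if x > 0 then 4 * \<beta> * x powr (2 * \<nu> + 1)
      else if x < 0 then 4 * (1 - \<beta>) * \<bar>x\<bar> powr (2 * \<nu> + 1)
      else 0))"

text \<open>
  On \<open>x \<noteq> 0\<close> the operator \<open>d/dm d/dS\<close> for this pair is \<open>f''/2 + (2\<nu> + 1)/(2x) f'\<close>; the two sides are
  glued at \<open>0\<close> by continuity of \<open>df/dS\<close>, as \<open>m\<close> has no atom at \<open>0\<close>.
\<close>

definition skew_two_sided_bessel ::
    "real \<Rightarrow> real \<Rightarrow> 'a measure \<Rightarrow> (real \<Rightarrow> 'a measure) \<Rightarrow> (real \<Rightarrow> 'a \<Rightarrow> real) \<Rightarrow> bool" where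
  "skew_two_sided_bessel \<nu> \<beta> M P X \<longleftrightarrow>
     regular_diffusion M P X \<and>
     has_scale_function M P X (skew_bessel_scale \<nu> \<beta>) \<and>
     has_speed_measure M P X (skew_bessel_scale \<nu> \<beta>) (skew_bessel_speed \<nu> \<beta>)"

definition occupation_nonneg :: "(real \<Rightarrow> 'a \<Rightarrow> real) \<Rightarrow> real \<Rightarrow> 'a \<Rightarrow> real" where
  "occupation_nonneg X t \<omega> = measure lborel {s \<in> {0..t}. X s \<omega> \<ge> 0}"

end

theory Submission
  imports Defs
begin

text \<open>
  Write \<open>\<alpha> = - \<nu> \<in> (0, 1)\<close>. Kill the process at rate \<open>c\<close> while it is in \<open>[0, \<infinity>)\<close> and at rate \<open>d\<close>
  while it is negative, and let \<open>V x\<close> be its mean lifetime from \<open>x\<close>. The whole proof rests on the value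
  of \<open>V 0\<close>, which is

    \<open>V 0 = (\<beta> c\<^sup>\<alpha>\<^sup>-\<^sup>1 + (1 - \<beta>) d\<^sup>\<alpha>\<^sup>-\<^sup>1) / (\<beta> c\<^sup>\<alpha> + (1 - \<beta>) d\<^sup>\<alpha>)\<close>   (lemma \<open>mean_lifetime_at_zero\<close>).

  It comes from one renewal step. From \<open>0\<close> the process leaves \<open>(-e, e)\<close> at \<open>e\<close> with probability \<open>\<beta>\<close>
  and at \<open>-e\<close> with probability \<open>1 - \<beta>\<close>, after a time of mean \<open>O(e\<^sup>2)\<close>, and then has to return to \<open>0\<close>,
  on one side only, where the killing rate is constant. If \<open>1 - v\<close> denotes the probability of being killed
  before the return from distance \<open>e\<close>, then \<open>V (\<plusminus>e) = (1 - v) / l + v V 0\<close> with \<open>l\<close> the rate on that side.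
  Both values of \<open>1 - v\<close> are asymptotic to \<open>k l\<^sup>\<alpha> e\<^sup>2\<^sup>\<alpha>\<close> with the same constant \<open>k > 0\<close>
  (lemma \<open>killed_harmonic_rate\<close>). As \<open>\<alpha> < 1\<close>, the error \<open>O(e\<^sup>2)\<close> is negligible, and dividing by \<open>e\<^sup>2\<^sup>\<alpha>\<close>
  determines \<open>V 0\<close>; the constant \<open>k\<close> cancels.

  The asymptotics are read off from the eigenvalue equation of the generator without solving it.
  The Laplace transform \<open>v\<close> of the hitting time of \<open>0\<close> satisfies an approximate version of this equation,
  in terms of the exit place and the exit time of short intervals
  (lemma \<open>hit_transform_killed_harmonic\<close>). A maximum principle shows that this version has only one
  bounded solution, so \<open>v\<close> is a function of \<open>sqrt l x\<close> alone, the same on both half-lines; and \<open>1 - v\<close> is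
  concave in the scale \<open>x\<^sup>2\<^sup>\<alpha>\<close> near \<open>0\<close>, so the quotient by \<open>x\<^sup>2\<^sup>\<alpha>\<close> is monotone and has a limit.

  With \<open>c = l (1 + z)\<close> and \<open>d = l\<close>, expanding \<open>V 0\<close> in powers of \<open>z\<close> gives the Laplace transform in \<open>t\<close>
  of every moment \<open>E A\<^sub>t\<^sup>n\<close>, which turns out to be that of a multiple of \<open>t\<^sup>n\<close>. Uniqueness of Laplace
  transforms (lemma \<open>laplace_transform_zero_imp_zero\<close>) identifies the moment itself. The coefficients are
  those of the power series of \<open>V 0\<close>, and they produce the two kinds of Stirling numbers because
  \<open>V 0\<close> is, up to elementary terms, the derivative of \<open>log (1 - \<beta> + \<beta> (1 + z)\<^sup>\<alpha>)\<close>
  (lemma \<open>occupation_generating_function_coeffs\<close>).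
\<close>

section \<open>The generating function and Stirling numbers\<close>

text \<open>
  The derivatives of the sum are supplied as a sequence of functions, so that closed formulas for them
  can be used directly.
\<close>

lemma power_series_coeff_eq_deriv:
  fixes c :: "nat \<Rightarrow> real" and g :: "nat \<Rightarrow> real \<Rightarrow> real"
  assumes "\<And>z. \<bar>z\<bar> < 1 \<Longrightarrow> (\<lambda>n. c n * z ^ n) sums g 0 z"
    and "\<And>k z. \<bar>z\<bar> < 1 \<Longrightarrow> (g k has_real_derivative g (Suc k) z) (at z)"
  shows "fact n * c n = g n 0"
  using assms
proof (induction n arbitrary: c g)
  case 0
  have "(\<lambda>n. c n * 0 ^ n) sums g 0 0"
    using 0(1)[of 0] by simp
  then have "g 0 0 = c 0"
    using powser_sums_zero_iff[of c "g 0 0"] by simp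
  then show ?case by simp
next
  case (Suc n)
  have sm: "summable (\<lambda>n. c n * z ^ n)" if "norm z < 1" for z
    using Suc.prems(1)[of z] that by (auto simp: sums_iff)
  have "(\<lambda>n. diffs c n * z ^ n) sums g (Suc 0) z" if z: "\<bar>z\<bar> < 1" for z
  proof -
    have "((\<lambda>z. \<Sum>n. c n * z ^ n) has_real_derivative (\<Sum>n. diffs c n * z ^ n)) (at z)"
      by (rule termdiffs_strong'[OF sm]) (use z in auto)
    moreover have "((\<lambda>z. \<Sum>n. c n * z ^ n) has_real_derivative g (Suc 0) z) (at z)"
    proof (rule has_field_derivative_transform_within_open[OF Suc.prems(2)[OF z]])
      show "open {-1<..<1::real}" by simp
      show "z \<in> {-1<..<1}" using z by auto
      show "g 0 w = (\<Sum>n. c n * w ^ n)" if "w \<in> {-1<..<1}" for w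
        using Suc.prems(1)[of w] that by (auto simp: sums_iff)
    qed
    ultimately have "(\<Sum>n. diffs c n * z ^ n) = g (Suc 0) z"
      by (rule DERIV_unique)
    moreover have "summable (\<lambda>n. diffs c n * z ^ n)"
      by (rule termdiff_converges[of z 1, OF _ sm]) (use z in auto)
    ultimately show ?thesis by (simp add: sums_iff)
  qed
  then have "fact n * diffs c n = g (Suc n) 0"
    using Suc.IH[of "diffs c" "\<lambda>k. g (Suc k)"] Suc.prems(2) by simp
  then show ?case by (simp add: diffs_def algebra_simps)
qed

text \<open>
  With \<open>y = (1 + z)\<^sup>\<alpha>\<close>, this is the result of applying the Euler operator \<open>y d/dy\<close> to
  \<open>log (1 - \<beta> + \<beta> y)\<close>. It satisfies the logistic equation \<open>y dr/dy = r - r\<^sup>2\<close>, so all further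
  applications of the operator are polynomials in it.
\<close>

definition odds_ratio :: "real \<Rightarrow> real \<Rightarrow> real \<Rightarrow> real" where
  "odds_ratio \<alpha> \<beta> z = \<beta> * (1 + z) powr \<alpha> / (1 - \<beta> + \<beta> * (1 + z) powr \<alpha>)"

text \<open>
  The result of applying \<open>y d/dy\<close> to \<open>log (1 - \<beta> + \<beta> y)\<close> altogether \<open>k + 1\<close> times, at \<open>y = (1 + z)\<^sup>\<alpha>\<close>.
\<close>

definition log_deriv_euler :: "real \<Rightarrow> real \<Rightarrow> nat \<Rightarrow> real \<Rightarrow> real" where
  "log_deriv_euler \<alpha> \<beta> k z =
     (\<Sum>j\<le>k. (-1) ^ j * fact j * real (Stirling (Suc k) (Suc j)) * odds_ratio \<alpha> \<beta> z ^ Suc j)"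

text \<open>
  The derivative of order \<open>n + 1\<close> of \<open>log (1 - \<beta> + \<beta> (1 + z)\<^sup>\<alpha>)\<close>. The signed Stirling numbers of the first
  kind express it through powers of the Euler operator \<open>(1 + z) d/dz\<close>, which acts on functions of
  \<open>y = (1 + z)\<^sup>\<alpha>\<close> as \<open>\<alpha> y d/dy\<close>.
\<close>

definition log_deriv :: "real \<Rightarrow> real \<Rightarrow> nat \<Rightarrow> real \<Rightarrow> real" where
  "log_deriv \<alpha> \<beta> n z =
     (\<Sum>k\<le>n. (-1) ^ (n + k) * real (stirling (Suc n) (Suc k)) * \<alpha> ^ Suc k
        * log_deriv_euler \<alpha> \<beta> k z) / (1 + z) ^ Suc n"

lemma denominator_pos:
  fixes \<beta> y :: real
  assumes "0 < \<beta>" "\<beta> < 1" "y \<ge> 0"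
  shows "1 - \<beta> + \<beta> * y > 0"
  using assms by (simp add: add_pos_nonneg)

context
  fixes \<alpha> \<beta> z :: real
  assumes \<beta>: "0 < \<beta>" "\<beta> < 1" and z: "z > -1"
begin

lemma has_derivative_odds_ratio:
  "(odds_ratio \<alpha> \<beta> has_real_derivative
      \<alpha> * (odds_ratio \<alpha> \<beta> z - odds_ratio \<alpha> \<beta> z ^ 2) / (1 + z)) (at z)"
proof -
  define y where "y = (1 + z) powr \<alpha>"
  have D: "1 - \<beta> + \<beta> * y > 0" unfolding y_def
    by (rule denominator_pos) (use \<beta> in auto)
  have 1: "((\<lambda>z. (1 + z) powr \<alpha>) has_real_derivative \<alpha> * y / (1 + z)) (at z)"
    unfolding y_def using z
    by (auto intro!: derivative_eq_intros simp: powr_diff)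
  have "(odds_ratio \<alpha> \<beta> has_real_derivative
     (\<beta> * (\<alpha> * y / (1 + z)) * (1 - \<beta> + \<beta> * y) - \<beta> * y * (\<beta> * (\<alpha> * y / (1 + z))))
       / ((1 - \<beta> + \<beta> * y) * (1 - \<beta> + \<beta> * y))) (at z)"
  proof -
    have "((\<lambda>z. 1 - \<beta> + \<beta> * (1 + z) powr \<alpha>) has_real_derivative \<beta> * (\<alpha> * y / (1 + z))) (at z)"
      by (rule DERIV_cong[OF DERIV_add[OF DERIV_const DERIV_cmult[OF 1]]]) simp
    from DERIV_divide[OF DERIV_cmult[OF 1] this, of \<beta>] D show ?thesis
      by (simp add: odds_ratio_def[abs_def] y_def)
  qed
  also have "(\<beta> * (\<alpha> * y / (1 + z)) * (1 - \<beta> + \<beta> * y) - \<beta> * y * (\<beta> * (\<alpha> * y / (1 + z))))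
       / ((1 - \<beta> + \<beta> * y) * (1 - \<beta> + \<beta> * y))
     = \<alpha> * (odds_ratio \<alpha> \<beta> z - odds_ratio \<alpha> \<beta> z ^ 2) / (1 + z)"
    unfolding odds_ratio_def y_def[symmetric] using D z
    by (simp add: divide_simps power2_eq_square) (simp add: algebra_simps)
  finally show ?thesis .
qed

text \<open>
  By the logistic equation, \<open>y d/dy\<close> sends \<open>r\<^sup>j\<^sup>+\<^sup>1\<close> to \<open>(j + 1) (r\<^sup>j\<^sup>+\<^sup>1 - r\<^sup>j\<^sup>+\<^sup>2)\<close>; collecting powers gives
  the recursion of the Stirling numbers of the second kind.
\<close>

lemma has_derivative_log_deriv_euler:
  "(log_deriv_euler \<alpha> \<beta> k has_real_derivative \<alpha> * log_deriv_euler \<alpha> \<beta> (Suc k) z / (1 + z)) (at z)"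
proof -
  define r where "r = odds_ratio \<alpha> \<beta> z"
  define c where "c j = (-1) ^ j * fact j * real (Stirling (Suc k) (Suc j))" for j
  define c' where "c' j = (-1) ^ j * fact j * real (Stirling (Suc (Suc k)) (Suc j))" for j
  have rec: "c' (Suc j) = real (Suc (Suc j)) * c (Suc j) - real (Suc j) * c j" for j
    unfolding c_def c'_def by (simp add: algebra_simps)
  have c0: "c' 0 = c 0" unfolding c_def c'_def by simp
  have cS: "c (Suc k) = 0" unfolding c_def by simp
  have "(\<Sum>j\<le>k. c j * (real (Suc j) * r ^ j * (r - r ^ 2)))
      = (\<Sum>j\<le>k. real (Suc j) * c j * r ^ Suc j) - (\<Sum>j\<le>k. real (Suc j) * c j * r ^ Suc (Suc j))"
    by (simp add: sum_subtractf[symmetric] algebra_simps power2_eq_square)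
  also have "(\<Sum>j\<le>k. real (Suc j) * c j * r ^ Suc j) = (\<Sum>j\<le>Suc k. real (Suc j) * c j * r ^ Suc j)"
    using cS by simp
  also have "\<dots> = c 0 * r + (\<Sum>j\<le>k. real (Suc (Suc j)) * c (Suc j) * r ^ Suc (Suc j))"
    by (subst sum.atMost_Suc_shift) simp
  also have "\<dots> - (\<Sum>j\<le>k. real (Suc j) * c j * r ^ Suc (Suc j))
      = c' 0 * r + (\<Sum>j\<le>k. c' (Suc j) * r ^ Suc (Suc j))"
    unfolding rec c0 by (simp add: sum_subtractf[symmetric] left_diff_distrib)
  also have "\<dots> = (\<Sum>j\<le>Suc k. c' j * r ^ Suc j)"
    by (simp add: sum.atMost_Suc_shift del: sum.atMost_Suc)
  finally have eq: "(\<Sum>j\<le>k. c j * (real (Suc j) * r ^ j * (r - r ^ 2))) = (\<Sum>j\<le>Suc k. c' j * r ^ Suc j)" .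
  have pw: "((\<lambda>z. odds_ratio \<alpha> \<beta> z ^ Suc j) has_real_derivative
      real (Suc j) * (r ^ j * (\<alpha> * (r - r ^ 2) / (1 + z)))) (at z)" for j
    unfolding r_def by (rule DERIV_power_Suc[THEN DERIV_cong, OF has_derivative_odds_ratio]) (simp add: algebra_simps)
  have "(log_deriv_euler \<alpha> \<beta> k has_real_derivative
      (\<Sum>j\<le>k. c j * (real (Suc j) * (r ^ j * (\<alpha> * (r - r ^ 2) / (1 + z)))))) (at z)"
    unfolding log_deriv_euler_def c_def[symmetric]
    by (intro DERIV_sum DERIV_cmult pw)
  also have "(\<Sum>j\<le>k. c j * (real (Suc j) * (r ^ j * (\<alpha> * (r - r ^ 2) / (1 + z)))))
      = \<alpha> * (\<Sum>j\<le>k. c j * (real (Suc j) * r ^ j * (r - r ^ 2))) / (1 + z)"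
    by (simp add: sum_distrib_left sum_divide_distrib algebra_simps)
  also have "\<dots> = \<alpha> * log_deriv_euler \<alpha> \<beta> (Suc k) z / (1 + z)"
  proof -
    have "log_deriv_euler \<alpha> \<beta> (Suc k) z = (\<Sum>j\<le>Suc k. c' j * r ^ Suc j)"
      unfolding log_deriv_euler_def c'_def r_def by (rule refl)
    then show ?thesis by (simp only: eq)
  qed
  finally show ?thesis .
qed

text \<open>
  The factor \<open>(1 + z)\<^sup>-\<^sup>n\<^sup>-\<^sup>1\<close> contributes the term with coefficient \<open>-(n + 1)\<close>, the sum the shifted
  one; together they are the recursion of the Stirling numbers of the first kind.
\<close>

lemma has_derivative_log_deriv:
  "(log_deriv \<alpha> \<beta> n has_real_derivative log_deriv \<alpha> \<beta> (Suc n) z) (at z)"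
proof -
  define h where "h k = log_deriv_euler \<alpha> \<beta> k z" for k
  define c where "c k = (-1) ^ (n + k) * real (stirling (Suc n) (Suc k)) * \<alpha> ^ Suc k" for k
  define c' where "c' k = (-1) ^ (Suc n + k) * real (stirling (Suc (Suc n)) (Suc k)) * \<alpha> ^ Suc k" for k
  have rec: "c' (Suc k) = - (real (Suc n) * c (Suc k)) + \<alpha> * c k" for k
    unfolding c_def c'_def by (simp add: algebra_simps)
  have c0: "c' 0 = - (real (Suc n) * c 0)" unfolding c_def c'_def by (simp add: algebra_simps)
  have cS: "c (Suc n) = 0" unfolding c_def by simp
  have "(\<Sum>k\<le>n. c k * (\<alpha> * h (Suc k))) - real (Suc n) * (\<Sum>k\<le>n. c k * h k)
      = (\<Sum>k\<le>n. c k * (\<alpha> * h (Suc k))) - (\<Sum>k\<le>Suc n. real (Suc n) * c k * h k)"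
    using cS by (simp add: sum_distrib_left algebra_simps)
  also have "(\<Sum>k\<le>Suc n. real (Suc n) * c k * h k)
      = real (Suc n) * c 0 * h 0 + (\<Sum>k\<le>n. real (Suc n) * c (Suc k) * h (Suc k))"
    by (subst sum.atMost_Suc_shift) simp
  also have "(\<Sum>k\<le>n. c k * (\<alpha> * h (Suc k))) - \<dots>
      = c' 0 * h 0 + (\<Sum>k\<le>n. c' (Suc k) * h (Suc k))"
    unfolding rec c0
    by (simp add: sum_subtractf sum.distrib sum_negf algebra_simps)
  also have "\<dots> = (\<Sum>k\<le>Suc n. c' k * h k)"
    by (simp add: sum.atMost_Suc_shift del: sum.atMost_Suc)
  finally have eq: "(\<Sum>k\<le>n. c k * (\<alpha> * h (Suc k))) - real (Suc n) * (\<Sum>k\<le>n. c k * h k)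
      = (\<Sum>k\<le>Suc n. c' k * h k)" .
  have 1: "((\<lambda>z. \<Sum>k\<le>n. c k * log_deriv_euler \<alpha> \<beta> k z) has_real_derivative
      (\<Sum>k\<le>n. c k * (\<alpha> * h (Suc k) / (1 + z)))) (at z)"
    unfolding h_def by (intro DERIV_sum DERIV_cmult has_derivative_log_deriv_euler)
  have 2: "((\<lambda>z. (1 + z) ^ Suc n) has_real_derivative real (Suc n) * (1 + z) ^ n) (at z)"
    by (rule DERIV_cong[OF DERIV_power_Suc[OF DERIV_add[OF DERIV_const DERIV_ident]]]) simp
  have "(log_deriv \<alpha> \<beta> n has_real_derivative
     ((\<Sum>k\<le>n. c k * (\<alpha> * h (Suc k) / (1 + z))) * (1 + z) ^ Suc n
       - (\<Sum>k\<le>n. c k * h k) * (real (Suc n) * (1 + z) ^ n)) / ((1 + z) ^ Suc n * (1 + z) ^ Suc n)) (at z)"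
    unfolding log_deriv_def c_def[symmetric] h_def
    by (rule DERIV_divide[OF 1[unfolded h_def] 2]) (use z in simp)
  also have "(\<Sum>k\<le>n. c k * (\<alpha> * h (Suc k) / (1 + z))) = (\<Sum>k\<le>n. c k * (\<alpha> * h (Suc k))) / (1 + z)"
    by (simp add: sum_divide_distrib)
  also have "((\<Sum>k\<le>n. c k * (\<alpha> * h (Suc k))) / (1 + z) * (1 + z) ^ Suc n
       - (\<Sum>k\<le>n. c k * h k) * (real (Suc n) * (1 + z) ^ n)) / ((1 + z) ^ Suc n * (1 + z) ^ Suc n)
      = ((\<Sum>k\<le>n. c k * (\<alpha> * h (Suc k))) - real (Suc n) * (\<Sum>k\<le>n. c k * h k)) / (1 + z) ^ Suc (Suc n)"
  proof -
    have "(A / q * (q * p) - B * (m * p)) / ((q * p) * (q * p)) = (A - m * B) / (q * (q * p))"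
      if "q \<noteq> 0" "p \<noteq> 0" for A B q p m :: real
      using that by (simp add: field_simps)
    then show ?thesis using z by simp
  qed
  also have "\<dots> = log_deriv \<alpha> \<beta> (Suc n) z"
  proof -
    have "log_deriv \<alpha> \<beta> (Suc n) z = (\<Sum>k\<le>Suc n. c' k * h k) / (1 + z) ^ Suc (Suc n)"
      unfolding log_deriv_def c'_def h_def by (rule refl)
    then show ?thesis by (simp only: eq)
  qed
  finally show ?thesis .
qed

end

text \<open>
  The function on the right-hand side is \<open>1 - (z / \<alpha>) F' z\<close> with \<open>F z = log (1 - \<beta> + \<beta> (1 + z)\<^sup>\<alpha>)\<close>.
  By the Leibniz rule its \<open>n\<close>-th derivative at \<open>0\<close> is \<open>-n / \<alpha>\<close> times that of \<open>F\<close>, and at \<open>z = 0\<close> the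
  odds ratio is \<open>\<beta>\<close>.
\<close>

lemma occupation_generating_function_coeffs:
  fixes \<alpha> \<beta> :: real and a :: "nat \<Rightarrow> real"
  assumes \<beta>: "0 < \<beta>" "\<beta> < 1" and \<alpha>: "\<alpha> > 0"
    and a: "\<And>z. \<bar>z\<bar> < 1 \<Longrightarrow> (\<lambda>n. (-1) ^ n * a n * z ^ n) sums
      ((\<beta> * (1 + z) powr (\<alpha> - 1) + (1 - \<beta>)) / (\<beta> * (1 + z) powr \<alpha> + (1 - \<beta>)))"
    and n: "n \<ge> 1"
  shows "a n = (\<Sum>k=0..n-1. \<Sum>j=0..k.
       (-1) ^ j * fact j / fact (n - 1) * real (stirling n (k + 1)) * real (Stirling (k + 1) (j + 1))
         * (- \<alpha>) ^ k * \<beta> ^ (j + 1))"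
proof -
  define g where "g k z = (if k = 0 then 1 - z * log_deriv \<alpha> \<beta> 0 z / \<alpha>
     else - (z * log_deriv \<alpha> \<beta> k z + real k * log_deriv \<alpha> \<beta> (k - 1) z) / \<alpha>)" for k z
  have sums: "(\<lambda>n. (-1) ^ n * a n * z ^ n) sums g 0 z" if z: "\<bar>z\<bar> < 1" for z
  proof -
    define y where "y = (1 + z) powr \<alpha>"
    have D: "1 - \<beta> + \<beta> * y > 0" unfolding y_def
      by (rule denominator_pos) (use \<beta> in auto)
    have y1: "(1 + z) powr (\<alpha> - 1) = y / (1 + z)" unfolding y_def using z by (simp add: powr_diff)
    have "(\<beta> * (1 + z) powr (\<alpha> - 1) + (1 - \<beta>)) / (\<beta> * (1 + z) powr \<alpha> + (1 - \<beta>)) = g 0 z"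
      unfolding y1 g_def log_deriv_def log_deriv_euler_def odds_ratio_def y_def[symmetric]
      using D z \<alpha> by (simp add: divide_simps) (simp add: algebra_simps)
    then show ?thesis using a[OF z] by simp
  qed
  have deriv: "(g k has_real_derivative g (Suc k) z) (at z)" if z: "\<bar>z\<bar> < 1" for k z
  proof -
    have D: "(log_deriv \<alpha> \<beta> m has_real_derivative log_deriv \<alpha> \<beta> (Suc m) z) (at z)" for m
      using has_derivative_log_deriv \<beta> z by auto
    show ?thesis
  proof (cases k)
    case 0
    have *: "g 0 = (\<lambda>z. 1 - z * log_deriv \<alpha> \<beta> 0 z / \<alpha>)" by (simp add: g_def fun_eq_iff)
    show ?thesis unfolding 0 *
      by (rule DERIV_cong[OF DERIV_diff[OF DERIV_const DERIV_cdivide[OF DERIV_mult[OF DERIV_ident D]]]])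
        (use \<alpha> in \<open>simp add: g_def field_simps\<close>)
  next
    case (Suc m)
    have *: "g (Suc m) = (\<lambda>z. - (z * log_deriv \<alpha> \<beta> (Suc m) z + real (Suc m) * log_deriv \<alpha> \<beta> m z) / \<alpha>)"
      by (simp add: g_def fun_eq_iff)
    show ?thesis unfolding Suc *
      by (rule DERIV_cong[OF DERIV_cdivide[OF DERIV_minus[OF DERIV_add[OF DERIV_mult[OF DERIV_ident D] DERIV_cmult[OF D]]]]])
        (use \<alpha> in \<open>simp add: g_def field_simps\<close>)
  qed
  qed
  obtain m where m: "n = Suc m" using n by (cases n) auto
  have "fact n * ((-1) ^ n * a n) = g n 0"
    by (rule power_series_coeff_eq_deriv[of "\<lambda>n. (-1) ^ n * a n", OF sums deriv])
  also have "\<dots> = - (real n * log_deriv \<alpha> \<beta> m 0) / \<alpha>"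
    unfolding g_def m by simp
  finally have "real n * (fact m * ((-1) ^ n * a n)) = real n * (- log_deriv \<alpha> \<beta> m 0 / \<alpha>)"
    unfolding m by (simp add: mult.assoc)
  then have "fact m * ((-1) ^ n * a n) = - log_deriv \<alpha> \<beta> m 0 / \<alpha>"
    by (rule mult_left_cancel[THEN iffD1, rotated]) (use n in simp)
  then have "(-1) ^ n * a n = - log_deriv \<alpha> \<beta> m 0 / \<alpha> / fact m"
    using nonzero_mult_div_cancel_left[of "fact m :: real" "(-1) ^ n * a n"] by simp
  then have "a n = (-1) ^ m * log_deriv \<alpha> \<beta> m 0 / (\<alpha> * fact m)"
    unfolding m by (cases "even m") auto
  also have "\<dots> = (\<Sum>k\<le>m. \<Sum>j\<le>k. (-1) ^ j * fact j / fact m * real (stirling (Suc m) (Suc k))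
      * real (Stirling (Suc k) (Suc j)) * (- \<alpha>) ^ k * \<beta> ^ Suc j)"
  proof -
    have r: "odds_ratio \<alpha> \<beta> 0 = \<beta>" by (simp add: odds_ratio_def)
    have sg: "(-1) ^ m * ((-1) ^ (m + k) * x) = (-1) ^ k * x" for x :: real and k
      by (cases "even m") (auto simp: power_add)
    have "(-1) ^ m * log_deriv \<alpha> \<beta> m 0 / (\<alpha> * fact m)
      = (\<Sum>k\<le>m. (-1) ^ m * ((-1) ^ (m + k) * (real (stirling (Suc m) (Suc k)) * \<alpha> ^ Suc k
            * log_deriv_euler \<alpha> \<beta> k 0)) / (\<alpha> * fact m))"
      unfolding log_deriv_def
      by (simp add: sum_distrib_left[of "(-1) ^ m"] sum_divide_distrib[of _ _ "\<alpha> * fact m"] mult.assoc)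
    also have "\<dots> = (\<Sum>k\<le>m. (-\<alpha>) ^ k / fact m * real (stirling (Suc m) (Suc k)) * log_deriv_euler \<alpha> \<beta> k 0)"
      unfolding sg using \<alpha> by (intro sum.cong refl) (simp add: power_minus[of \<alpha>])
    also have "\<dots> = (\<Sum>k\<le>m. \<Sum>j\<le>k. (-1) ^ j * fact j / fact m * real (stirling (Suc m) (Suc k))
      * real (Stirling (Suc k) (Suc j)) * (- \<alpha>) ^ k * \<beta> ^ Suc j)"
      unfolding log_deriv_euler_def r sum_distrib_left
      by (intro sum.cong refl) (simp add: mult_ac)
    finally show ?thesis .
  qed
  finally show ?thesis
    unfolding m by (simp add: atLeast0AtMost)
qed

section \<open>Laplace transforms on the half-line\<close>

lemma has_bochner_integral_power_exp:
  fixes l :: real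
  assumes "0 < l"
  shows "has_bochner_integral lborel (\<lambda>t. indicator {0..} t * (exp (- l * t) * t ^ n)) (fact n / l ^ Suc n)"
proof -
  have "has_bochner_integral lborel (\<lambda>t. erlang_density n l t) 1"
  proof (rule has_bochner_integral_nn_integral)
    show "(\<integral>\<^sup>+ x. ennreal (erlang_density n l x) \<partial>lborel) = ennreal 1"
      using nn_integral_erlang_ith_moment[OF assms, of n 0] by simp
  qed (use assms in auto)
  from has_bochner_integral_mult_right[OF this, of "fact n / l ^ Suc n"]
  have "has_bochner_integral lborel (\<lambda>t. fact n / l ^ Suc n * erlang_density n l t) (fact n / l ^ Suc n)"
    by simp
  moreover have "(\<lambda>t. fact n / l ^ Suc n * erlang_density n l t)
      = (\<lambda>t. indicator {0..} t * (exp (- l * t) * t ^ n))"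
    using assms by (auto simp: fun_eq_iff erlang_density_def indicator_def field_simps)
  ultimately show ?thesis by simp
qed

text \<open>
  The substitution \<open>u = e\<^sup>-\<^sup>t\<close> turns the hypothesis for integer \<open>l\<close> into the orthogonality of
  \<open>k u = u d(- log u)\<close> to all monomials on \<open>[0, 1]\<close>. The polynomial bound on \<open>d\<close> and the extra factor \<open>u\<close>
  make \<open>k\<close> continuous at \<open>0\<close>, so Weierstrass approximation applies and \<open>k\<close> is orthogonal to itself.
  The integrals are kept in the variable \<open>t\<close> throughout.
\<close>

lemma laplace_transform_zero_imp_zero:
  fixes d :: "real \<Rightarrow> real"
  assumes cont: "continuous_on {0..} d"
    and bound: "\<And>t. t \<ge> 0 \<Longrightarrow> \<bar>d t\<bar> \<le> C * t ^ n"
    and zero: "\<And>l. l > 0 \<Longrightarrow> (\<integral>t. indicator {0..} t * (exp (- l * t) * d t) \<partial>lborel) = 0"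
    and t: "t > 0"
  shows "d t = 0"
proof -
  define D where "D t = d (max 0 t)" for t
  have contD: "continuous_on UNIV D"
    unfolding D_def by (intro continuous_on_compose2[OF cont] continuous_intros) auto
  have D_meas[measurable]: "D \<in> borel_measurable borel"
    by (rule borel_measurable_continuous_onI[OF contD])
  have D_bound: "\<bar>D t\<bar> \<le> C * t ^ n" if "t \<ge> 0" for t
    using bound[OF that] that by (simp add: D_def)
  have C: "C \<ge> 0"
    using bound[of 1] by auto
  have ind: "indicator {0..} t * (x * d t) = indicator {0..} t * (x * D t)" for t x :: real
    by (auto simp: D_def indicator_def)
  have int1: "integrable lborel (\<lambda>t. indicator {0..} t * (exp (- l * t) * D t))" if "l > 0" for l
  proof (rule Bochner_Integration.integrable_bound)
    show "integrable lborel (\<lambda>t. C * (indicator {0..} t * (exp (- l * t) * t ^ n)))"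
      using has_bochner_integral_power_exp[OF that, of n] by (auto simp: has_bochner_integral_iff)
    show "AE t in lborel. norm (indicator {0..} t * (exp (- l * t) * D t))
         \<le> norm (C * (indicator {0..} t * (exp (- l * t) * t ^ n)))"
      using D_bound C by (auto simp: indicator_def abs_mult)
  qed measurable
  define k where "k u = (if u \<le> 0 then 0 else u * d (- ln u))" for u
  have kexp: "k (exp (- t)) = exp (- t) * d t" for t
    by (simp add: k_def)
  have k_lim: "(k \<longlongrightarrow> 0) (at_right 0)"
  proof (rule Lim_null_comparison)
    have "filterlim (\<lambda>u::real. - ln u) at_top (at_right 0)"
      using ln_at_0 by (simp add: filterlim_uminus_at_top)
    from filterlim_compose[OF tendsto_power_div_exp_0 this]
    have "((\<lambda>u. C * ((- ln u) ^ n / exp (- ln u))) \<longlongrightarrow> C * 0) (at_right (0::real))"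
      by (intro tendsto_mult_left)
    then show "((\<lambda>u. C * ((- ln u) ^ n / exp (- ln u))) \<longlongrightarrow> 0) (at_right (0::real))" by simp
    have "eventually (\<lambda>u::real. u \<in> {0<..<1}) (at_right 0)"
      by (rule eventually_at_rightI[of 0 1]) auto
    then show "eventually (\<lambda>u. norm (k u) \<le> C * ((- ln u) ^ n / exp (- ln u))) (at_right 0)"
    proof eventually_elim
      case (elim u)
      then have "\<bar>d (- ln u)\<bar> \<le> C * (- ln u) ^ n" by (intro bound) auto
      then have "u * \<bar>d (- ln u)\<bar> \<le> u * (C * (- ln u) ^ n)"
        using elim by (intro mult_left_mono) auto
      then show ?case using elim by (simp add: k_def abs_mult exp_minus field_simps)
    qed
  qed
  have contk: "continuous_on {0..1} k"
    unfolding continuous_on_eq_continuous_within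
  proof
    fix u :: real assume u: "u \<in> {0..1}"
    show "continuous (at u within {0..1}) k"
    proof (cases "u = 0")
      case True
      have "(k \<longlongrightarrow> k 0) (at 0 within {0..1})"
        using k_lim at_within_Icc_at_right[of 0 "1::real"] by (simp add: k_def)
      then show ?thesis using True by (simp add: continuous_within)
    next
      case False
      have "continuous_on {0<..1} (\<lambda>u. u * d (- ln u))"
        by (intro continuous_intros continuous_on_compose2[OF cont]) auto
      then have "continuous_on {0<..1} k"
        by (rule continuous_on_cong[THEN iffD1, rotated -1]) (auto simp: k_def)
      then have "continuous (at u within {0<..1}) k"
        using u False by (auto simp: continuous_on_eq_continuous_within)
      moreover have "at u within {0<..1} = at u within {0..1}"
        by (rule at_within_nhd[of u "{0<..}"]) (use u False in auto)
      ultimately show ?thesis by (simp add: continuous_within)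
    qed
  qed
  define J where "J = (\<integral>t. indicator {0..} t * (exp (- 2 * t) * \<bar>D t\<bar>) \<partial>lborel)"
  have intJ: "integrable lborel (\<lambda>t. indicator {0..} t * (exp (- 2 * t) * \<bar>D t\<bar>))"
    using integrable_abs[OF int1[of 2]] by (simp add: abs_mult)
  have int_sq: "integrable lborel (\<lambda>t. indicator {0..} t * (exp (- 3 * t) * D t ^ 2))"
  proof (rule Bochner_Integration.integrable_bound)
    show "integrable lborel (\<lambda>t. C\<^sup>2 * (indicator {0..} t * (exp (- 3 * t) * t ^ (2 * n))))"
      using has_bochner_integral_power_exp[of 3 "2 * n"] by (auto simp: has_bochner_integral_iff)
    have "D t ^ 2 \<le> C ^ 2 * t ^ (2 * n)" if "t \<ge> 0" for t
      using power_mono[OF D_bound[OF that], of 2] by (simp add: power_mult_distrib power_mult[symmetric] mult.commute)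
    then show "AE t in lborel. norm (indicator {0..} t * (exp (- 3 * t) * D t ^ 2))
         \<le> norm (C\<^sup>2 * (indicator {0..} t * (exp (- 3 * t) * t ^ (2 * n))))"
      by (auto simp: indicator_def abs_mult)
  qed measurable
  \<comment> \<open>With \<open>k (e\<^sup>-\<^sup>t) = e\<^sup>-\<^sup>t d t\<close>, the integral of \<open>k\<^sup>2\<close> over \<open>[0, 1]\<close> is that of \<open>e\<^sup>-\<^sup>3\<^sup>t (d t)\<^sup>2\<close>; replacing one
    factor \<open>k\<close> by a polynomial \<open>g\<close> gives \<open>0\<close> and costs at most \<open>e J\<close>.\<close>
  have small: "(\<integral>t. indicator {0..} t * (exp (- 3 * t) * D t ^ 2) \<partial>lborel) \<le> e * J" if e: "e > 0" for e
  proof -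
    obtain g where g: "real_polynomial_function g" and ge: "\<And>x. x \<in> {0..1} \<Longrightarrow> \<bar>k x - g x\<bar> < e"
      using Stone_Weierstrass_real_polynomial_function[OF _ contk e] by auto
    obtain a N where gs: "g = (\<lambda>x. \<Sum>i\<le>N. a i * x ^ i)"
      using g unfolding real_polynomial_function_iff_sum by auto
    have gi: "indicator {0..} t * (exp (- 2 * t) * D t * g (exp (- t)))
       = (\<Sum>i\<le>N. a i * (indicator {0..} t * (exp (- real (i + 2) * t) * D t)))" for t :: real
      unfolding gs sum_distrib_left
      by (intro sum.cong refl) (simp add: exp_of_nat_mult[symmetric] exp_add[symmetric] algebra_simps flip: exp_add)
    have ii: "integrable lborel (\<lambda>t. a i * (indicator {0..} t * (exp (- real (i + 2) * t) * D t)))" for i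
      by (intro integrable_mult_right int1) simp
    have int_g: "integrable lborel (\<lambda>t. indicator {0..} t * (exp (- 2 * t) * D t * g (exp (- t))))"
      unfolding gi by (intro Bochner_Integration.integrable_sum integrable_mult_right int1) simp
    have "(\<integral>t. indicator {0..} t * (exp (- 2 * t) * D t * g (exp (- t))) \<partial>lborel)
       = (\<Sum>i\<le>N. a i * (\<integral>t. (indicator {0..} t * (exp (- real (i + 2) * t) * D t)) \<partial>lborel))"
      unfolding gi by (subst Bochner_Integration.integral_sum[OF ii]) simp
    also have "\<dots> = 0"
    proof (intro sum.neutral ballI)
      fix i show "a i * (\<integral>t. (indicator {0..} t * (exp (- real (i + 2) * t) * D t)) \<partial>lborel) = 0"
        using zero[of "real (i + 2)"] unfolding ind by simp
    qed
    finally have g0: "(\<integral>t. indicator {0..} t * (exp (- 2 * t) * D t * g (exp (- t))) \<partial>lborel) = 0" .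
    have sq: "indicator {0..} t * (exp (- 3 * t) * D t ^ 2)
        = indicator {0..} t * (exp (- 2 * t) * D t * k (exp (- t)))" for t :: real
      unfolding kexp by (auto simp: D_def indicator_def power2_eq_square exp_add[symmetric])
    have "(\<integral>t. indicator {0..} t * (exp (- 3 * t) * D t ^ 2) \<partial>lborel)
       = (\<integral>t. indicator {0..} t * (exp (- 3 * t) * D t ^ 2)
            - indicator {0..} t * (exp (- 2 * t) * D t * g (exp (- t))) \<partial>lborel)"
      using Bochner_Integration.integral_diff[OF int_sq int_g] g0 by simp
    also have "\<dots> \<le> (\<integral>t. e * (indicator {0..} t * (exp (- 2 * t) * \<bar>D t\<bar>)) \<partial>lborel)"
    proof (rule integral_mono)
      fix t :: real
      show "indicator {0..} t * (exp (- 3 * t) * D t ^ 2)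
            - indicator {0..} t * (exp (- 2 * t) * D t * g (exp (- t)))
          \<le> e * (indicator {0..} t * (exp (- 2 * t) * \<bar>D t\<bar>))"
      proof (cases "t \<ge> 0")
        case True
        have "D t * (k (exp (- t)) - g (exp (- t))) \<le> \<bar>D t\<bar> * \<bar>k (exp (- t)) - g (exp (- t))\<bar>"
          by (metis abs_ge_self abs_mult)
        also have "\<dots> \<le> \<bar>D t\<bar> * e"
          using ge[of "exp (- t)"] True by (intro mult_left_mono) auto
        finally have "exp (- 2 * t) * (D t * (k (exp (- t)) - g (exp (- t)))) \<le> exp (- 2 * t) * (\<bar>D t\<bar> * e)"
          by (intro mult_left_mono) auto
        then show ?thesis unfolding sq using True by (simp add: algebra_simps)
      qed auto
    qed (intro Bochner_Integration.integrable_diff int_sq int_g integrable_mult_right intJ)+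
    finally show ?thesis unfolding J_def by simp
  qed
  have J0: "J \<ge> 0" unfolding J_def by (intro Bochner_Integration.integral_nonneg) auto
  have le0: "(\<integral>t. indicator {0..} t * (exp (- 3 * t) * D t ^ 2) \<partial>lborel) \<le> 0"
  proof (rule field_le_epsilon)
    fix e :: real assume "e > 0"
    then have "(\<integral>t. indicator {0..} t * (exp (- 3 * t) * D t ^ 2) \<partial>lborel) \<le> e / (J + 1) * J"
      using J0 by (intro small) auto
    also have "\<dots> \<le> e" using J0 \<open>e > 0\<close> by (simp add: field_simps)
    finally show "(\<integral>t. indicator {0..} t * (exp (- 3 * t) * D t ^ 2) \<partial>lborel) \<le> 0 + e" by simp
  qed
  have "(\<integral>t. indicator {0..} t * (exp (- 3 * t) * D t ^ 2) \<partial>lborel) = 0"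
    by (rule antisym[OF le0]) (intro Bochner_Integration.integral_nonneg, auto)
  then have "AE t in lborel. indicator {0..} t * (exp (- 3 * t) * D t ^ 2) = 0"
    by (subst (asm) integral_nonneg_eq_0_iff_AE[OF int_sq]) auto
  then have "AE t in lborel. t \<in> {0<..} \<longrightarrow> D t = 0"
    by eventually_elim (auto simp: indicator_def)
  then have AE: "AE t\<in>{0<..} in lebesgue. t \<in> {t. D t = 0}"
    by (intro AE_completion) simp
  have "closed {t. D t = 0}"
    using continuous_closed_vimage[of "{0}" D] contD
    by (auto simp: vimage_def continuous_on_eq_continuous_at)
  from mem_closed_if_AE_lebesgue_open[OF _ this AE, of t] t
  show ?thesis by (simp add: D_def)
qed

section \<open>The characteristic operator equation of the Bessel process\<close>

text \<open>
  On either half-line the scale function is proportional to \<open>\<bar>x\<bar>\<^sup>2\<^sup>\<alpha>\<close>. For a process at distance \<open>x\<close> from the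
  origin this is the probability of reaching distance \<open>b\<close> before distance \<open>a\<close>.
\<close>

definition upper_exit_prob :: "real \<Rightarrow> real \<Rightarrow> real \<Rightarrow> real \<Rightarrow> real" where
  "upper_exit_prob \<alpha> a x b =
     (x powr (2 * \<alpha>) - a powr (2 * \<alpha>)) / (b powr (2 * \<alpha>) - a powr (2 * \<alpha>))"

text \<open>
  The generator sends \<open>x\<^sup>2 / (2 - 2 \<alpha>)\<close> to \<open>1\<close>, so the mean exit time of \<open>(a, b)\<close> is the mean increase
  of this function.
\<close>

definition mean_exit_time :: "real \<Rightarrow> real \<Rightarrow> real \<Rightarrow> real \<Rightarrow> real" where
  "mean_exit_time \<alpha> a x b =
     (upper_exit_prob \<alpha> a x b * b\<^sup>2 + (1 - upper_exit_prob \<alpha> a x b) * a\<^sup>2 - x\<^sup>2) / (2 - 2 * \<alpha>)"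

definition exit_mean :: "real \<Rightarrow> (real \<Rightarrow> real) \<Rightarrow> real \<Rightarrow> real \<Rightarrow> real \<Rightarrow> real" where
  "exit_mean \<alpha> f a x b = upper_exit_prob \<alpha> a x b * f b + (1 - upper_exit_prob \<alpha> a x b) * f a"

text \<open>
  An integrated form of the equation \<open>\<G> f = l f\<close> with \<open>f 0 = 1\<close>: as \<open>a\<close> and \<open>b\<close> approach \<open>x\<close>,
  both bounds become \<open>l f x\<close> times the mean exit time, and Dynkin's characteristic operator of \<open>f\<close> is \<open>l f\<close>.
  The explicit error terms are those that one exit from \<open>(a, b)\<close> yields for the Laplace transform of
  the hitting time of \<open>0\<close>; they suffice for continuity, uniqueness and the behaviour at \<open>0\<close>.
\<close>

definition killed_harmonic :: "real \<Rightarrow> real \<Rightarrow> (real \<Rightarrow> real) \<Rightarrow> bool" where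
  "killed_harmonic \<alpha> l f \<longleftrightarrow> (\<forall>x\<ge>0. 0 \<le> f x \<and> f x \<le> 1) \<and> f 0 = 1 \<and>
     (\<forall>a x b. 0 \<le> a \<longrightarrow> a < x \<longrightarrow> x < b \<longrightarrow>
        l * mean_exit_time \<alpha> a x b * (min (f a) (f b) * (1 - l * (b\<^sup>2 - a\<^sup>2) / (2 - 2 * \<alpha>)))
          \<le> exit_mean \<alpha> f a x b - f x \<and>
        exit_mean \<alpha> f a x b - f x \<le> l * mean_exit_time \<alpha> a x b * max (f a) (f b))"

context
  fixes \<alpha> :: real
  assumes \<alpha>: "0 < \<alpha>" "\<alpha> < 1"
begin

lemma upper_exit_prob_bounds:
  assumes "0 \<le> a" "a < x" "x < b"
  shows "0 < upper_exit_prob \<alpha> a x b" "upper_exit_prob \<alpha> a x b < 1"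
proof -
  have "a powr (2 * \<alpha>) < x powr (2 * \<alpha>)" "x powr (2 * \<alpha>) < b powr (2 * \<alpha>)"
    using assms \<alpha> by (auto intro!: powr_less_mono2)
  then show "0 < upper_exit_prob \<alpha> a x b" "upper_exit_prob \<alpha> a x b < 1"
    by (auto simp: upper_exit_prob_def)
qed

text \<open>
  Strict convexity of \<open>x\<^sup>2\<close> as a function of \<open>x\<^sup>2\<^sup>\<alpha>\<close>: by Cauchy's mean value theorem the slopes on
  \<open>[a, x]\<close> and \<open>[x, b]\<close> are values of the increasing function \<open>c\<^sup>2\<^sup>-\<^sup>2\<^sup>\<alpha> / \<alpha>\<close>. For \<open>a = 0\<close>, where \<open>x\<^sup>2\<^sup>\<alpha>\<close>
  need not be differentiable, the first slope is estimated directly.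
\<close>

lemma mean_exit_time_pos:
  assumes "0 \<le> a" "a < x" "x < b"
  shows "0 < mean_exit_time \<alpha> a x b"
proof -
  have *: "a powr (2 * \<alpha>) < x powr (2 * \<alpha>)" "x powr (2 * \<alpha>) < b powr (2 * \<alpha>)"
    using assms \<alpha> by (auto intro!: powr_less_mono2)
  have mvt: "\<exists>c. u < c \<and> c < v \<and> \<alpha> * (v\<^sup>2 - u\<^sup>2) = (v powr (2 * \<alpha>) - u powr (2 * \<alpha>)) * c powr (2 - 2 * \<alpha>)"
    if "0 < u" "u < v" for u v
  proof -
    have "\<exists>c. u < c \<and> c < v \<and> (v\<^sup>2 - u\<^sup>2) * (2 * \<alpha> * c powr (2 * \<alpha> - 1))
        = (v powr (2 * \<alpha>) - u powr (2 * \<alpha>)) * (2 * c)"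
    proof (rule GMVT'[OF that(2)])
      fix z assume "u \<le> z" "z \<le> v"
      then show "isCont (\<lambda>x. x\<^sup>2) z" "isCont (\<lambda>x. x powr (2 * \<alpha>)) z"
        using that by (auto intro!: continuous_intros)
    next
      fix z assume "u < z" "z < v"
      then show "DERIV (\<lambda>x. x powr (2 * \<alpha>)) z :> 2 * \<alpha> * z powr (2 * \<alpha> - 1)"
        using that by (auto intro!: derivative_eq_intros simp: powr_diff)
      show "DERIV (\<lambda>x. x\<^sup>2) z :> 2 * z"
        by (auto intro!: derivative_eq_intros)
    qed
    then obtain c where c: "u < c" "c < v" "(v\<^sup>2 - u\<^sup>2) * (2 * \<alpha> * c powr (2 * \<alpha> - 1))
        = (v powr (2 * \<alpha>) - u powr (2 * \<alpha>)) * (2 * c)" by blast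
    have c0: "c > 0" using c that by auto
    have pw: "c powr (2 * \<alpha> - 1) * c powr (2 - 2 * \<alpha>) = c"
      using c0 by (simp flip: powr_add)
    have "(2 * (c powr (2 * \<alpha> - 1) * c powr (2 - 2 * \<alpha>))) * (\<alpha> * (v\<^sup>2 - u\<^sup>2))
       = ((v\<^sup>2 - u\<^sup>2) * (2 * \<alpha> * c powr (2 * \<alpha> - 1))) * c powr (2 - 2 * \<alpha>)"
      by (simp only: mult_ac)
    also have "\<dots> = (2 * c) * ((v powr (2 * \<alpha>) - u powr (2 * \<alpha>)) * c powr (2 - 2 * \<alpha>))"
      unfolding c(3) by (simp only: mult_ac)
    finally have "(2 * c) * (\<alpha> * (v\<^sup>2 - u\<^sup>2))
       = (2 * c) * ((v powr (2 * \<alpha>) - u powr (2 * \<alpha>)) * c powr (2 - 2 * \<alpha>))"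
      unfolding pw .
    then have "\<alpha> * (v\<^sup>2 - u\<^sup>2) = (v powr (2 * \<alpha>) - u powr (2 * \<alpha>)) * c powr (2 - 2 * \<alpha>)"
      using c0 by simp
    then show ?thesis using c by blast
  qed
  have "(x\<^sup>2 - a\<^sup>2) * (b powr (2 * \<alpha>) - x powr (2 * \<alpha>)) < (b\<^sup>2 - x\<^sup>2) * (x powr (2 * \<alpha>) - a powr (2 * \<alpha>))"
  proof -
    obtain d where d: "x < d" "d < b" "\<alpha> * (b\<^sup>2 - x\<^sup>2) = (b powr (2 * \<alpha>) - x powr (2 * \<alpha>)) * d powr (2 - 2 * \<alpha>)"
      using mvt[of x b] assms by auto
    have "\<exists>c. 0 < c \<and> c \<le> x \<and> \<alpha> * (x\<^sup>2 - a\<^sup>2) \<le> (x powr (2 * \<alpha>) - a powr (2 * \<alpha>)) * c powr (2 - 2 * \<alpha>)"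
    proof (cases "a = 0")
      case True
      have "x powr (2 * \<alpha>) * x powr (2 - 2 * \<alpha>) = x\<^sup>2"
        using assms by (simp flip: powr_add)
      then show ?thesis using True assms \<alpha> by (intro exI[of _ x]) auto
    next
      case False
      then obtain c where "a < c" "c < x" "\<alpha> * (x\<^sup>2 - a\<^sup>2) = (x powr (2 * \<alpha>) - a powr (2 * \<alpha>)) * c powr (2 - 2 * \<alpha>)"
        using mvt[of a x] assms by auto
      then show ?thesis using assms by (intro exI[of _ c]) auto
    qed
    then obtain c where c: "0 < c" "c \<le> x" "\<alpha> * (x\<^sup>2 - a\<^sup>2) \<le> (x powr (2 * \<alpha>) - a powr (2 * \<alpha>)) * c powr (2 - 2 * \<alpha>)" by blast
    have cd: "c powr (2 - 2 * \<alpha>) < d powr (2 - 2 * \<alpha>)"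
      using c d \<alpha> by (intro powr_less_mono2) auto
    have "\<alpha> * ((x\<^sup>2 - a\<^sup>2) * (b powr (2 * \<alpha>) - x powr (2 * \<alpha>)))
       = \<alpha> * (x\<^sup>2 - a\<^sup>2) * (b powr (2 * \<alpha>) - x powr (2 * \<alpha>))" by simp
    also have "\<dots> \<le> (x powr (2 * \<alpha>) - a powr (2 * \<alpha>)) * c powr (2 - 2 * \<alpha>) * (b powr (2 * \<alpha>) - x powr (2 * \<alpha>))"
      using * by (intro mult_right_mono c) auto
    also have "\<dots> = ((x powr (2 * \<alpha>) - a powr (2 * \<alpha>)) * (b powr (2 * \<alpha>) - x powr (2 * \<alpha>))) * c powr (2 - 2 * \<alpha>)"
      by (simp add: mult_ac)
    also have "\<dots> < ((x powr (2 * \<alpha>) - a powr (2 * \<alpha>)) * (b powr (2 * \<alpha>) - x powr (2 * \<alpha>))) * d powr (2 - 2 * \<alpha>)"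
      using * cd by (intro mult_strict_left_mono) auto
    also have "\<dots> = \<alpha> * (b\<^sup>2 - x\<^sup>2) * (x powr (2 * \<alpha>) - a powr (2 * \<alpha>))"
      unfolding d(3) by (simp add: mult_ac)
    finally have "\<alpha> * ((x\<^sup>2 - a\<^sup>2) * (b powr (2 * \<alpha>) - x powr (2 * \<alpha>))) < \<alpha> * ((b\<^sup>2 - x\<^sup>2) * (x powr (2 * \<alpha>) - a powr (2 * \<alpha>)))"
      by (simp add: mult_ac)
    then show ?thesis using \<alpha> by simp
  qed
  moreover have "upper_exit_prob \<alpha> a x b * b\<^sup>2 + (1 - upper_exit_prob \<alpha> a x b) * a\<^sup>2 - x\<^sup>2
     = ((b\<^sup>2 - x\<^sup>2) * (x powr (2 * \<alpha>) - a powr (2 * \<alpha>)) - (x\<^sup>2 - a\<^sup>2) * (b powr (2 * \<alpha>) - x powr (2 * \<alpha>)))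
       / (b powr (2 * \<alpha>) - a powr (2 * \<alpha>))"
    using * unfolding upper_exit_prob_def by (simp add: divide_simps) (simp add: algebra_simps)
  ultimately have "0 < upper_exit_prob \<alpha> a x b * b\<^sup>2 + (1 - upper_exit_prob \<alpha> a x b) * a\<^sup>2 - x\<^sup>2"
    using * by simp
  then show ?thesis using \<alpha> by (simp add: mean_exit_time_def)
qed

lemma mean_exit_time_le:
  assumes "0 \<le> a" "a < x" "x < b"
  shows "mean_exit_time \<alpha> a x b \<le> upper_exit_prob \<alpha> a x b * (b\<^sup>2 - a\<^sup>2) / (2 - 2 * \<alpha>)"
    and "mean_exit_time \<alpha> a x b \<le> (b\<^sup>2 - a\<^sup>2) / (2 - 2 * \<alpha>)"
proof -
  define p where "p = upper_exit_prob \<alpha> a x b"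
  have p: "0 < p" "p < 1" using upper_exit_prob_bounds[OF assms] by (auto simp: p_def)
  have sq: "a\<^sup>2 \<le> x\<^sup>2" "x\<^sup>2 \<le> b\<^sup>2" using assms by (auto intro!: power_mono)
  have "p * b\<^sup>2 + (1 - p) * a\<^sup>2 - x\<^sup>2 \<le> p * (b\<^sup>2 - a\<^sup>2)"
    using sq by (simp add: algebra_simps)
  moreover have "p * (b\<^sup>2 - a\<^sup>2) \<le> 1 * (b\<^sup>2 - a\<^sup>2)"
    using sq p by (intro mult_right_mono) auto
  ultimately show "mean_exit_time \<alpha> a x b \<le> upper_exit_prob \<alpha> a x b * (b\<^sup>2 - a\<^sup>2) / (2 - 2 * \<alpha>)"
    and "mean_exit_time \<alpha> a x b \<le> (b\<^sup>2 - a\<^sup>2) / (2 - 2 * \<alpha>)"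
    unfolding mean_exit_time_def p_def[symmetric] using \<alpha> by (auto intro!: divide_right_mono)
qed

lemma exit_mean_scale:
  assumes "0 < r" "0 \<le> a" "0 \<le> x" "0 \<le> b"
  shows "upper_exit_prob \<alpha> (r * a) (r * x) (r * b) = upper_exit_prob \<alpha> a x b"
    and "mean_exit_time \<alpha> (r * a) (r * x) (r * b) = r\<^sup>2 * mean_exit_time \<alpha> a x b"
proof -
  show *: "upper_exit_prob \<alpha> (r * a) (r * x) (r * b) = upper_exit_prob \<alpha> a x b"
    unfolding upper_exit_prob_def using assms
    by (simp add: powr_mult flip: right_diff_distrib)
  show "mean_exit_time \<alpha> (r * a) (r * x) (r * b) = r\<^sup>2 * mean_exit_time \<alpha> a x b"
    unfolding mean_exit_time_def * by (simp add: power_mult_distrib algebra_simps)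
qed

text \<open>
  Brownian scaling: exit probabilities are invariant under dilations, and exit times scale by the square.
\<close>

lemma killed_harmonic_scale:
  assumes f: "killed_harmonic \<alpha> 1 f" and l: "l > 0"
  shows "killed_harmonic \<alpha> l (\<lambda>x. f (sqrt l * x))"
proof -
  have *: "l * mean_exit_time \<alpha> a x b * (min (f (sqrt l * a)) (f (sqrt l * b)) * (1 - l * (b\<^sup>2 - a\<^sup>2) / (2 - 2 * \<alpha>)))
          \<le> exit_mean \<alpha> (\<lambda>x. f (sqrt l * x)) a x b - f (sqrt l * x) \<and>
        exit_mean \<alpha> (\<lambda>x. f (sqrt l * x)) a x b - f (sqrt l * x)
          \<le> l * mean_exit_time \<alpha> a x b * max (f (sqrt l * a)) (f (sqrt l * b))"
    if "0 \<le> a" "a < x" "x < b" for a x b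
  proof -
    define r where "r = sqrt l"
    have r: "r > 0" "r\<^sup>2 = l" using l by (auto simp: r_def)
    have e: "exit_mean \<alpha> (\<lambda>x. f (r * x)) a x b = exit_mean \<alpha> f (r * a) (r * x) (r * b)"
      unfolding exit_mean_def using exit_mean_scale(1)[of r a x b] r that by auto
    have m: "mean_exit_time \<alpha> (r * a) (r * x) (r * b) = l * mean_exit_time \<alpha> a x b"
      using exit_mean_scale(2)[of r a x b] r that by auto
    have s: "(r * b)\<^sup>2 - (r * a)\<^sup>2 = l * (b\<^sup>2 - a\<^sup>2)"
      by (simp add: power_mult_distrib r algebra_simps)
    have ord: "0 \<le> r * a" "r * a < r * x" "r * x < r * b" using that r by auto
    have "1 * mean_exit_time \<alpha> (r * a) (r * x) (r * b) * (min (f (r * a)) (f (r * b)) * (1 - 1 * ((r * b)\<^sup>2 - (r * a)\<^sup>2) / (2 - 2 * \<alpha>)))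
          \<le> exit_mean \<alpha> f (r * a) (r * x) (r * b) - f (r * x) \<and>
        exit_mean \<alpha> f (r * a) (r * x) (r * b) - f (r * x)
          \<le> 1 * mean_exit_time \<alpha> (r * a) (r * x) (r * b) * max (f (r * a)) (f (r * b))"
      using f ord unfolding killed_harmonic_def by blast
    then show ?thesis
      unfolding r_def[symmetric] e m s by simp
  qed
  have "0 \<le> f (sqrt l * x) \<and> f (sqrt l * x) \<le> 1" if "x \<ge> 0" for x
    using f that l unfolding killed_harmonic_def by simp
  moreover have "f (sqrt l * 0) = 1"
    using f unfolding killed_harmonic_def by simp
  ultimately show ?thesis
    unfolding killed_harmonic_def using * by blast
qed

context
  fixes l :: real
  assumes l: "l > 0"
begin

lemma killed_harmonic_range:
  assumes "killed_harmonic \<alpha> l f" "x \<ge> 0"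
  shows "0 \<le> f x" "f x \<le> 1"
  using assms unfolding killed_harmonic_def by auto

lemma killed_harmonic_exit:
  assumes "killed_harmonic \<alpha> l f" "0 \<le> a" "a < x" "x < b"
  shows "l * mean_exit_time \<alpha> a x b * (min (f a) (f b) * (1 - l * (b\<^sup>2 - a\<^sup>2) / (2 - 2 * \<alpha>)))
          \<le> exit_mean \<alpha> f a x b - f x"
    and "exit_mean \<alpha> f a x b - f x \<le> l * mean_exit_time \<alpha> a x b * max (f a) (f b)"
  using assms unfolding killed_harmonic_def by blast+

lemma killed_harmonic_exit_abs:
  assumes f: "killed_harmonic \<alpha> l f" and ord: "0 \<le> a" "a < x" "x < b"
  shows "\<bar>exit_mean \<alpha> f a x b - f x\<bar> \<le> l * mean_exit_time \<alpha> a x b * (1 + l * (b\<^sup>2 - a\<^sup>2) / (2 - 2 * \<alpha>))"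
proof -
  define K where "K = l * (b\<^sup>2 - a\<^sup>2) / (2 - 2 * \<alpha>)"
  define e where "e = l * mean_exit_time \<alpha> a x b"
  have e: "e > 0" using mean_exit_time_pos[OF ord] l by (simp add: e_def)
  have "a\<^sup>2 \<le> b\<^sup>2" using ord by (intro power_mono) auto
  then have K: "K \<ge> 0" unfolding K_def using l \<alpha> by auto
  have m: "0 \<le> min (f a) (f b)" "min (f a) (f b) \<le> 1" "max (f a) (f b) \<le> 1"
    using killed_harmonic_range[OF f, of a] killed_harmonic_range[OF f, of b] ord by auto
  have "- (1 + K) \<le> min (f a) (f b) * (1 - K)"
  proof -
    have "min (f a) (f b) * K \<le> 1 * K" using m K by (intro mult_right_mono) auto
    then show ?thesis using m by (simp add: algebra_simps)
  qed
  then have "e * - (1 + K) \<le> e * (min (f a) (f b) * (1 - K))"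
    using e by (intro mult_left_mono) auto
  moreover have "e * max (f a) (f b) \<le> e * (1 + K)"
    using e m K by (intro mult_left_mono) auto
  ultimately show ?thesis
    using killed_harmonic_exit[OF f ord] unfolding e_def[symmetric] K_def[symmetric] abs_le_iff
    by (simp add: algebra_simps)
qed

text \<open>
  Let the starting point tend to one end of a fixed interval \<open>(a, b)\<close>: the mean exit time tends to \<open>0\<close>, and
  the exit place tends to that end.
\<close>

lemma killed_harmonic_continuous:
  assumes f: "killed_harmonic \<alpha> l f"
  shows "continuous_on {0..} f"
proof -
  have cp: "continuous_on {0..} (\<lambda>x. upper_exit_prob \<alpha> a x b)" for a b
    unfolding upper_exit_prob_def divide_inverse
    using \<alpha> by (intro continuous_intros continuous_on_powr') auto
  have ce: "continuous_on {0..} (\<lambda>x. mean_exit_time \<alpha> a x b)" for a b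
    unfolding mean_exit_time_def divide_inverse by (intro continuous_intros cp)
  have lim: "(f \<longlongrightarrow> f x0) (at x0 within {a<..<b})"
    if x0: "x0 = a \<or> x0 = b" and ab: "0 \<le> a" "a < b" for a b x0
  proof -
    define K where "K = 1 + l * (b\<^sup>2 - a\<^sup>2) / (2 - 2 * \<alpha>)"
    have nz: "a powr (2 * \<alpha>) < b powr (2 * \<alpha>)"
      using ab \<alpha> by (intro powr_less_mono2) auto
    have p0: "exit_mean \<alpha> f a x0 b = f x0" "mean_exit_time \<alpha> a x0 b = 0"
      using x0 nz by (auto simp: exit_mean_def mean_exit_time_def upper_exit_prob_def)
    have sub: "{a<..<b} \<subseteq> {0..}" "x0 \<in> {0..}" using ab x0 by auto
    have lims: "((\<lambda>x. upper_exit_prob \<alpha> a x b) \<longlongrightarrow> upper_exit_prob \<alpha> a x0 b) (at x0 within {a<..<b})"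
      "((\<lambda>x. mean_exit_time \<alpha> a x b) \<longlongrightarrow> mean_exit_time \<alpha> a x0 b) (at x0 within {a<..<b})"
      using cp[of a b] ce[of a b] sub
      by (auto simp: continuous_on_def intro: tendsto_within_subset)
    have lo: "((\<lambda>x. exit_mean \<alpha> f a x b - l * mean_exit_time \<alpha> a x b * K) \<longlongrightarrow>
        exit_mean \<alpha> f a x0 b - l * mean_exit_time \<alpha> a x0 b * K) (at x0 within {a<..<b})"
      and hi: "((\<lambda>x. exit_mean \<alpha> f a x b + l * mean_exit_time \<alpha> a x b * K) \<longlongrightarrow>
        exit_mean \<alpha> f a x0 b + l * mean_exit_time \<alpha> a x0 b * K) (at x0 within {a<..<b})"
      unfolding exit_mean_def by (intro tendsto_intros lims)+
    have bd: "\<bar>exit_mean \<alpha> f a x b - f x\<bar> \<le> l * mean_exit_time \<alpha> a x b * K" if "x \<in> {a<..<b}" for x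
      using killed_harmonic_exit_abs[OF f ab(1), of x b] that by (simp add: K_def)
    show ?thesis
    proof (rule tendsto_sandwich)
      show "eventually (\<lambda>x. exit_mean \<alpha> f a x b - l * mean_exit_time \<alpha> a x b * K \<le> f x) (at x0 within {a<..<b})"
        and "eventually (\<lambda>x. f x \<le> exit_mean \<alpha> f a x b + l * mean_exit_time \<alpha> a x b * K) (at x0 within {a<..<b})"
        unfolding eventually_at_topological
        using bd by (auto simp: abs_le_iff intro!: exI[of _ UNIV]) (smt (verit) bd greaterThanLessThan_iff)+
    qed (use lo hi p0 in simp_all)
  qed
  have right: "(f \<longlongrightarrow> f x0) (at_right x0)" if "x0 \<ge> 0" for x0
  proof -
    have "at x0 within {x0<..<x0 + 1} = at_right x0"
      by (rule at_within_nhd[of x0 "{..<x0 + 1}"]) auto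
    then show ?thesis using lim[of x0 x0 "x0 + 1"] that by simp
  qed
  have left: "(f \<longlongrightarrow> f x0) (at_left x0)" if "x0 > 0" for x0
  proof -
    have "at x0 within {0<..<x0} = at_left x0"
      by (rule at_within_nhd[of x0 "{0<..}"]) (use that in auto)
    then show ?thesis using lim[of x0 0 x0] that by simp
  qed
  show ?thesis
    unfolding continuous_on_def
  proof
    fix x0 :: real assume x0: "x0 \<in> {0..}"
    show "(f \<longlongrightarrow> f x0) (at x0 within {0..})"
    proof (cases "x0 = 0")
      case True
      then show ?thesis using right[of 0] by (simp add: at_within_Ici_at_right)
    next
      case False
      then have "(f \<longlongrightarrow> f x0) (at x0)"
        using x0 by (intro filterlim_split_at left right) auto
      then show ?thesis by (rule tendsto_within_subset) simp
    qed
  qed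
qed

text \<open>
  A maximum principle. Subtracting \<open>\<delta> (1 + \<eta> x\<^sup>2)\<close> from \<open>f - g\<close> forces the maximum to be attained; the
  generator sends this barrier to the constant \<open>\<delta> l / 2\<close>. At a maximum inside \<open>(0, \<infinity>)\<close> the exit mean cannot
  exceed the value, so \<open>l (f - g) \<le> \<delta> l / 2\<close> there, while a positive maximum requires \<open>f - g > \<delta>\<close>.
\<close>

lemma killed_harmonic_le:
  assumes f: "killed_harmonic \<alpha> l f" and g: "killed_harmonic \<alpha> l g" and x: "x \<ge> 0"
  shows "f x \<le> g x"
proof -
  define \<eta> where "\<eta> = l / (2 * (2 - 2 * \<alpha>))"
  have \<eta>: "\<eta> > 0" "\<eta> * (2 - 2 * \<alpha>) = l / 2" using l \<alpha> by (auto simp: \<eta>_def field_simps)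
  have "f x - g x \<le> \<delta> * (1 + \<eta> * x\<^sup>2)" if \<delta>: "\<delta> > 0" for \<delta>
  proof (rule ccontr)
    assume neg: "\<not> ?thesis"
    define D where "D y = f y - g y - \<delta> * (1 + \<eta> * y\<^sup>2)" for y
    have Dx: "D x > 0" using neg by (simp add: D_def)
    \<comment> \<open>Beyond \<open>B\<close> the barrier exceeds \<open>1 \<ge> f - g\<close>, so the maximum over \<open>[0, B]\<close> is attained inside.\<close>
    define B where "B = max (x + 1) (sqrt (1 / (\<delta> * \<eta>)))"
    have B: "B > x" "B > 0" using x by (auto simp: B_def)
    have "1 / (\<delta> * \<eta>) \<le> B\<^sup>2"
      using \<delta> \<eta> by (intro sqrt_le_D) (auto simp: B_def)
    then have "1 \<le> \<delta> * \<eta> * B\<^sup>2" using \<delta> \<eta> by (simp add: field_simps)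
    then have DB: "D B < 0"
      using killed_harmonic_range[OF f, of B] killed_harmonic_range[OF g, of B] B \<delta> by (simp add: D_def algebra_simps)
    have D0: "D 0 < 0" using f g \<delta> by (simp add: D_def killed_harmonic_def)
    have contD: "continuous_on {0..B} D"
      unfolding D_def
      by (intro continuous_intros continuous_on_subset[OF killed_harmonic_continuous[OF f]]
            continuous_on_subset[OF killed_harmonic_continuous[OF g]]) auto
    obtain x0 where x0: "x0 \<in> {0..B}" "\<And>y. y \<in> {0..B} \<Longrightarrow> D y \<le> D x0"
      using continuous_attains_sup[OF compact_Icc _ contD] B by auto
    have Dx0: "D x0 > 0" using x0(2)[of x] Dx B x by auto
    have x0': "0 < x0" "x0 < B"
      using x0(1) Dx0 D0 DB by (auto simp: less_le)
    define F where "F r = min (f (x0 - r)) (f (x0 + r)) * (1 - l * ((x0 + r)\<^sup>2 - (x0 - r)\<^sup>2) / (2 - 2 * \<alpha>))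
        - max (g (x0 - r)) (g (x0 + r))" for r
    have step: "F r \<le> \<delta> / 2" if r: "0 < r" "r < min x0 (B - x0)" for r
    proof -
      define a b where "a = x0 - r" and "b = x0 + r"
      have ord: "0 \<le> a" "a < x0" "x0 < b" "b \<le> B" using r by (auto simp: a_def b_def)
      define p where "p = upper_exit_prob \<alpha> a x0 b"
      have p: "0 < p" "p < 1" using upper_exit_prob_bounds[of a x0 b] ord by (auto simp: p_def)
      define e where "e = mean_exit_time \<alpha> a x0 b"
      have e: "e > 0" using mean_exit_time_pos[of a x0 b] ord by (auto simp: e_def)
      have "p * D b + (1 - p) * D a \<le> p * D x0 + (1 - p) * D x0"
        using p ord x0 by (intro add_mono mult_left_mono) auto
      then have "p * D b + (1 - p) * D a \<le> D x0" by (simp add: algebra_simps)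
      moreover have "p * D b + (1 - p) * D a - D x0
         = (exit_mean \<alpha> f a x0 b - f x0) - (exit_mean \<alpha> g a x0 b - g x0) - \<delta> * \<eta> * (p * b\<^sup>2 + (1 - p) * a\<^sup>2 - x0\<^sup>2)"
        unfolding D_def exit_mean_def p_def[symmetric] by (simp add: algebra_simps)
      moreover have "p * b\<^sup>2 + (1 - p) * a\<^sup>2 - x0\<^sup>2 = e * (2 - 2 * \<alpha>)"
        unfolding e_def mean_exit_time_def p_def using \<alpha> by simp
      moreover have "\<delta> * \<eta> * (e * (2 - 2 * \<alpha>)) = \<delta> * (l / 2) * e"
        unfolding \<eta>(2)[symmetric] by simp
      ultimately have "(exit_mean \<alpha> f a x0 b - f x0) - (exit_mean \<alpha> g a x0 b - g x0) \<le> \<delta> * (l / 2) * e"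
        by simp
      moreover have "l * e * (min (f a) (f b) * (1 - l * (b\<^sup>2 - a\<^sup>2) / (2 - 2 * \<alpha>))) - l * e * max (g a) (g b)
          \<le> (exit_mean \<alpha> f a x0 b - f x0) - (exit_mean \<alpha> g a x0 b - g x0)"
        using killed_harmonic_exit(1)[OF f ord(1-3)] killed_harmonic_exit(2)[OF g ord(1-3)]
        by (simp add: e_def)
      moreover have "l * e * (min (f a) (f b) * (1 - l * (b\<^sup>2 - a\<^sup>2) / (2 - 2 * \<alpha>))) - l * e * max (g a) (g b) = (l * e) * F r"
        unfolding F_def a_def b_def by (simp add: right_diff_distrib)
      ultimately have "(l * e) * F r \<le> (l * e) * (\<delta> / 2)" by (simp add: algebra_simps)
      then show ?thesis using e l by simp
    qed
    have tend: "((\<lambda>r. h (x0 - r)) \<longlongrightarrow> h x0) (at_right 0)" "((\<lambda>r. h (x0 + r)) \<longlongrightarrow> h x0) (at_right 0)"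
      if "killed_harmonic \<alpha> l h" for h
    proof -
      have c: "isCont h x0"
        using killed_harmonic_continuous[OF that] x0'
        by (auto intro: continuous_on_interior)
      have "((\<lambda>r. x0 - r) \<longlongrightarrow> x0 - 0) (at_right 0)" "((\<lambda>r. x0 + r) \<longlongrightarrow> x0 + 0) (at_right 0)"
        by (intro tendsto_intros)+
      then show "((\<lambda>r. h (x0 - r)) \<longlongrightarrow> h x0) (at_right 0)" "((\<lambda>r. h (x0 + r)) \<longlongrightarrow> h x0) (at_right 0)"
        using isCont_tendsto_compose[OF c] by auto
    qed
    have "(F \<longlongrightarrow> min (f x0) (f x0) * (1 - l * ((x0 + 0)\<^sup>2 - (x0 - 0)\<^sup>2) / (2 - 2 * \<alpha>)) - max (g x0) (g x0)) (at_right 0)"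
      unfolding F_def by (intro tendsto_intros tend f g) (use \<alpha> in auto)
    then have "(F \<longlongrightarrow> f x0 - g x0) (at_right 0)" by simp
    moreover have "eventually (\<lambda>r. F r \<le> \<delta> / 2) (at_right 0)"
      using x0' by (intro eventually_at_rightI[of 0 "min x0 (B - x0)"] step) auto
    ultimately have "f x0 - g x0 \<le> \<delta> / 2"
      by (intro tendsto_upperbound[of F]) auto
    moreover have "f x0 - g x0 > \<delta>"
      using Dx0 \<delta> \<eta> by (simp add: D_def algebra_simps) (smt (verit) mult_nonneg_nonneg zero_le_power2)
    ultimately show False using \<delta> by simp
  qed
  note * = this
  have "f x - g x \<le> 0"
  proof (rule field_le_epsilon)
    fix e :: real assume "e > 0"
    then have "f x - g x \<le> e / (1 + \<eta> * x\<^sup>2) * (1 + \<eta> * x\<^sup>2)"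
      using \<eta> by (intro *) (auto intro!: divide_pos_pos add_pos_nonneg)
    also have "\<dots> = e"
      using \<eta> by (simp add: add_nonneg_eq_0_iff)
    finally show "f x - g x \<le> 0 + e" by simp
  qed
  then show ?thesis by simp
qed

end

lemma killed_harmonic_unique:
  assumes "l > 0" "killed_harmonic \<alpha> l f" "killed_harmonic \<alpha> l g" "x \<ge> 0"
  shows "f x = g x"
  using killed_harmonic_le[OF assms(1,2,3,4)] killed_harmonic_le[OF assms(1,3,2,4)] by simp

text \<open>
  Exits from \<open>(0, b)\<close> compare the quotient at \<open>x\<close> and at \<open>b\<close>. The lower bound shows that it decreases near
  \<open>0\<close>, strictly where \<open>f > 0\<close>, and the upper bound that it stays bounded. Hence it has a positive limit.
\<close>

lemma killed_harmonic_asymptotics: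
  assumes f: "killed_harmonic \<alpha> 1 f"
  shows "\<exists>c>0. ((\<lambda>x. (1 - f x) / x powr (2 * \<alpha>)) \<longlongrightarrow> c) (at_right 0)"
proof -
  define R where "R x = (1 - f x) / x powr (2 * \<alpha>)" for x
  \<comment> \<open>For \<open>b \<le> b0\<close> the factor \<open>1 - b\<^sup>2 / (2 - 2 \<alpha>)\<close> of the lower bound is at least \<open>1 / 2\<close>.\<close>
  define b0 where "b0 = sqrt (1 - \<alpha>)"
  have b0: "b0 > 0" "b0\<^sup>2 = 1 - \<alpha>" using \<alpha> by (auto simp: b0_def)
  have q: "exit_mean \<alpha> f 0 x b - f x = x powr (2 * \<alpha>) * (R x - R b)" if "0 < x" "x < b" for x b
  proof -
    have "f 0 = 1" using f by (simp add: killed_harmonic_def)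
    then show ?thesis
      using that unfolding exit_mean_def upper_exit_prob_def R_def
      by (simp add: field_simps)
  qed
  have strict: "R b < R x" if "0 < x" "x < b" "b \<le> b0" "f b > 0" for x b
  proof -
    have "b\<^sup>2 \<le> 1 - \<alpha>" using that b0 power_mono[of b b0 2] by auto
    then have "0 < 1 - 1 * (b\<^sup>2 - 0\<^sup>2) / (2 - 2 * \<alpha>)" using \<alpha> by (simp add: field_simps)
    then have "0 < 1 * mean_exit_time \<alpha> 0 x b * (min (f 0) (f b) * (1 - 1 * (b\<^sup>2 - 0\<^sup>2) / (2 - 2 * \<alpha>)))"
      using mean_exit_time_pos[of 0 x b] that f by (auto intro!: mult_pos_pos simp: killed_harmonic_def)
    also have "\<dots> \<le> x powr (2 * \<alpha>) * (R x - R b)"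
      using killed_harmonic_exit(1)[OF _ f, of 0 x b] that q[of x b] by simp
    finally show ?thesis using that by (simp add: zero_less_mult_iff)
  qed
  have mono: "R b \<le> R x" if "0 < x" "x < b" "b \<le> b0" for x b
  proof -
    have "b\<^sup>2 \<le> 1 - \<alpha>" using that b0 power_mono[of b b0 2] by auto
    then have "0 < 1 - 1 * (b\<^sup>2 - 0\<^sup>2) / (2 - 2 * \<alpha>)" using \<alpha> by (simp add: field_simps)
    then have "0 \<le> 1 * mean_exit_time \<alpha> 0 x b * (min (f 0) (f b) * (1 - 1 * (b\<^sup>2 - 0\<^sup>2) / (2 - 2 * \<alpha>)))"
      using mean_exit_time_pos[of 0 x b] that f by (auto intro!: mult_nonneg_nonneg simp: killed_harmonic_def)
    also have "\<dots> \<le> x powr (2 * \<alpha>) * (R x - R b)"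
      using killed_harmonic_exit(1)[OF _ f, of 0 x b] that q[of x b] by simp
    finally show ?thesis using that by (simp add: zero_le_mult_iff)
  qed
  have upper: "R x \<le> R b0 + 1 / (2 * b0 powr (2 * \<alpha>))" if "0 < x" "x < b0" for x
  proof -
    have up: "upper_exit_prob \<alpha> 0 x b0 = x powr (2 * \<alpha>) / b0 powr (2 * \<alpha>)"
      by (simp add: upper_exit_prob_def)
    have "mean_exit_time \<alpha> 0 x b0 \<le> upper_exit_prob \<alpha> 0 x b0 * (b0\<^sup>2 - 0\<^sup>2) / (2 - 2 * \<alpha>)"
      using that by (intro mean_exit_time_le) auto
    also have "\<dots> = x powr (2 * \<alpha>) * (1 / (2 * b0 powr (2 * \<alpha>)))"
      unfolding b0 up using \<alpha> b0(1) by (simp add: divide_simps)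
    finally have e: "mean_exit_time \<alpha> 0 x b0 \<le> x powr (2 * \<alpha>) * (1 / (2 * b0 powr (2 * \<alpha>)))" .
    have "x powr (2 * \<alpha>) * (R x - R b0) \<le> 1 * mean_exit_time \<alpha> 0 x b0 * max (f 0) (f b0)"
      using killed_harmonic_exit(2)[OF _ f, of 0 x b0] that q[of x b0] by simp
    also have "max (f 0) (f b0) = 1"
    proof -
      have "f b0 \<le> 1" using killed_harmonic_range(2)[OF _ f, of b0] b0 by simp
      moreover have "f 0 = 1" using f by (simp add: killed_harmonic_def)
      ultimately show ?thesis by simp
    qed
    finally have "x powr (2 * \<alpha>) * (R x - R b0) \<le> x powr (2 * \<alpha>) * (1 / (2 * b0 powr (2 * \<alpha>)))"
      using e by simp
    then have "R x - R b0 \<le> 1 / (2 * b0 powr (2 * \<alpha>))"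
      using that by (subst (asm) mult_le_cancel_left_pos) auto
    then show ?thesis by simp
  qed
  define c where "c = (SUP x\<in>{0<..<b0}. R x)"
  have bdd: "bdd_above (R ` {0<..<b0})"
    using upper by (intro bdd_aboveI[of _ "R b0 + 1 / (2 * b0 powr (2 * \<alpha>))"]) auto
  have le_c: "R x \<le> c" if "0 < x" "x < b0" for x
    unfolding c_def using that by (intro cSUP_upper bdd) auto
  have "(R \<longlongrightarrow> c) (at_right 0)"
  proof (rule order_tendstoI)
    fix u assume "u < c"
    then obtain x1 where x1: "x1 \<in> {0<..<b0}" "u < R x1"
      unfolding c_def using b0 bdd by (subst (asm) less_cSUP_iff) auto
    show "eventually (\<lambda>x. u < R x) (at_right 0)"
    proof (rule eventually_at_rightI[of 0 x1])
      fix x assume "x \<in> {0<..<x1}"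
      then show "u < R x" using mono[of x x1] x1 by auto
    qed (use x1 in auto)
  next
    fix u assume "c < u"
    then show "eventually (\<lambda>x. R x < u) (at_right 0)"
      using b0 le_c by (intro eventually_at_rightI[of 0 b0]) fastforce+
  qed
  moreover have "c > 0"
  proof -
    \<comment> \<open>Either \<open>f b > 0\<close> and the quotient decreases strictly, or \<open>f b = 0\<close> and it is positive already at \<open>b\<close>.\<close>
    obtain b where b: "0 < b" "b < b0" "R b \<ge> 0" "f b > 0 \<or> R b > 0"
    proof
      show "0 < b0 / 2" "b0 / 2 < b0" using b0 by auto
      show "R (b0 / 2) \<ge> 0" using killed_harmonic_range[OF _ f, of "b0 / 2"] b0 by (simp add: R_def)
      show "f (b0 / 2) > 0 \<or> R (b0 / 2) > 0"
        using killed_harmonic_range[OF _ f, of "b0 / 2"] b0 by (cases "f (b0 / 2) = 0") (auto simp: R_def)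
    qed
    have "R (b / 2) > 0"
      using b(4)
    proof
      assume "f b > 0"
      then have "R b < R (b / 2)" using b by (intro strict) auto
      then show ?thesis using b by simp
    next
      assume "R b > 0"
      then show ?thesis using mono[of "b / 2" b] b by simp
    qed
    also have "R (b / 2) \<le> c" using b by (intro le_c) auto
    finally show ?thesis .
  qed
  ultimately show ?thesis unfolding R_def by blast
qed

text \<open>
  By scaling and uniqueness every solution at rate \<open>l\<close> is \<open>f (sqrt l x)\<close>, which leaves one constant for all rates.
\<close>

lemma killed_harmonic_rate:
  assumes f: "killed_harmonic \<alpha> 1 f"
  shows "\<exists>c>0. \<forall>l>0. \<forall>g. killed_harmonic \<alpha> l g \<longrightarrow>
      ((\<lambda>x. (1 - g x) / x powr (2 * \<alpha>)) \<longlongrightarrow> c * l powr \<alpha>) (at_right 0)"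
proof -
  obtain c where c: "c > 0" "((\<lambda>x. (1 - f x) / x powr (2 * \<alpha>)) \<longlongrightarrow> c) (at_right 0)"
    using killed_harmonic_asymptotics[OF f] by blast
  have "((\<lambda>x. (1 - g x) / x powr (2 * \<alpha>)) \<longlongrightarrow> c * l powr \<alpha>) (at_right 0)"
    if l: "l > 0" and g: "killed_harmonic \<alpha> l g" for l g
  proof -
    have geq: "g x = f (sqrt l * x)" if "x > 0" for x
      using killed_harmonic_unique[OF l g killed_harmonic_scale[OF f l], of x] that by simp
    have "filterlim (\<lambda>x. sqrt l * x) (at_right 0) (at_right 0)"
      unfolding filterlim_at
    proof
      show "((\<lambda>x. sqrt l * x) \<longlongrightarrow> 0) (at_right 0)"
        by (rule tendsto_eq_intros refl | simp)+
      show "eventually (\<lambda>x. sqrt l * x \<in> {0<..} \<and> sqrt l * x \<noteq> 0) (at_right 0)"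
        using l by (intro eventually_at_rightI[of 0 1]) auto
    qed
    from filterlim_compose[OF c(2) this]
    have "((\<lambda>x. (1 - f (sqrt l * x)) / (sqrt l * x) powr (2 * \<alpha>) * l powr \<alpha>) \<longlongrightarrow> c * l powr \<alpha>) (at_right 0)"
      by (intro tendsto_intros)
    moreover have "eventually (\<lambda>x. (1 - f (sqrt l * x)) / (sqrt l * x) powr (2 * \<alpha>) * l powr \<alpha>
       = (1 - g x) / x powr (2 * \<alpha>)) (at_right 0)"
    proof (rule eventually_at_rightI[of 0 1])
      fix x :: real assume x: "x \<in> {0<..<1}"
      have "sqrt l powr (2 * \<alpha>) = l powr \<alpha>"
        using l by (simp add: powr_half_sqrt[symmetric] powr_powr)
      then have "(sqrt l * x) powr (2 * \<alpha>) = l powr \<alpha> * x powr (2 * \<alpha>)"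
        using x l by (simp add: powr_mult)
      then show "(1 - f (sqrt l * x)) / (sqrt l * x) powr (2 * \<alpha>) * l powr \<alpha> = (1 - g x) / x powr (2 * \<alpha>)"
        using x l geq[of x] by simp
    qed simp
    ultimately show ?thesis by (rule Lim_transform_eventually)
  qed
  then show ?thesis using c(1) by blast
qed

end

section \<open>Path space, hitting times and the strong Markov property\<close>

text \<open>
  Hitting times and occupation times are not measurable for the product \<open>\<sigma>\<close>-algebra over uncountably many
  times, but they are for its trace on the continuous paths, where countably many times determine a path.
\<close>

definition path_space :: "(real \<Rightarrow> real) measure" where
  "path_space = restrict_space (PiM {0..} (\<lambda>_. borel)) {f. continuous_on {0..} f}"

abbreviation (input) coord :: "real \<Rightarrow> (real \<Rightarrow> real) \<Rightarrow> real" where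
  "coord t f \<equiv> f t"

abbreviation shift :: "real \<Rightarrow> (real \<Rightarrow> real) \<Rightarrow> (real \<Rightarrow> real)" where
  "shift \<equiv> path_after coord"

abbreviation history :: "ennreal \<Rightarrow> (real \<Rightarrow> real) measure" where
  "history \<equiv> natural_filtration path_space coord"

abbreviation hit :: "real \<Rightarrow> (real \<Rightarrow> real) \<Rightarrow> ennreal" where
  "hit \<equiv> hitting_time coord"

lemma path_space_continuous: "f \<in> space path_space \<Longrightarrow> continuous_on {0..} f"
  by (simp add: path_space_def space_restrict_space)

lemma space_path_space: "space path_space = {f \<in> extensional {0..}. continuous_on {0..} f}"
  by (auto simp: path_space_def space_restrict_space space_PiM PiE_def)

lemma measurable_coord: "t \<ge> 0 \<Longrightarrow> coord t \<in> borel_measurable path_space"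
  unfolding path_space_def by (intro measurable_restrict_space1 measurable_component_singleton) auto

lemma measurable_into_path_space:
  assumes "\<And>t. t \<ge> 0 \<Longrightarrow> (\<lambda>\<omega>. F \<omega> t) \<in> borel_measurable M"
    and "\<And>\<omega>. \<omega> \<in> space M \<Longrightarrow> F \<omega> \<in> space path_space"
  shows "F \<in> M \<rightarrow>\<^sub>M path_space"
  unfolding path_space_def
proof (rule measurable_restrict_space2)
  show "F \<in> space M \<rightarrow> {f. continuous_on {0..} f}"
    using assms(2) by (auto simp: space_path_space)
  show "F \<in> M \<rightarrow>\<^sub>M PiM {0..} (\<lambda>_. borel)"
  proof (rule measurable_PiM_single')
    show "F \<in> space M \<rightarrow> ({0..} \<rightarrow>\<^sub>E space borel)"
      using assms(2) by (auto simp: space_path_space PiE_def)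
  qed (use assms(1) in auto)
qed

lemma path_after_in_path_space:
  assumes "continuous_on {0..} (\<lambda>t. X t \<omega>)" "t \<ge> 0"
  shows "path_after X t \<omega> \<in> space path_space"
proof -
  have "continuous_on {0..} (\<lambda>s. X (t + s) \<omega>)"
    by (rule continuous_on_compose2[OF assms(1)]) (use assms(2) in \<open>auto intro!: continuous_intros\<close>)
  then have "continuous_on {0..} (path_after X t \<omega>)"
    by (rule continuous_on_cong[THEN iffD1, rotated -1]) (auto simp: path_after_def)
  then show ?thesis by (auto simp: space_path_space path_after_def)
qed

lemma path_after_apply: "s \<ge> 0 \<Longrightarrow> path_after X t \<omega> s = X (t + s) \<omega>"
  by (simp add: path_after_def)

lemma shift_path_after:
  "t \<ge> 0 \<Longrightarrow> shift t (path_after X 0 \<omega>) = path_after X t \<omega>"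
  by (auto simp: path_after_def fun_eq_iff)

text \<open>
  A continuous path is the limit of its step approximations along the grids of mesh \<open>1 / (n + 1)\<close>, which are
  jointly measurable. The maximum with \<open>0\<close> extends the time variable to the whole real line.
\<close>

lemma measurable_coord_pair:
  "(\<lambda>(s, f). f (max 0 s)) \<in> borel_measurable (borel \<Otimes>\<^sub>M path_space)"
proof (rule borel_measurable_LIMSEQ_metric)
  fix n :: nat
  have "(\<lambda>x. (\<lambda>i x. snd x (real i / real (Suc n))) (nat \<lfloor>real (Suc n) * max 0 (fst x)\<rfloor>) x)
      \<in> borel_measurable (borel \<Otimes>\<^sub>M path_space)"
  proof (rule measurable_compose_countable[where f = "\<lambda>i x. snd x (real i / real (Suc n))"])
    fix i :: nat
    show "(\<lambda>x. snd x (real i / real (Suc n))) \<in> borel_measurable (borel \<Otimes>\<^sub>M path_space)"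
      by (rule measurable_compose[OF measurable_snd measurable_coord]) simp
  qed measurable
  then show "(\<lambda>x. snd x (real (nat \<lfloor>real (Suc n) * max 0 (fst x)\<rfloor>) / real (Suc n)))
      \<in> borel_measurable (borel \<Otimes>\<^sub>M path_space)" by simp
next
  fix x :: "real \<times> (real \<Rightarrow> real)"
  assume x: "x \<in> space (borel \<Otimes>\<^sub>M path_space)"
  obtain s f where sf: "x = (s, f)" by (cases x)
  define u where "u = max 0 s"
  have f: "continuous_on {0..} f"
    using x unfolding sf by (auto simp: space_pair_measure path_space_continuous)
  have "(\<lambda>n. real (nat \<lfloor>real (Suc n) * u\<rfloor>) / real (Suc n)) \<longlonglongrightarrow> u"
  proof (rule tendsto_sandwich)
    have "(\<lambda>n. u - inverse (real (Suc n))) \<longlonglongrightarrow> u - 0"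
      by (intro tendsto_intros LIMSEQ_inverse_real_of_nat)
    then show "(\<lambda>n. u - inverse (real (Suc n))) \<longlonglongrightarrow> u" by simp
    have fl: "real (nat \<lfloor>real (Suc n) * u\<rfloor>) = of_int \<lfloor>real (Suc n) * u\<rfloor>" for n
      by (simp add: u_def del: of_nat_Suc)
    show "eventually (\<lambda>n. u - inverse (real (Suc n)) \<le> real (nat \<lfloor>real (Suc n) * u\<rfloor>) / real (Suc n)) sequentially"
    proof (intro always_eventually allI)
      fix n
      have "real (Suc n) * u - 1 \<le> of_int \<lfloor>real (Suc n) * u\<rfloor>" by linarith
      then have "(real (Suc n) * u - 1) / real (Suc n) \<le> of_int \<lfloor>real (Suc n) * u\<rfloor> / real (Suc n)"
        by (intro divide_right_mono) auto
      then show "u - inverse (real (Suc n)) \<le> real (nat \<lfloor>real (Suc n) * u\<rfloor>) / real (Suc n)"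
        unfolding fl by (simp add: diff_divide_distrib inverse_eq_divide del: of_nat_Suc)
    qed
    show "eventually (\<lambda>n. real (nat \<lfloor>real (Suc n) * u\<rfloor>) / real (Suc n) \<le> u) sequentially"
    proof (intro always_eventually allI)
      fix n
      have "of_int \<lfloor>real (Suc n) * u\<rfloor> \<le> u * real (Suc n)" by (simp add: mult.commute del: of_nat_Suc)
      then show "real (nat \<lfloor>real (Suc n) * u\<rfloor>) / real (Suc n) \<le> u"
        unfolding fl by (subst pos_divide_le_eq) auto
    qed
  qed simp
  from continuous_on_tendsto_compose[OF f this]
  show "(\<lambda>n. snd x (real (nat \<lfloor>real (Suc n) * max 0 (fst x)\<rfloor>) / real (Suc n))) \<longlonglongrightarrow> (case x of (s, f) \<Rightarrow> f (max 0 s))"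
    unfolding sf by (simp add: u_def)
qed

lemma measurable_coord_at:
  assumes S: "S \<in> borel_measurable N" and F: "F \<in> N \<rightarrow>\<^sub>M path_space"
    and nn: "\<And>x. x \<in> space N \<Longrightarrow> S x \<ge> 0"
  shows "(\<lambda>x. F x (S x)) \<in> borel_measurable N"
proof -
  have "(\<lambda>x. (\<lambda>(s, f). f (max 0 s)) (S x, F x)) \<in> borel_measurable N"
    by (rule measurable_compose[OF _ measurable_coord_pair]) (use S F in measurable)
  then show ?thesis
    by (rule measurable_cong[THEN iffD1, rotated]) (simp add: nn max_def)
qed

lemma measurable_shift:
  assumes S: "S \<in> borel_measurable N" and F: "F \<in> N \<rightarrow>\<^sub>M path_space"
    and nn: "\<And>x. x \<in> space N \<Longrightarrow> S x \<ge> 0"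
  shows "(\<lambda>x. shift (S x) (F x)) \<in> N \<rightarrow>\<^sub>M path_space"
proof (rule measurable_into_path_space)
  fix t :: real assume t: "t \<ge> 0"
  have "(\<lambda>x. F x (S x + t)) \<in> borel_measurable N"
    by (rule measurable_coord_at[OF _ F]) (use S nn t in \<open>auto simp: add_nonneg_nonneg\<close>)
  then show "(\<lambda>x. shift (S x) (F x) t) \<in> borel_measurable N"
    using t by (simp add: path_after_apply)
next
  fix x assume "x \<in> space N"
  then show "shift (S x) (F x) \<in> space path_space"
    using nn measurable_space[OF F] by (intro path_after_in_path_space) (auto simp: path_space_continuous)
qed

text \<open>
  By continuity the infimum defining the hitting time of a point is attained.
\<close>

lemma hitting_time_cases:
  assumes "continuous_on {0..} (\<lambda>t. X t \<omega>)"
  obtains (never) "hitting_time X y \<omega> = \<infinity>" "\<And>t. t \<ge> 0 \<Longrightarrow> X t \<omega> \<noteq> y"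
  | (at) s where "s \<ge> 0" "hitting_time X y \<omega> = ennreal s" "X s \<omega> = y" "\<And>t. 0 \<le> t \<Longrightarrow> t < s \<Longrightarrow> X t \<omega> \<noteq> y"
proof -
  define H where "H = {t. 0 \<le> t \<and> X t \<omega> = y}"
  have ht: "hitting_time X y \<omega> = Inf (ennreal ` H)"
    unfolding hitting_time_def H_def by (rule arg_cong[of _ _ Inf]) auto
  show thesis
  proof (cases "H = {}")
    case True
    then show ?thesis using ht never by (auto simp: H_def)
  next
    case False
    have "closed H"
      using continuous_closed_preimage[OF assms, of "{y}"]
      by (simp add: H_def vimage_def Int_def)
    moreover have bdd: "bdd_below H" by (rule bdd_belowI[of _ 0]) (auto simp: H_def)
    ultimately have m: "Inf H \<in> H" using False by (intro closed_contains_Inf)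
    have "Inf (ennreal ` H) = ennreal (Inf H)"
    proof (rule antisym)
      show "Inf (ennreal ` H) \<le> ennreal (Inf H)" using m by (intro Inf_lower) auto
      show "ennreal (Inf H) \<le> Inf (ennreal ` H)"
        by (intro Inf_greatest) (auto intro!: ennreal_leI cInf_lower bdd)
    qed
    then show ?thesis
      using at[of "Inf H"] m ht cInf_lower[OF _ bdd] by (auto simp: H_def not_le[symmetric])
  qed
qed

lemma hitting_time_le_iff:
  assumes "continuous_on {0..} (\<lambda>t. X t \<omega>)" "t \<ge> 0"
  shows "hitting_time X y \<omega> \<le> ennreal t \<longleftrightarrow> (\<exists>s\<in>{0..t}. X s \<omega> = y)"
proof
  assume "hitting_time X y \<omega> \<le> ennreal t"
  with assms(1) show "\<exists>s\<in>{0..t}. X s \<omega> = y"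
    by (cases rule: hitting_time_cases[of X \<omega> y]) (use assms(2) in \<open>auto simp: top_unique\<close>)
next
  assume "\<exists>s\<in>{0..t}. X s \<omega> = y"
  then obtain s where "0 \<le> s" "s \<le> t" "X s \<omega> = y" by auto
  then have "hitting_time X y \<omega> \<le> ennreal s"
    unfolding hitting_time_def by (intro Inf_lower) auto
  also have "\<dots> \<le> ennreal t" using \<open>s \<le> t\<close> by (rule ennreal_leI)
  finally show "hitting_time X y \<omega> \<le> ennreal t" .
qed

text \<open>
  By compactness it is enough to come arbitrarily close to \<open>y\<close> at rational times; this makes hitting \<open>y\<close>
  before \<open>t\<close> an event of the natural filtration at time \<open>t\<close>.
\<close>

lemma attains_iff_rational_approx:
  fixes f :: "real \<Rightarrow> real"
  assumes f: "continuous_on {0..t} f" and t: "t \<ge> 0"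
  shows "(\<exists>s\<in>{0..t}. f s = y) \<longleftrightarrow> (\<forall>n. \<exists>q\<in>\<rat> \<inter> {0..t}. \<bar>f q - y\<bar> < 1 / real (Suc n))"
proof
  assume "\<exists>s\<in>{0..t}. f s = y"
  then obtain s where s: "s \<in> {0..t}" "f s = y" by auto
  show "\<forall>n. \<exists>q\<in>\<rat> \<inter> {0..t}. \<bar>f q - y\<bar> < 1 / real (Suc n)"
  proof
    fix n
    show "\<exists>q\<in>\<rat> \<inter> {0..t}. \<bar>f q - y\<bar> < 1 / real (Suc n)"
    proof (cases "t = 0")
      case True
      then show ?thesis using s by (intro bexI[of _ 0]) auto
    next
      case False
      then have t: "t > 0" using t by simp
      obtain d where d: "d > 0" "\<And>x. x \<in> {0..t} \<Longrightarrow> dist x s < d \<Longrightarrow> dist (f x) (f s) < 1 / real (Suc n)"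
        using f s(1) unfolding continuous_on_iff by (metis zero_less_divide_1_iff of_nat_0_less_iff zero_less_Suc)
      have "max 0 (s - d) < min t (s + d)" using s d t by auto
      then obtain q where q: "q \<in> \<rat>" "max 0 (s - d) < q" "q < min t (s + d)"
        using Rats_dense_in_real by blast
      then have "dist (f q) (f s) < 1 / real (Suc n)"
        by (intro d) (auto simp: dist_real_def)
      then show ?thesis using q s(2) by (intro bexI[of _ q]) (auto simp: dist_real_def)
    qed
  qed
next
  assume *: "\<forall>n. \<exists>q\<in>\<rat> \<inter> {0..t}. \<bar>f q - y\<bar> < 1 / real (Suc n)"
  have "continuous_on {0..t} (\<lambda>s. \<bar>f s - y\<bar>)" by (intro continuous_intros f)
  then have "\<exists>s\<in>{0..t}. \<forall>u\<in>{0..t}. \<bar>f s - y\<bar> \<le> \<bar>f u - y\<bar>"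
    using t by (intro continuous_attains_inf) auto
  then obtain s where s: "s \<in> {0..t}" "\<And>u. u \<in> {0..t} \<Longrightarrow> \<bar>f s - y\<bar> \<le> \<bar>f u - y\<bar>"
    by blast
  have "\<bar>f s - y\<bar> < 1 / real (Suc n)" for n
    using *[rule_format, of n] s(2) by fastforce
  then have "\<not> 0 < \<bar>f s - y\<bar>"
    using reals_Archimedean[of "\<bar>f s - y\<bar>"] by (metis inverse_eq_divide not_less_iff_gr_or_eq)
  then show "\<exists>s\<in>{0..t}. f s = y" using s(1) by (intro bexI[of _ s]) auto
qed

lemma space_natural_filtration [simp]: "space (natural_filtration M X t) = space M"
  unfolding natural_filtration_def by (rule space_measure_of) auto

lemma filtration_natural: "filtration (space M) (natural_filtration M X)"
proof
  fix i j :: ennreal assume "i \<le> j"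
  then show "sets (natural_filtration M X i) \<subseteq> sets (natural_filtration M X j)"
    unfolding natural_filtration_def
    by (subst (1 2) sets_measure_of) (auto intro!: sigma_sets_mono' intro: order_trans)
qed simp

lemma measurable_natural_filtration:
  assumes "0 \<le> s" "ennreal s \<le> t"
  shows "X s \<in> borel_measurable (natural_filtration M X t)"
proof (rule measurableI)
  fix B :: "real set" assume "B \<in> sets borel"
  then have "X s -` B \<inter> space M \<in> {X s -` B \<inter> space M | s B. 0 \<le> s \<and> ennreal s \<le> t \<and> B \<in> sets borel}"
    using assms by blast
  then show "X s -` B \<inter> space (natural_filtration M X t) \<in> sets (natural_filtration M X t)"
    unfolding natural_filtration_def by (auto simp: space_measure_of_conv)
qed simp

lemma sets_history_subset: "sets (history t) \<subseteq> sets path_space"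
  unfolding natural_filtration_def
  by (subst sets_measure_of) (auto intro!: sets.sigma_sets_subset measurable_sets[OF measurable_coord])

lemma stopping_time_hit: "stopping_time history (hit y)"
proof
  fix t :: ennreal
  show "Measurable.pred (history t) (\<lambda>f. hit y f \<le> t)"
  proof (cases t)
    case (real r)
    have "Measurable.pred (history t) (\<lambda>f. \<forall>n. \<exists>q\<in>\<rat> \<inter> {0..r}. \<bar>f q - y\<bar> < 1 / real (Suc n))"
    proof (intro pred_intros_countable measurable_pred_countable)
      show "countable (\<rat> \<inter> {0..r})" using countable_rat by blast
      fix n q assume "q \<in> \<rat> \<inter> {0..r}"
      then have "coord q \<in> borel_measurable (history t)"
        using real by (intro measurable_natural_filtration) (auto intro: ennreal_leI)
      then show "Measurable.pred (history t) (\<lambda>f. \<bar>f q - y\<bar> < 1 / real (Suc n))" by measurable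
    qed
    moreover have "hit y f \<le> t \<longleftrightarrow> (\<forall>n. \<exists>q\<in>\<rat> \<inter> {0..r}. \<bar>f q - y\<bar> < 1 / real (Suc n))"
      if "f \<in> space (history t)" for f
    proof -
      have f: "continuous_on {0..} f" using that path_space_continuous by simp
      have "hit y f \<le> t \<longleftrightarrow> (\<exists>s\<in>{0..r}. f s = y)"
        using hitting_time_le_iff[where X = coord and \<omega> = f and t = r and y = y] f real by simp
      also have "\<dots> \<longleftrightarrow> (\<forall>n. \<exists>q\<in>\<rat> \<inter> {0..r}. \<bar>f q - y\<bar> < 1 / real (Suc n))"
        using real f by (intro attains_iff_rational_approx) (auto elim: continuous_on_subset)
      finally show ?thesis .
    qed
    ultimately show ?thesis by (subst measurable_cong) auto
  qed simp
qed

lemma measurable_stopping: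
  "stopping_time history T \<Longrightarrow> T \<in> borel_measurable path_space"
  by (rule measurable_stopping_time[OF _ sets_history_subset]) auto

lemmas measurable_hit = measurable_stopping[OF stopping_time_hit]

abbreviation past :: "((real \<Rightarrow> real) \<Rightarrow> ennreal) \<Rightarrow> (real \<Rightarrow> real) measure" where
  "past \<equiv> filtration.pre_sigma (space path_space) history"

lemma space_past [simp]: "space (past T) = space path_space"
  by (rule filtration.space_pre_sigma[OF filtration_natural])

lemma sets_past_subset:
  assumes T: "stopping_time history T"
  shows "sets (past T) \<subseteq> sets path_space"
proof
  fix A assume A: "A \<in> sets (past T)"
  have "{f \<in> A. T f \<le> top} \<in> sets (history top)"
    using filtration.sets_pre_sigmaD[OF filtration_natural T A] .
  then show "A \<in> sets path_space" using sets_history_subset by auto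
qed

text \<open>
  All statements about the process are moved to the laws of its paths on \<open>path_space\<close>, on which the coordinate
  process has the same hitting times, occupation times and filtration.
\<close>

locale diffusion =
  fixes M :: "'a measure" and P :: "real \<Rightarrow> 'a measure" and X :: "real \<Rightarrow> 'a \<Rightarrow> real"
  assumes diff: "regular_diffusion M P X"
begin

definition law :: "real \<Rightarrow> (real \<Rightarrow> real) measure" where
  "law x = distr (P x) path_space (path_after X 0)"

lemma kernel_P: "P \<in> borel \<rightarrow>\<^sub>M prob_algebra M"
  and measurable_X: "t \<ge> 0 \<Longrightarrow> X t \<in> borel_measurable M"
  and continuous_X: "\<omega> \<in> space M \<Longrightarrow> continuous_on {0..} (\<lambda>t. X t \<omega>)"
  and start_X: "AE \<omega> in P x. X 0 \<omega> = x"
  and markov: "strong_Markov M P X"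
  using diff unfolding regular_diffusion_def by auto

lemma sets_P [simp, measurable_cong]: "sets (P x) = sets M"
  and prob_P: "prob_space (P x)"
  using measurable_space[OF kernel_P, of x] by (auto simp: space_prob_algebra)

lemma space_P [simp]: "space (P x) = space M"
  by (rule sets_eq_imp_space_eq) simp

lemma measurable_path: "t \<ge> 0 \<Longrightarrow> path_after X t \<in> M \<rightarrow>\<^sub>M path_space"
proof (rule measurable_into_path_space)
  show "0 \<le> t \<Longrightarrow> \<omega> \<in> space M \<Longrightarrow> path_after X t \<omega> \<in> space path_space" for \<omega>
    by (rule path_after_in_path_space[where X = X, OF continuous_X])
  show "0 \<le> t \<Longrightarrow> 0 \<le> s \<Longrightarrow> (\<lambda>\<omega>. path_after X t \<omega> s) \<in> borel_measurable M" for s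
    using measurable_X[of "t + s"] by (simp add: path_after_apply)
qed

lemma measurable_path_P: "path_after X 0 \<in> P x \<rightarrow>\<^sub>M path_space"
  using measurable_path[of 0] by simp

lemma sets_law [simp, measurable_cong]: "sets (law x) = sets path_space"
  and space_law [simp]: "space (law x) = space path_space"
  by (simp_all add: law_def)

lemma prob_law: "prob_space (law x)"
  unfolding law_def by (rule prob_space.prob_space_distr[OF prob_P measurable_path_P])

lemma kernel_law: "law \<in> borel \<rightarrow>\<^sub>M prob_algebra path_space"
  unfolding law_def[abs_def]
  by (rule measurable_compose[OF kernel_P measurable_distr_prob_space[OF measurable_path]]) simp

lemma start_law: "AE f in law x. f 0 = x"
proof -
  have "AE \<omega> in P x. path_after X 0 \<omega> 0 = x"
    using start_X by (simp add: path_after_apply)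
  moreover have "{f \<in> space path_space. f 0 = x} \<in> sets path_space"
    using measurable_coord[of 0] by measurable
  ultimately show ?thesis
    unfolding law_def by (subst AE_distr_iff[OF measurable_path_P])
qed

lemma hitting_time_law: "hitting_time X y \<omega> = hit y (path_after X 0 \<omega>)"
proof -
  have "{ennreal t |t. 0 \<le> t \<and> path_after X 0 \<omega> t = y} = {ennreal t |t. 0 \<le> t \<and> X t \<omega> = y}"
    by (auto simp: path_after_apply)
  then show ?thesis unfolding hitting_time_def by simp
qed

text \<open>
  The natural filtration of the coordinate process pulls back to that of \<open>X\<close>; so stopping times and their
  \<open>\<sigma>\<close>-algebras pull back as well.
\<close>

lemma measurable_path_history: "path_after X 0 \<in> natural_filtration M X t \<rightarrow>\<^sub>M history t"
  unfolding natural_filtration_def[of path_space]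
proof (rule measurable_measure_of)
  show "path_after X 0 \<in> space (natural_filtration M X t) \<rightarrow> space path_space"
    using measurable_space[OF measurable_path[of 0]] by auto
  fix Y assume "Y \<in> {coord s -` B \<inter> space path_space | s B. 0 \<le> s \<and> ennreal s \<le> t \<and> B \<in> sets borel}"
  then obtain s B where Y: "Y = coord s -` B \<inter> space path_space" "0 \<le> s" "ennreal s \<le> t" "B \<in> sets borel"
    by blast
  have "path_after X 0 -` Y \<inter> space (natural_filtration M X t) = X s -` B \<inter> space (natural_filtration M X t)"
    using Y(2) measurable_space[OF measurable_path[of 0]] by (auto simp: Y(1) path_after_apply)
  also have "\<dots> \<in> sets (natural_filtration M X t)"
    using Y by (intro measurable_sets[OF measurable_natural_filtration])
  finally show "path_after X 0 -` Y \<inter> space (natural_filtration M X t) \<in> sets (natural_filtration M X t)" .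
qed auto

lemma strong_Markov_emeasure:
  assumes T: "stopping_time history T" and A: "A \<in> sets (past T)" and D: "D \<in> sets path_space"
  shows "emeasure (law x) {f \<in> A. T f < \<infinity> \<and> shift (enn2real (T f)) f \<in> D}
     = (\<integral>\<^sup>+f\<in>{f \<in> A. T f < \<infinity>}. emeasure (law (f (enn2real (T f)))) D \<partial>law x)"
proof -
  let ?\<Phi> = "path_after X 0"
  have A': "A \<in> sets path_space" using sets_past_subset[OF T] A by auto
  then have Asub: "A \<subseteq> space path_space" by (rule sets.sets_into_space)
  note [measurable] = measurable_stopping[OF T] measurable_path_P kernel_law A' D measurable_path[of 0, simplified]
  have sh[measurable]: "(\<lambda>f. shift (enn2real (T f)) f) \<in> path_space \<rightarrow>\<^sub>M path_space"
    by (rule measurable_shift) auto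
  have at[measurable]: "(\<lambda>f. f (enn2real (T f))) \<in> borel_measurable path_space"
    by (rule measurable_coord_at) auto
  obtain D0 where D0: "D0 \<in> sets (PiM {0..} (\<lambda>_. borel))" "D = {f. continuous_on {0..} f} \<inter> D0"
    using D unfolding path_space_def sets_restrict_space by auto
  have inD: "path_after X t \<omega> \<in> D0 \<longleftrightarrow> path_after X t \<omega> \<in> D" if "t \<ge> 0" "\<omega> \<in> space M" for t \<omega>
    using path_after_in_path_space[where X = X, OF continuous_X[OF that(2)] that(1)] by (auto simp: D0 path_space_continuous)
  have \<Phi>: "?\<Phi> \<omega> \<in> space path_space" if "\<omega> \<in> space M" for \<omega>
    using measurable_space[OF measurable_path[of 0]] that by auto
  have T': "stopping_time (natural_filtration M X) (\<lambda>\<omega>. T (?\<Phi> \<omega>))"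
    by (intro stopping_timeI measurable_compose[OF measurable_path_history stopping_timeD[OF T]])
  have "?\<Phi> -` A \<inter> space M \<in> sets (filtration.pre_sigma (space M) (natural_filtration M X) (\<lambda>\<omega>. T (?\<Phi> \<omega>)))"
  proof (rule filtration.sets_pre_sigmaI[OF filtration_natural T'])
    fix t
    have "?\<Phi> -` {f \<in> A. T f \<le> t} \<inter> space (natural_filtration M X t) \<in> sets (natural_filtration M X t)"
      by (intro measurable_sets[OF measurable_path_history] filtration.sets_pre_sigmaD[OF filtration_natural T A])
    also have "?\<Phi> -` {f \<in> A. T f \<le> t} \<inter> space (natural_filtration M X t) = {\<omega> \<in> ?\<Phi> -` A \<inter> space M. T (?\<Phi> \<omega>) \<le> t}"
      by auto
    finally show "{\<omega> \<in> ?\<Phi> -` A \<inter> space M. T (?\<Phi> \<omega>) \<le> t} \<in> sets (natural_filtration M X t)" .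
  qed
  with markov T' D0(1)
  have "emeasure (P x) {\<omega> \<in> ?\<Phi> -` A \<inter> space M. T (?\<Phi> \<omega>) < \<infinity> \<and> path_after X (enn2real (T (?\<Phi> \<omega>))) \<omega> \<in> D0}
     = (\<integral>\<^sup>+\<omega>\<in>{\<omega> \<in> ?\<Phi> -` A \<inter> space M. T (?\<Phi> \<omega>) < \<infinity>}.
          emeasure (P (X (enn2real (T (?\<Phi> \<omega>))) \<omega>)) {\<omega>' \<in> space M. ?\<Phi> \<omega>' \<in> D0} \<partial>P x)"
    unfolding strong_Markov_def by blast
  also have "{\<omega> \<in> ?\<Phi> -` A \<inter> space M. T (?\<Phi> \<omega>) < \<infinity> \<and> path_after X (enn2real (T (?\<Phi> \<omega>))) \<omega> \<in> D0}
     = ?\<Phi> -` {f \<in> A. T f < \<infinity> \<and> shift (enn2real (T f)) f \<in> D} \<inter> space (P x)"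
    by (auto simp: shift_path_after inD)
  also have "emeasure (P x) \<dots> = emeasure (law x) {f \<in> A. T f < \<infinity> \<and> shift (enn2real (T f)) f \<in> D}"
    unfolding law_def
  proof (rule emeasure_distr[symmetric, OF measurable_path_P])
    have "{f \<in> space path_space. f \<in> A \<and> T f < \<infinity> \<and> shift (enn2real (T f)) f \<in> D} \<in> sets path_space"
      by measurable
    also have "{f \<in> space path_space. f \<in> A \<and> T f < \<infinity> \<and> shift (enn2real (T f)) f \<in> D}
       = {f \<in> A. T f < \<infinity> \<and> shift (enn2real (T f)) f \<in> D}" using Asub by auto
    finally show "{f \<in> A. T f < \<infinity> \<and> shift (enn2real (T f)) f \<in> D} \<in> sets path_space" .
  qed
  also have "(\<integral>\<^sup>+\<omega>\<in>{\<omega> \<in> ?\<Phi> -` A \<inter> space M. T (?\<Phi> \<omega>) < \<infinity>}.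
          emeasure (P (X (enn2real (T (?\<Phi> \<omega>))) \<omega>)) {\<omega>' \<in> space M. ?\<Phi> \<omega>' \<in> D0} \<partial>P x)
     = (\<integral>\<^sup>+\<omega>. emeasure (law (?\<Phi> \<omega> (enn2real (T (?\<Phi> \<omega>))))) D * indicator {f \<in> A. T f < \<infinity>} (?\<Phi> \<omega>) \<partial>P x)"
  proof (rule nn_integral_cong)
    fix \<omega> assume \<omega>: "\<omega> \<in> space (P x)"
    have "emeasure (P y) {\<omega>' \<in> space M. ?\<Phi> \<omega>' \<in> D0} = emeasure (law y) D" for y
    proof -
      have "{\<omega>' \<in> space M. ?\<Phi> \<omega>' \<in> D0} = ?\<Phi> -` D \<inter> space (P y)" using inD[of 0] by auto
      then show ?thesis unfolding law_def by (simp add: emeasure_distr[OF measurable_path_P D])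
    qed
    then show "emeasure (P (X (enn2real (T (?\<Phi> \<omega>))) \<omega>)) {\<omega>' \<in> space M. ?\<Phi> \<omega>' \<in> D0}
        * indicator {\<omega> \<in> ?\<Phi> -` A \<inter> space M. T (?\<Phi> \<omega>) < \<infinity>} \<omega>
      = emeasure (law (?\<Phi> \<omega> (enn2real (T (?\<Phi> \<omega>))))) D * indicator {f \<in> A. T f < \<infinity>} (?\<Phi> \<omega>)"
      using \<omega> by (auto simp: path_after_apply indicator_def)
  qed
  also have "\<dots> = (\<integral>\<^sup>+f\<in>{f \<in> A. T f < \<infinity>}. emeasure (law (f (enn2real (T f)))) D \<partial>law x)"
    unfolding law_def[of x]
  proof (rule nn_integral_distr[symmetric, OF measurable_path_P])
    have "{f \<in> space path_space. f \<in> A \<and> T f < \<infinity>} \<in> sets path_space" by measurable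
    also have "{f \<in> space path_space. f \<in> A \<and> T f < \<infinity>} = {f \<in> A. T f < \<infinity>}" using Asub by auto
    finally have [measurable]: "{f \<in> A. T f < \<infinity>} \<in> sets path_space" .
    have [measurable]: "(\<lambda>f. emeasure (law (f (enn2real (T f)))) D) \<in> borel_measurable path_space"
      by (rule measurable_compose[OF at measurable_emeasure_kernel[OF measurable_prob_algebraD[OF kernel_law] D]])
    show "(\<lambda>f. emeasure (law (f (enn2real (T f)))) D * indicator {f \<in> A. T f < \<infinity>} f)
        \<in> borel_measurable (distr (P x) path_space ?\<Phi>)" by measurable
  qed
  finally show ?thesis .
qed

text \<open>
  For events \<open>A\<close> and \<open>D\<close> this is the strong Markov property. Keeping \<open>A\<close> fixed, both sides are measures in
  \<open>D\<close>, which gives general \<open>G\<close>; keeping \<open>G\<close> fixed, both sides are measures on the past, which gives general \<open>Z\<close>.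
\<close>

lemma strong_Markov_nn_integral:
  assumes T: "stopping_time history T" and Z: "Z \<in> borel_measurable (past T)"
    and G: "G \<in> borel_measurable path_space"
  shows "(\<integral>\<^sup>+f. Z f * (G (shift (enn2real (T f)) f) * indicator {f. T f < \<infinity>} f) \<partial>law x)
     = (\<integral>\<^sup>+f. Z f * ((\<integral>\<^sup>+g. G g \<partial>law (f (enn2real (T f)))) * indicator {f. T f < \<infinity>} f) \<partial>law x)"
proof -
  let ?s = "\<lambda>f. shift (enn2real (T f)) f" and ?a = "\<lambda>f. f (enn2real (T f))"
  note [measurable] = measurable_stopping[OF T] G
  have sh[measurable]: "?s \<in> path_space \<rightarrow>\<^sub>M path_space"
    by (rule measurable_shift) auto
  have at[measurable]: "?a \<in> borel_measurable path_space"
    by (rule measurable_coord_at) auto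
  have fin[measurable]: "{f \<in> space path_space. T f < \<infinity>} \<in> sets path_space" by measurable
  have K: "law \<in> borel \<rightarrow>\<^sub>M subprob_algebra path_space"
    by (rule measurable_prob_algebraD[OF kernel_law])
  have KA[measurable]: "(\<lambda>f. law (?a f)) \<in> path_space \<rightarrow>\<^sub>M subprob_algebra path_space"
    by (rule measurable_compose[OF at K])
  \<comment> \<open>The two integrands without the factor \<open>Z\<close>, which are compared on events of the past.\<close>
  define h1 where "h1 f = G (?s f) * indicator {f \<in> space path_space. T f < \<infinity>} f" for f
  define h2 where "h2 f = (\<integral>\<^sup>+g. G g \<partial>law (?a f)) * indicator {f \<in> space path_space. T f < \<infinity>} f" for f
  have m1[measurable]: "h1 \<in> borel_measurable path_space" unfolding h1_def by measurable
  have "(\<lambda>f. \<integral>\<^sup>+g. G g \<partial>law (?a f)) \<in> borel_measurable path_space"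
    by (rule measurable_compose[OF KA nn_integral_measurable_subprob_algebra[OF G]])
  then have m2[measurable]: "h2 \<in> borel_measurable path_space" unfolding h2_def by measurable
  have eqA: "(\<integral>\<^sup>+f. h1 f * indicator A f \<partial>law x) = (\<integral>\<^sup>+f. h2 f * indicator A f \<partial>law x)"
    if A: "A \<in> sets (past T)" for A
  proof -
    have A'[measurable]: "A \<in> sets path_space" using sets_past_subset[OF T] A by auto
    then have Asub: "A \<subseteq> space path_space" by (rule sets.sets_into_space)
    define B where "B = {f \<in> space path_space. f \<in> A \<and> T f < \<infinity>}"
    have B[measurable]: "B \<in> sets path_space" unfolding B_def by measurable
    have Beq: "B = {f \<in> A. T f < \<infinity>}" using Asub by (auto simp: B_def)
    define N where "N = density (law x) (indicator B)"
    have sN[measurable_cong]: "sets N = sets path_space" by (simp add: N_def)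
    have spN: "space N = space path_space" by (rule sets_eq_imp_space_eq[OF sN])
    have ne: "space N \<noteq> {}" unfolding spN using prob_space.not_empty[OF prob_law[of x]] by simp
    have KN: "(\<lambda>f. law (?a f)) \<in> N \<rightarrow>\<^sub>M subprob_algebra path_space"
      using KA by (simp add: measurable_cong_sets[OF sN refl])
    have "distr N path_space ?s = N \<bind> (\<lambda>f. law (?a f))"
    proof (rule measure_eqI)
      show "sets (distr N path_space ?s) = sets (N \<bind> (\<lambda>f. law (?a f)))"
        by (simp add: sets_bind[OF _ ne, of _ path_space] subprob_measurableD(2)[OF KN])
      fix D assume "D \<in> sets (distr N path_space ?s)"
      then have D[measurable]: "D \<in> sets path_space" by simp
      have sv: "?s -` D \<inter> space N \<in> sets path_space"
        using measurable_sets[OF sh D] by (simp add: spN)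
      have "emeasure (distr N path_space ?s) D = emeasure N (?s -` D \<inter> space N)"
        by (rule emeasure_distr) (simp_all add: D measurable_cong_sets[OF sN refl] sh)
      also have "\<dots> = (\<integral>\<^sup>+f. indicator B f * indicator (?s -` D \<inter> space N) f \<partial>law x)"
        unfolding N_def by (rule emeasure_density) (use sv in \<open>simp_all add: N_def\<close>)
      also have "\<dots> = (\<integral>\<^sup>+f. indicator {f \<in> A. T f < \<infinity> \<and> ?s f \<in> D} f \<partial>law x)"
        by (intro nn_integral_cong) (auto simp: Beq spN indicator_def)
      also have "\<dots> = emeasure (law x) {f \<in> A. T f < \<infinity> \<and> ?s f \<in> D}"
      proof (rule nn_integral_indicator)
        have "{f \<in> space path_space. f \<in> B \<and> ?s f \<in> D} \<in> sets path_space" by measurable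
        also have "{f \<in> space path_space. f \<in> B \<and> ?s f \<in> D} = {f \<in> A. T f < \<infinity> \<and> ?s f \<in> D}"
          using Asub by (auto simp: Beq)
        finally show "{f \<in> A. T f < \<infinity> \<and> ?s f \<in> D} \<in> sets (law x)" by simp
      qed
      also have "\<dots> = (\<integral>\<^sup>+f\<in>{f \<in> A. T f < \<infinity>}. emeasure (law (?a f)) D \<partial>law x)"
        by (rule strong_Markov_emeasure[OF T A D])
      also have "\<dots> = (\<integral>\<^sup>+f. indicator B f * emeasure (law (?a f)) D \<partial>law x)"
        unfolding Beq by (simp add: mult.commute)
      also have "\<dots> = (\<integral>\<^sup>+f. emeasure (law (?a f)) D \<partial>N)"
        unfolding N_def
        by (rule nn_integral_density[symmetric])
          (use measurable_compose[OF KA measurable_emeasure_subprob_algebra[OF D]] in auto)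
      also have "\<dots> = emeasure (N \<bind> (\<lambda>f. law (?a f))) D"
        by (rule emeasure_bind[OF ne KN D, symmetric])
      finally show "emeasure (distr N path_space ?s) D = emeasure (N \<bind> (\<lambda>f. law (?a f))) D" .
    qed
    then have "(\<integral>\<^sup>+g. G g \<partial>distr N path_space ?s) = (\<integral>\<^sup>+g. G g \<partial>(N \<bind> (\<lambda>f. law (?a f))))" by simp
    also have "(\<integral>\<^sup>+g. G g \<partial>(N \<bind> (\<lambda>f. law (?a f)))) = (\<integral>\<^sup>+f. \<integral>\<^sup>+g. G g \<partial>law (?a f) \<partial>N)"
      by (rule nn_integral_bind[OF G KN])
    also have "(\<integral>\<^sup>+g. G g \<partial>distr N path_space ?s) = (\<integral>\<^sup>+f. G (?s f) \<partial>N)"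
      by (rule nn_integral_distr) (simp_all add: G measurable_cong_sets[OF sN refl] sh)
    also have "(\<integral>\<^sup>+f. G (?s f) \<partial>N) = (\<integral>\<^sup>+f. indicator B f * G (?s f) \<partial>law x)"
      unfolding N_def by (rule nn_integral_density) measurable
    also have "(\<integral>\<^sup>+f. \<integral>\<^sup>+g. G g \<partial>law (?a f) \<partial>N) = (\<integral>\<^sup>+f. indicator B f * (\<integral>\<^sup>+g. G g \<partial>law (?a f)) \<partial>law x)"
      unfolding N_def
      by (rule nn_integral_density)
         (use measurable_compose[OF KA nn_integral_measurable_subprob_algebra[OF G]] in auto)
    finally have "(\<integral>\<^sup>+f. indicator B f * G (?s f) \<partial>law x) = (\<integral>\<^sup>+f. indicator B f * (\<integral>\<^sup>+g. G g \<partial>law (?a f)) \<partial>law x)" .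
    moreover have "(\<integral>\<^sup>+f. h1 f * indicator A f \<partial>law x) = (\<integral>\<^sup>+f. indicator B f * G (?s f) \<partial>law x)"
      by (intro nn_integral_cong) (auto simp: h1_def Beq indicator_def)
    moreover have "(\<integral>\<^sup>+f. h2 f * indicator A f \<partial>law x) = (\<integral>\<^sup>+f. indicator B f * (\<integral>\<^sup>+g. G g \<partial>law (?a f)) \<partial>law x)"
      by (intro nn_integral_cong) (auto simp: h2_def Beq indicator_def)
    ultimately show ?thesis by simp
  qed
  have id: "(\<lambda>f. f) \<in> N \<rightarrow>\<^sub>M past T" if "sets N = sets path_space" for N
    using that sets_past_subset[OF T] sets_eq_imp_space_eq[OF that]
    by (intro measurableI) (auto dest: sets.sets_into_space intro: sets.Int)
  have Z'[measurable]: "Z \<in> borel_measurable path_space"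
    using measurable_compose[OF id Z] by simp
  have D: "distr (density (law x) h1) (past T) (\<lambda>f. f) = distr (density (law x) h2) (past T) (\<lambda>f. f)"
  proof (rule measure_eqI)
    fix A assume "A \<in> sets (distr (density (law x) h1) (past T) (\<lambda>f. f))"
    then have A: "A \<in> sets (past T)" by simp
    have A'[measurable]: "A \<in> sets path_space" using sets_past_subset[OF T] A by auto
    then have Asub: "A \<inter> space path_space = A" using sets.sets_into_space by blast
    have "emeasure (distr (density (law x) h) (past T) (\<lambda>f. f)) A = (\<integral>\<^sup>+f. h f * indicator A f \<partial>law x)"
      if [measurable]: "h \<in> borel_measurable path_space" for h
      using A by (simp add: emeasure_distr id emeasure_density Asub vimage_def)
    then show "emeasure (distr (density (law x) h1) (past T) (\<lambda>f. f)) A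
       = emeasure (distr (density (law x) h2) (past T) (\<lambda>f. f)) A"
      using eqA[OF A] by simp
  qed simp
  have "(\<integral>\<^sup>+f. h f * Z f \<partial>law x) = (\<integral>\<^sup>+f. Z f \<partial>distr (density (law x) h) (past T) (\<lambda>f. f))"
    if [measurable]: "h \<in> borel_measurable path_space" for h
    using Z by (simp add: nn_integral_distr id nn_integral_density)
  from this[OF m1] this[OF m2] have "(\<integral>\<^sup>+f. h1 f * Z f \<partial>law x) = (\<integral>\<^sup>+f. h2 f * Z f \<partial>law x)"
    by (simp add: D)
  moreover have "(\<integral>\<^sup>+f. h1 f * Z f \<partial>law x) = (\<integral>\<^sup>+f. Z f * (G (?s f) * indicator {f. T f < \<infinity>} f) \<partial>law x)"
    by (intro nn_integral_cong) (auto simp: h1_def indicator_def mult.commute)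
  moreover have "(\<integral>\<^sup>+f. h2 f * Z f \<partial>law x) = (\<integral>\<^sup>+f. Z f * ((\<integral>\<^sup>+g. G g \<partial>law (?a f)) * indicator {f. T f < \<infinity>} f) \<partial>law x)"
    by (intro nn_integral_cong) (auto simp: h2_def indicator_def mult.commute)
  ultimately show ?thesis by simp
qed

text \<open>
  The bound on \<open>G\<close> makes its conditional mean finite. If the integrals diverge, both sides are \<open>0\<close>, the default
  value of the integral.
\<close>

lemma strong_Markov_integral:
  fixes Z G :: "(real \<Rightarrow> real) \<Rightarrow> real"
  assumes T: "stopping_time history T" and Z: "Z \<in> borel_measurable (past T)"
    and G: "G \<in> borel_measurable path_space"
    and Zb: "\<And>f. f \<in> space path_space \<Longrightarrow> 0 \<le> Z f"
    and Gb: "\<And>f. f \<in> space path_space \<Longrightarrow> 0 \<le> G f \<and> G f \<le> B"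
  shows "(\<integral>f. Z f * (G (shift (enn2real (T f)) f) * indicator {f. T f < \<infinity>} f) \<partial>law x)
     = (\<integral>f. Z f * ((\<integral>g. G g \<partial>law (f (enn2real (T f)))) * indicator {f. T f < \<infinity>} f) \<partial>law x)"
proof -
  let ?s = "\<lambda>f. shift (enn2real (T f)) f" and ?a = "\<lambda>f. f (enn2real (T f))"
  note [measurable] = measurable_stopping[OF T] G
  have sh[measurable]: "?s \<in> path_space \<rightarrow>\<^sub>M path_space"
    by (rule measurable_shift) auto
  have at[measurable]: "?a \<in> borel_measurable path_space"
    by (rule measurable_coord_at) auto
  have id: "(\<lambda>f. f) \<in> path_space \<rightarrow>\<^sub>M past T"
    using sets_past_subset[OF T]
    by (intro measurableI) (auto dest: sets.sets_into_space intro: sets.Int)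
  have Z'[measurable]: "Z \<in> borel_measurable path_space"
    using measurable_compose[OF id Z] by simp
  have K: "law \<in> borel \<rightarrow>\<^sub>M subprob_algebra path_space"
    by (rule measurable_prob_algebraD[OF kernel_law])
  have [measurable]: "(\<lambda>y. \<integral>g. G g \<partial>law y) \<in> borel_measurable borel"
    by (rule measurable_compose[OF K integral_measurable_subprob_algebra[OF G]])
  have inG: "integrable (law y) G" for y
  proof -
    interpret prob_space "law y" by (rule prob_law)
    show ?thesis using Gb by (intro integrable_const_bound[of _ B]) auto
  qed
  have nnG: "0 \<le> (\<integral>g. G g \<partial>law y)" for y
    using Gb by (intro Bochner_Integration.integral_nonneg) auto
  have eqG: "(\<integral>\<^sup>+g. ennreal (G g) \<partial>law y) = ennreal (\<integral>g. G g \<partial>law y)" for y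
    using inG Gb by (intro nn_integral_eq_integral) auto
  have shsp: "?s f \<in> space path_space" if "f \<in> space path_space" for f
    using measurable_space[OF sh that] .
  have fin[measurable]: "{f \<in> space path_space. T f < \<infinity>} \<in> sets path_space" by measurable
  have ind: "indicator {f. T f < \<infinity>} f = (indicator {f \<in> space path_space. T f < \<infinity>} f :: real)" if "f \<in> space path_space" for f
    using that by (auto simp: indicator_def)
  have m: "(\<lambda>f. Z f * (H f * indicator {f. T f < \<infinity>} f)) \<in> borel_measurable (law x)"
    if [measurable]: "H \<in> borel_measurable path_space" for H :: "_ \<Rightarrow> real"
  proof -
    have "(\<lambda>f. Z f * (H f * indicator {f \<in> space path_space. T f < \<infinity>} f)) \<in> borel_measurable (law x)"
      by measurable
    then show ?thesis
      by (rule measurable_cong[THEN iffD1, rotated]) (auto simp: indicator_def)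
  qed
  have "(\<integral>f. Z f * (G (?s f) * indicator {f. T f < \<infinity>} f) \<partial>law x)
      = enn2real (\<integral>\<^sup>+f. ennreal (Z f) * (ennreal (G (?s f)) * indicator {f. T f < \<infinity>} f) \<partial>law x)"
  proof -
    have "(\<integral>\<^sup>+f. ennreal (Z f) * (ennreal (G (?s f)) * indicator {f. T f < \<infinity>} f) \<partial>law x)
       = (\<integral>\<^sup>+f. ennreal (Z f * (G (?s f) * indicator {f. T f < \<infinity>} f)) \<partial>law x)"
      using Zb Gb shsp by (intro nn_integral_cong) (auto simp: ennreal_mult indicator_def)
    then show ?thesis
      using Zb Gb shsp by (subst integral_eq_nn_integral[OF m]) (auto simp: indicator_def)
  qed
  also have "(\<integral>\<^sup>+f. ennreal (Z f) * (ennreal (G (?s f)) * indicator {f. T f < \<infinity>} f) \<partial>law x)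
     = (\<integral>\<^sup>+f. ennreal (Z f) * ((\<integral>\<^sup>+g. ennreal (G g) \<partial>law (?a f)) * indicator {f. T f < \<infinity>} f) \<partial>law x)"
    using Z G by (intro strong_Markov_nn_integral[OF T]) auto
  also have "\<dots> = (\<integral>\<^sup>+f. ennreal (Z f * ((\<integral>g. G g \<partial>law (?a f)) * indicator {f. T f < \<infinity>} f)) \<partial>law x)"
    unfolding eqG using Zb nnG by (intro nn_integral_cong) (auto simp: ennreal_mult indicator_def)
  also have "enn2real \<dots> = (\<integral>f. Z f * ((\<integral>g. G g \<partial>law (?a f)) * indicator {f. T f < \<infinity>} f) \<partial>law x)"
    using Zb nnG by (subst integral_eq_nn_integral[OF m]) (auto simp: indicator_def)
  finally show ?thesis .
qed

end

section \<open>Green functions of the skew Bessel process\<close>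

text \<open>
  The product of the Green function of \<open>(a, b)\<close> and the speed density on one half-line, in terms of the
  distance from the origin. The factors \<open>\<beta>\<close> and \<open>1 - \<beta>\<close> cancel in this product.
\<close>

definition bessel_green :: "real \<Rightarrow> real \<Rightarrow> real \<Rightarrow> real \<Rightarrow> real \<Rightarrow> real" where
  "bessel_green \<alpha> a x b y =
     (min x y powr (2 * \<alpha>) - a powr (2 * \<alpha>)) * (b powr (2 * \<alpha>) - max x y powr (2 * \<alpha>))
       / (b powr (2 * \<alpha>) - a powr (2 * \<alpha>)) * y powr (1 - 2 * \<alpha>) / \<alpha>"

lemma nn_integral_Ioo_eq_Icc:
  fixes a b :: real
  shows "(\<integral>\<^sup>+y. f y * indicator {a<..<b} y \<partial>lborel) = (\<integral>\<^sup>+y. f y * indicator {a..b} y \<partial>lborel)"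
proof (rule nn_integral_cong_AE)
  have "AE y in lborel. y \<noteq> a" "AE y in lborel. y \<noteq> b" by (rule AE_lborel_singleton)+
  then show "AE y in lborel. f y * indicator {a<..<b} y = f y * indicator {a..b} y"
    by eventually_elim (auto simp: indicator_def)
qed

lemma has_integral_powr_Icc:
  fixes u v p :: real
  assumes "p > -1" "0 \<le> u" "u \<le> v"
  shows "((\<lambda>y. y powr p) has_integral (v powr (p + 1) - u powr (p + 1)) / (p + 1)) {u..v}"
proof -
  have "((\<lambda>y. y powr p) has_integral v powr (p + 1) / (p + 1) - u powr (p + 1) / (p + 1)) {u..v}"
  proof (rule fundamental_theorem_of_calculus_interior[OF assms(3)])
    show "continuous_on {u..v} (\<lambda>y. y powr (p + 1) / (p + 1))"
      using assms unfolding divide_inverse by (intro continuous_intros continuous_on_powr') auto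
    fix y assume y: "y \<in> {u<..<v}"
    then have "((\<lambda>y. y powr (p + 1) / (p + 1)) has_real_derivative (p + 1) * y powr (p + 1 - 1) / (p + 1)) (at y)"
      using assms by (intro DERIV_cdivide has_real_derivative_powr) auto
    then show "((\<lambda>y. y powr (p + 1) / (p + 1)) has_vector_derivative y powr p) (at y)"
      using assms by (simp add: has_real_derivative_iff_has_vector_derivative)
  qed
  then show ?thesis by (simp add: diff_divide_distrib)
qed

text \<open>
  On both sides of \<open>x\<close> the integrand is a combination of \<open>y\<close> and \<open>y\<^sup>1\<^sup>-\<^sup>2\<^sup>\<alpha>\<close>. In the sum of the two
  integrals the boundary terms collapse to the mean increase of \<open>y\<^sup>2 / (2 - 2 \<alpha>)\<close>.
\<close>

lemma nn_integral_bessel_green: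
  assumes \<alpha>: "0 < \<alpha>" "\<alpha> < 1" and ord: "0 \<le> a" "a < x" "x < b"
  shows "(\<integral>\<^sup>+y. ennreal (bessel_green \<alpha> a x b y) * indicator {a<..<b} y \<partial>lborel)
     = ennreal (mean_exit_time \<alpha> a x b)"
proof -
  define A B Y where "A = a powr (2 * \<alpha>)" and "B = b powr (2 * \<alpha>)" and "Y = x powr (2 * \<alpha>)"
  define A' B' Y' where "A' = a powr (2 - 2 * \<alpha>)" and "B' = b powr (2 - 2 * \<alpha>)" and "Y' = x powr (2 - 2 * \<alpha>)"
  have AYB: "A < Y" "Y < B"
    unfolding A_def B_def Y_def using ord \<alpha> by (auto intro!: powr_less_mono2)
  have sq: "a\<^sup>2 = A * A'" "b\<^sup>2 = B * B'" "x\<^sup>2 = Y * Y'"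
    using ord \<alpha> by (auto simp: A_def B_def Y_def A'_def B'_def Y'_def simp flip: powr_add)
  have pw: "y powr (2 * \<alpha>) * y powr (1 - 2 * \<alpha>) = y" if "y \<ge> 0" for y :: real
    using that by (cases "y = 0") (auto simp flip: powr_add)
  have id_int: "((\<lambda>y::real. y) has_integral (v\<^sup>2 - u\<^sup>2) / 2) {u..v}" if "u \<le> v" for u v
    using ident_has_integral[OF that] by simp
  have q: "1 - 2 * \<alpha> + 1 = 2 - 2 * \<alpha>" by simp
  have pw_int: "((\<lambda>y. y powr (1 - 2 * \<alpha>)) has_integral (v powr (2 - 2 * \<alpha>) - u powr (2 - 2 * \<alpha>)) / (2 - 2 * \<alpha>)) {u..v}"
    if "0 \<le> u" "u \<le> v" for u v
    using has_integral_powr_Icc[of "1 - 2 * \<alpha>" u v] that \<alpha> unfolding q by auto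
  have 1: "(bessel_green \<alpha> a x b has_integral
      ((B - Y) / ((B - A) * \<alpha>)) * ((x\<^sup>2 - a\<^sup>2) / 2 - A * ((Y' - A') / (2 - 2 * \<alpha>)))) {a..x}"
  proof (rule has_integral_eq)
    show "((\<lambda>y. ((B - Y) / ((B - A) * \<alpha>)) * (y - A * y powr (1 - 2 * \<alpha>))) has_integral
      ((B - Y) / ((B - A) * \<alpha>)) * ((x\<^sup>2 - a\<^sup>2) / 2 - A * ((Y' - A') / (2 - 2 * \<alpha>)))) {a..x}"
      unfolding Y'_def A'_def
      by (intro has_integral_mult_right has_integral_diff id_int pw_int) (use ord in auto)
    fix y assume y: "y \<in> {a..x}"
    have "bessel_green \<alpha> a x b y = (y powr (2 * \<alpha>) - A) * (B - Y) / (B - A) * y powr (1 - 2 * \<alpha>) / \<alpha>"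
      using y by (simp add: bessel_green_def A_def B_def Y_def)
    also have "\<dots> = ((B - Y) / ((B - A) * \<alpha>)) * (y powr (2 * \<alpha>) * y powr (1 - 2 * \<alpha>) - A * y powr (1 - 2 * \<alpha>))"
      by (simp add: field_simps)
    also have "\<dots> = ((B - Y) / ((B - A) * \<alpha>)) * (y - A * y powr (1 - 2 * \<alpha>))"
      using pw[of y] y ord by simp
    finally show "((B - Y) / ((B - A) * \<alpha>)) * (y - A * y powr (1 - 2 * \<alpha>)) = bessel_green \<alpha> a x b y" by simp
  qed
  have 2: "(bessel_green \<alpha> a x b has_integral
      ((Y - A) / ((B - A) * \<alpha>)) * (B * ((B' - Y') / (2 - 2 * \<alpha>)) - (b\<^sup>2 - x\<^sup>2) / 2)) {x..b}"
  proof (rule has_integral_eq)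
    show "((\<lambda>y. ((Y - A) / ((B - A) * \<alpha>)) * (B * y powr (1 - 2 * \<alpha>) - y)) has_integral
      ((Y - A) / ((B - A) * \<alpha>)) * (B * ((B' - Y') / (2 - 2 * \<alpha>)) - (b\<^sup>2 - x\<^sup>2) / 2)) {x..b}"
      unfolding Y'_def B'_def
      by (intro has_integral_mult_right has_integral_diff id_int pw_int) (use ord in auto)
    fix y assume y: "y \<in> {x..b}"
    have "bessel_green \<alpha> a x b y = (Y - A) * (B - y powr (2 * \<alpha>)) / (B - A) * y powr (1 - 2 * \<alpha>) / \<alpha>"
      using y by (simp add: bessel_green_def A_def B_def Y_def)
    also have "\<dots> = ((Y - A) / ((B - A) * \<alpha>)) * (B * y powr (1 - 2 * \<alpha>) - y powr (2 * \<alpha>) * y powr (1 - 2 * \<alpha>))"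
      by (simp add: field_simps)
    also have "\<dots> = ((Y - A) / ((B - A) * \<alpha>)) * (B * y powr (1 - 2 * \<alpha>) - y)"
      using pw[of y] y ord by simp
    finally show "((Y - A) / ((B - A) * \<alpha>)) * (B * y powr (1 - 2 * \<alpha>) - y) = bessel_green \<alpha> a x b y" by simp
  qed
  have "((B - Y) / ((B - A) * \<alpha>)) * ((x\<^sup>2 - a\<^sup>2) / 2 - A * ((Y' - A') / (2 - 2 * \<alpha>)))
      + ((Y - A) / ((B - A) * \<alpha>)) * (B * ((B' - Y') / (2 - 2 * \<alpha>)) - (b\<^sup>2 - x\<^sup>2) / 2)
     = mean_exit_time \<alpha> a x b"
  proof -
    define k where "k = 2 - 2 * \<alpha>"
    have k: "k > 0" "\<alpha> = 1 - k / 2" using \<alpha> by (auto simp: k_def field_simps)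
    have nz: "B - A \<noteq> 0" "k \<noteq> 0" "\<alpha> \<noteq> 0" using AYB k \<alpha> by auto
    have "((B - Y) / ((B - A) * \<alpha>)) * ((Y * Y' - A * A') / 2 - A * ((Y' - A') / k))
      + ((Y - A) / ((B - A) * \<alpha>)) * (B * ((B' - Y') / k) - (B * B' - Y * Y') / 2)
     = ((B - Y) * (k * (Y * Y' - A * A') - 2 * (A * (Y' - A')))
       + (Y - A) * (2 * (B * (B' - Y')) - k * (B * B' - Y * Y'))) / (2 * k * ((B - A) * \<alpha>))"
      using nz by (simp add: divide_simps) (simp add: algebra_simps)
    also have "(B - Y) * (k * (Y * Y' - A * A') - 2 * (A * (Y' - A')))
       + (Y - A) * (2 * (B * (B' - Y')) - k * (B * B' - Y * Y'))
       = (2 - k) * ((Y - A) * (B * B') + (B - Y) * (A * A') - (B - A) * (Y * Y'))"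
      by (simp add: algebra_simps)
    also have "2 - k = 2 * \<alpha>" by (simp add: k_def)
    also have "2 * \<alpha> * ((Y - A) * (B * B') + (B - Y) * (A * A') - (B - A) * (Y * Y')) / (2 * k * ((B - A) * \<alpha>))
       = ((Y - A) * (B * B') + (B - Y) * (A * A') - (B - A) * (Y * Y')) / (B - A) / k"
      using nz by (simp add: divide_simps)
    also have "\<dots> = ((Y - A) / (B - A) * (B * B') + (1 - (Y - A) / (B - A)) * (A * A') - Y * Y') / k"
      using nz by (simp add: divide_simps)
    finally show ?thesis
      unfolding sq mean_exit_time_def upper_exit_prob_def A_def[symmetric] B_def[symmetric] Y_def[symmetric] k_def .
  qed
  with has_integral_combine[OF _ _ 1 2] ord
  have int: "(bessel_green \<alpha> a x b has_integral mean_exit_time \<alpha> a x b) {a..b}" by simp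
  have nn: "0 \<le> bessel_green \<alpha> a x b y" if "y \<in> {a..b}" for y
  proof -
    have "a powr (2 * \<alpha>) \<le> min x y powr (2 * \<alpha>)" "max x y powr (2 * \<alpha>) \<le> b powr (2 * \<alpha>)"
      using that ord \<alpha> by (auto intro!: powr_mono2)
    then show ?thesis unfolding bessel_green_def using \<alpha> AYB by (auto simp: A_def B_def)
  qed
  show ?thesis
    unfolding nn_integral_Ioo_eq_Icc by (rule nn_integral_has_integral_lebesgue'[OF nn int])
qed

context
  fixes \<nu> \<beta> :: real
  assumes \<nu>: "-1 < \<nu>" "\<nu> < 0" and \<beta>: "0 < \<beta>" "\<beta> < 1"
begin

lemma skew_bessel_scale_pos: "y \<ge> 0 \<Longrightarrow> skew_bessel_scale \<nu> \<beta> y = y powr (2 * (-\<nu>)) / (4 * \<beta> * (-\<nu>))"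
  using \<nu> by (simp add: skew_bessel_scale_def)

lemma skew_bessel_scale_neg:
  "y \<ge> 0 \<Longrightarrow> skew_bessel_scale \<nu> \<beta> (- y) = - (y powr (2 * (-\<nu>)) / (4 * (1 - \<beta>) * (-\<nu>)))"
  using \<nu> \<beta> by (cases "y = 0") (auto simp: skew_bessel_scale_def)

lemma skew_bessel_density_measurable [measurable]:
  "(\<lambda>x. ennreal (if x > 0 then 4 * \<beta> * x powr (2 * \<nu> + 1)
      else if x < 0 then 4 * (1 - \<beta>) * \<bar>x\<bar> powr (2 * \<nu> + 1) else 0)) \<in> borel_measurable borel"
  by measurable

lemma measurable_green_function [measurable]:
  "(\<lambda>y. green_function (skew_bessel_scale \<nu> \<beta>) a b x y) \<in> borel_measurable borel"
  unfolding green_function_def skew_bessel_scale_def by measurable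

lemma nn_integral_skew_bessel_speed:
  "(\<integral>\<^sup>+y\<in>{a<..<b}. ennreal (green_function (skew_bessel_scale \<nu> \<beta>) a b x y) \<partial>skew_bessel_speed \<nu> \<beta>)
   = (\<integral>\<^sup>+y. ennreal (if y > 0 then 4 * \<beta> * y powr (2 * \<nu> + 1)
      else if y < 0 then 4 * (1 - \<beta>) * \<bar>y\<bar> powr (2 * \<nu> + 1) else 0)
      * ennreal (green_function (skew_bessel_scale \<nu> \<beta>) a b x y) * indicator {a<..<b} y \<partial>lborel)"
  unfolding skew_bessel_speed_def
  by (subst nn_integral_density) (auto simp: mult.assoc)

lemma skew_bessel_exit_time_pos:
  assumes ord: "0 \<le> a" "a < x" "x < b"
  shows "(\<integral>\<^sup>+y\<in>{a<..<b}. ennreal (green_function (skew_bessel_scale \<nu> \<beta>) a b x y) \<partial>skew_bessel_speed \<nu> \<beta>)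
    = ennreal (mean_exit_time (- \<nu>) a x b)"
proof -
  have "(\<integral>\<^sup>+y\<in>{a<..<b}. ennreal (green_function (skew_bessel_scale \<nu> \<beta>) a b x y) \<partial>skew_bessel_speed \<nu> \<beta>)
    = (\<integral>\<^sup>+y. ennreal (bessel_green (- \<nu>) a x b y) * indicator {a<..<b} y \<partial>lborel)"
    unfolding nn_integral_skew_bessel_speed
  proof (intro nn_integral_cong)
    fix y
    show "ennreal (if y > 0 then 4 * \<beta> * y powr (2 * \<nu> + 1)
      else if y < 0 then 4 * (1 - \<beta>) * \<bar>y\<bar> powr (2 * \<nu> + 1) else 0)
      * ennreal (green_function (skew_bessel_scale \<nu> \<beta>) a b x y) * indicator {a<..<b} y
      = ennreal (bessel_green (- \<nu>) a x b y) * indicator {a<..<b} y"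
    proof (cases "y \<in> {a<..<b}")
      case True
      define c where "c = 4 * \<beta> * (-\<nu>)"
      have c: "c > 0" using \<nu> \<beta> by (simp add: c_def mult_pos_neg)
      define A B P Q where "A = a powr (2 * (-\<nu>))" and "B = b powr (2 * (-\<nu>))"
        and "P = min x y powr (2 * (-\<nu>))" and "Q = max x y powr (2 * (-\<nu>))"
      have AB: "A < B" unfolding A_def B_def using ord \<nu> by (intro powr_less_mono2) auto
      have "green_function (skew_bessel_scale \<nu> \<beta>) a b x y = (P / c - A / c) * (B / c - Q / c) / (B / c - A / c)"
        using True ord unfolding green_function_def by (simp add: skew_bessel_scale_pos A_def B_def P_def Q_def c_def)
      also have "\<dots> = (P - A) * (B - Q) / (B - A) / c"
        using AB c by (simp add: divide_simps)
      finally have g: "green_function (skew_bessel_scale \<nu> \<beta>) a b x y = (P - A) * (B - Q) / (B - A) / c" .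
      have "4 * \<beta> * y powr (2 * \<nu> + 1) * ((P - A) * (B - Q) / (B - A) / c)
         = (P - A) * (B - Q) / (B - A) * y powr (1 - 2 * (-\<nu>)) / (-\<nu>)"
        unfolding c_def using \<beta> \<nu> AB by (simp add: divide_simps add.commute)
      then show ?thesis
        using True ord \<beta> by (simp add: g ennreal_mult'[symmetric] bessel_green_def A_def B_def P_def Q_def)
    qed simp
  qed
  also have "\<dots> = ennreal (mean_exit_time (- \<nu>) a x b)"
    by (rule nn_integral_bessel_green) (use \<nu> ord in auto)
  finally show ?thesis .
qed

text \<open>
  Reflection at the origin exchanges \<open>\<beta>\<close> with \<open>1 - \<beta>\<close>, and neither enters the result.
\<close>

lemma skew_bessel_exit_time_neg:
  assumes ord: "0 \<le> a" "a < x" "x < b"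
  shows "(\<integral>\<^sup>+y\<in>{-b<..<-a}. ennreal (green_function (skew_bessel_scale \<nu> \<beta>) (-b) (-a) (-x) y) \<partial>skew_bessel_speed \<nu> \<beta>)
    = ennreal (mean_exit_time (- \<nu>) a x b)"
proof -
  define D where "D y = ennreal (if y > 0 then 4 * \<beta> * y powr (2 * \<nu> + 1)
      else if y < 0 then 4 * (1 - \<beta>) * \<bar>y\<bar> powr (2 * \<nu> + 1) else 0)
      * ennreal (green_function (skew_bessel_scale \<nu> \<beta>) (-b) (-a) (-x) y) * indicator {-b<..<-a} y" for y
  have [measurable]: "D \<in> borel_measurable borel" unfolding D_def by measurable
  have "(\<integral>\<^sup>+y\<in>{-b<..<-a}. ennreal (green_function (skew_bessel_scale \<nu> \<beta>) (-b) (-a) (-x) y) \<partial>skew_bessel_speed \<nu> \<beta>)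
    = (\<integral>\<^sup>+y. D y \<partial>lborel)"
    unfolding nn_integral_skew_bessel_speed D_def ..
  also have "\<dots> = (\<integral>\<^sup>+y. D (- y) \<partial>lborel)"
    using nn_integral_real_affine[of D "-1" 0] by simp
  also have "\<dots> = (\<integral>\<^sup>+y. ennreal (bessel_green (- \<nu>) a x b y) * indicator {a<..<b} y \<partial>lborel)"
  proof (intro nn_integral_cong)
    fix y
    show "D (- y) = ennreal (bessel_green (- \<nu>) a x b y) * indicator {a<..<b} y"
    proof (cases "y \<in> {a<..<b}")
      case True
      define c where "c = 4 * (1 - \<beta>) * (-\<nu>)"
      have c: "c > 0" using \<nu> \<beta> by (simp add: c_def mult_pos_neg)
      define A B P Q where "A = a powr (2 * (-\<nu>))" and "B = b powr (2 * (-\<nu>))"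
        and "P = min x y powr (2 * (-\<nu>))" and "Q = max x y powr (2 * (-\<nu>))"
      have AB: "A < B" unfolding A_def B_def using ord \<nu> by (intro powr_less_mono2) auto
      have mm: "min (- x) (- y) = - max x y" "max (- x) (- y) = - min x y" by auto
      have sn: "skew_bessel_scale \<nu> \<beta> (- a) = - (A / c)" "skew_bessel_scale \<nu> \<beta> (- b) = - (B / c)"
        "skew_bessel_scale \<nu> \<beta> (- min x y) = - (P / c)" "skew_bessel_scale \<nu> \<beta> (- max x y) = - (Q / c)"
        unfolding A_def B_def P_def Q_def c_def
        by (rule skew_bessel_scale_neg, use True ord in simp)+
      have "green_function (skew_bessel_scale \<nu> \<beta>) (-b) (-a) (-x) (-y)
          = (B / c - Q / c) * (P / c - A / c) / (B / c - A / c)"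
        unfolding green_function_def mm sn by simp
      also have "\<dots> = (P - A) * (B - Q) / (B - A) / c"
        using AB c by (simp add: divide_simps)
      finally have g: "green_function (skew_bessel_scale \<nu> \<beta>) (-b) (-a) (-x) (-y) = (P - A) * (B - Q) / (B - A) / c" .
      have "4 * (1 - \<beta>) * y powr (2 * \<nu> + 1) * ((P - A) * (B - Q) / (B - A) / c)
         = (P - A) * (B - Q) / (B - A) * y powr (1 - 2 * (-\<nu>)) / (-\<nu>)"
        unfolding c_def using \<beta> \<nu> AB by (simp add: divide_simps add.commute)
      then show ?thesis
        unfolding D_def g
        using True ord \<beta> by (simp add: ennreal_mult'[symmetric] bessel_green_def A_def B_def P_def Q_def)
    qed (auto simp: D_def)
  qed
  also have "\<dots> = ennreal (mean_exit_time (- \<nu>) a x b)"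
    by (rule nn_integral_bessel_green) (use \<nu> ord in auto)
  finally show ?thesis .
qed

text \<open>
  Near the origin the Green function is of order \<open>e\<^sup>2\<^sup>\<alpha>\<close> and the interval has speed measure of
  order \<open>e\<^sup>2\<^sup>-\<^sup>2\<^sup>\<alpha>\<close>, which makes the mean exit time \<open>O(e\<^sup>2)\<close>.
\<close>

lemma skew_bessel_exit_time_origin:
  assumes e: "e > 0"
  shows "(\<integral>\<^sup>+y\<in>{-e<..<e}. ennreal (green_function (skew_bessel_scale \<nu> \<beta>) (-e) e 0 y) \<partial>skew_bessel_speed \<nu> \<beta>)
    \<le> ennreal (e\<^sup>2 / ((-\<nu>) * (1 + \<nu>)))"
proof -
  define \<alpha> where "\<alpha> = -\<nu>"
  have \<alpha>: "0 < \<alpha>" "\<alpha> < 1" using \<nu> by (auto simp: \<alpha>_def)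
  define E where "E = e powr (2 * \<alpha>)"
  have E: "E > 0" using e by (simp add: E_def)
  define H where "H y = ennreal (E / \<alpha> * y powr (1 - 2 * \<alpha>)) * indicator {0..e} y" for y
  have [measurable]: "H \<in> borel_measurable borel" unfolding H_def by measurable
  have S: "skew_bessel_scale \<nu> \<beta> 0 = 0" "skew_bessel_scale \<nu> \<beta> e = E / (4 * \<beta> * \<alpha>)"
    "skew_bessel_scale \<nu> \<beta> (- e) = - (E / (4 * (1 - \<beta>) * \<alpha>))"
    using skew_bessel_scale_pos[of 0] skew_bessel_scale_pos[of e] skew_bessel_scale_neg[of e] e by (auto simp: E_def \<alpha>_def)
  have Sd: "skew_bessel_scale \<nu> \<beta> e - skew_bessel_scale \<nu> \<beta> (- e) = E / (4 * \<beta> * (1 - \<beta>) * \<alpha>)"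
    unfolding S using \<beta> \<alpha> by (simp add: divide_simps) (simp add: algebra_simps)
  have "(\<integral>\<^sup>+y\<in>{-e<..<e}. ennreal (green_function (skew_bessel_scale \<nu> \<beta>) (-e) e 0 y) \<partial>skew_bessel_speed \<nu> \<beta>)
    \<le> (\<integral>\<^sup>+y. H y + H (- y) \<partial>lborel)"
    unfolding nn_integral_skew_bessel_speed
  proof (rule nn_integral_mono)
    fix y
    consider "y \<notin> {-e<..<e}" | "y = 0" | "0 < y" "y < e" | "y < 0" "-e < y" by fastforce
    then show "ennreal (if y > 0 then 4 * \<beta> * y powr (2 * \<nu> + 1)
      else if y < 0 then 4 * (1 - \<beta>) * \<bar>y\<bar> powr (2 * \<nu> + 1) else 0)
      * ennreal (green_function (skew_bessel_scale \<nu> \<beta>) (-e) e 0 y) * indicator {-e<..<e} y \<le> H y + H (- y)"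
    proof cases
      case 3
      have yE: "y powr (2 * \<alpha>) \<le> E" unfolding E_def using 3 \<alpha> by (intro powr_mono2) auto
      have Sy: "skew_bessel_scale \<nu> \<beta> y = y powr (2 * \<alpha>) / (4 * \<beta> * \<alpha>)"
        using skew_bessel_scale_pos[of y] 3 by (simp add: \<alpha>_def)
      have "green_function (skew_bessel_scale \<nu> \<beta>) (-e) e 0 y = \<beta> * (E - y powr (2 * \<alpha>)) / (4 * \<beta> * \<alpha>)"
        unfolding green_function_def Sd using 3 \<beta> \<alpha> E by (simp add: S Sy divide_simps)
      also have "\<dots> \<le> 1 * E / (4 * \<beta> * \<alpha>)"
        using \<beta> \<alpha> E yE by (intro divide_right_mono mult_mono) auto
      finally have "4 * \<beta> * y powr (2 * \<nu> + 1) * green_function (skew_bessel_scale \<nu> \<beta>) (-e) e 0 y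
         \<le> 4 * \<beta> * y powr (2 * \<nu> + 1) * (1 * E / (4 * \<beta> * \<alpha>))"
        using \<beta> by (intro mult_left_mono) auto
      also have "\<dots> = E / \<alpha> * y powr (1 - 2 * \<alpha>)"
        using \<beta> \<alpha> by (simp add: \<alpha>_def divide_simps add.commute)
      finally show ?thesis
        using 3 \<beta> by (simp add: H_def ennreal_mult'[symmetric] ennreal_leI)
    next
      case 4
      have yE: "(-y) powr (2 * \<alpha>) \<le> E" unfolding E_def using 4 \<alpha> by (intro powr_mono2) auto
      have Sy: "skew_bessel_scale \<nu> \<beta> y = - ((-y) powr (2 * \<alpha>) / (4 * (1 - \<beta>) * \<alpha>))"
        using skew_bessel_scale_neg[of "-y"] 4 by (simp add: \<alpha>_def)
      have "green_function (skew_bessel_scale \<nu> \<beta>) (-e) e 0 y = (1 - \<beta>) * (E - (-y) powr (2 * \<alpha>)) / (4 * (1 - \<beta>) * \<alpha>)"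
        unfolding green_function_def Sd using 4 \<beta> \<alpha> E by (simp add: S Sy divide_simps)
      also have "\<dots> \<le> 1 * E / (4 * (1 - \<beta>) * \<alpha>)"
        using \<beta> \<alpha> E yE by (intro divide_right_mono mult_mono) auto
      finally have "4 * (1 - \<beta>) * (-y) powr (2 * \<nu> + 1) * green_function (skew_bessel_scale \<nu> \<beta>) (-e) e 0 y
         \<le> 4 * (1 - \<beta>) * (-y) powr (2 * \<nu> + 1) * (1 * E / (4 * (1 - \<beta>) * \<alpha>))"
        using \<beta> by (intro mult_left_mono) auto
      also have "\<dots> = E / \<alpha> * (-y) powr (1 - 2 * \<alpha>)"
        using \<beta> \<alpha> by (simp add: \<alpha>_def divide_simps add.commute)
      finally show ?thesis
        using 4 \<beta> by (simp add: H_def ennreal_mult'[symmetric] ennreal_leI)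
    qed auto
  qed
  also have "\<dots> = (\<integral>\<^sup>+y. H y \<partial>lborel) + (\<integral>\<^sup>+y. H (- y) \<partial>lborel)"
    by (rule nn_integral_add) auto
  also have "(\<integral>\<^sup>+y. H (- y) \<partial>lborel) = (\<integral>\<^sup>+y. H y \<partial>lborel)"
    using nn_integral_real_affine[of H "-1" 0] by simp
  also have "(\<integral>\<^sup>+y. H y \<partial>lborel) = ennreal (e\<^sup>2 / (\<alpha> * (2 - 2 * \<alpha>)))"
  proof -
    have "((\<lambda>y. E / \<alpha> * y powr (1 - 2 * \<alpha>)) has_integral
        E / \<alpha> * ((e powr (1 - 2 * \<alpha> + 1) - 0 powr (1 - 2 * \<alpha> + 1)) / (1 - 2 * \<alpha> + 1))) {0..e}"
      by (intro has_integral_mult_right has_integral_powr_Icc) (use \<alpha> e in auto)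
    from nn_integral_has_integral_lebesgue'[OF _ this]
    have "(\<integral>\<^sup>+y. H y \<partial>lborel) = ennreal (E / \<alpha> * ((e powr (1 - 2 * \<alpha> + 1) - 0 powr (1 - 2 * \<alpha> + 1)) / (1 - 2 * \<alpha> + 1)))"
      unfolding H_def using \<alpha> E by simp
    also have "E / \<alpha> * ((e powr (1 - 2 * \<alpha> + 1) - 0 powr (1 - 2 * \<alpha> + 1)) / (1 - 2 * \<alpha> + 1))
       = (e powr (2 * \<alpha>) * e powr (2 - 2 * \<alpha>)) / (\<alpha> * (2 - 2 * \<alpha>))"
      by (simp add: E_def)
    also have "e powr (2 * \<alpha>) * e powr (2 - 2 * \<alpha>) = e\<^sup>2"
      using e by (simp flip: powr_add)
    finally show ?thesis .
  qed
  also have "ennreal (e\<^sup>2 / (\<alpha> * (2 - 2 * \<alpha>))) + ennreal (e\<^sup>2 / (\<alpha> * (2 - 2 * \<alpha>))) = ennreal (e\<^sup>2 / ((-\<nu>) * (1 + \<nu>)))"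
  proof -
    define u where "u = e\<^sup>2 / (\<alpha> * (2 - 2 * \<alpha>))"
    have "u + u = e\<^sup>2 / (\<alpha> * (1 - \<alpha>))"
      unfolding u_def using \<alpha> by (simp add: divide_simps)
    moreover have "u \<ge> 0" unfolding u_def using \<alpha> by simp
    then have "ennreal u + ennreal u = ennreal (u + u)" by (intro ennreal_plus[symmetric])
    ultimately have "ennreal u + ennreal u = ennreal (e\<^sup>2 / (\<alpha> * (1 - \<alpha>)))" by (simp only:)
    then show ?thesis unfolding u_def \<alpha>_def by simp
  qed
  finally show ?thesis .
qed

end

section \<open>Exit from one-sided intervals\<close>

abbreviation exit_time :: "real \<Rightarrow> real \<Rightarrow> (real \<Rightarrow> real) \<Rightarrow> ennreal" where
  "exit_time a b f \<equiv> min (hit a f) (hit b f)"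

lemma stopping_time_exit: "stopping_time history (exit_time a b)"
  by (intro stopping_time_min stopping_time_hit)

text \<open>
  Until it hits an end point, a path started in \<open>(a, b)\<close> stays there, by the intermediate value theorem.
\<close>

lemma exit_path:
  assumes f: "f \<in> space path_space" and ab: "a < f 0" "f 0 < b" and fin: "exit_time a b f < \<infinity>"
  defines "\<tau> \<equiv> enn2real (exit_time a b f)"
  shows "exit_time a b f = ennreal \<tau>"
    and "f \<tau> = (if hit b f < hit a f then b else a)"
    and "hit a f \<noteq> hit b f"
    and "\<And>t. 0 \<le> t \<Longrightarrow> t < \<tau> \<Longrightarrow> a < f t \<and> f t < b"
proof -
  have c: "continuous_on {0..} f" using f by (rule path_space_continuous)
  show e: "exit_time a b f = ennreal \<tau>" using fin by (simp add: \<tau>_def)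
  have at: "f s = y" if "hit y f = ennreal s" "s \<ge> 0" for y s
    using c by (cases rule: hitting_time_cases[where X = coord and \<omega> = f and y = y]) (use that in auto)
  have \<tau>0: "\<tau> \<ge> 0" by (simp add: \<tau>_def)
  show ne: "hit a f \<noteq> hit b f"
  proof
    assume *: "hit a f = hit b f"
    then have "hit a f = ennreal \<tau>" "hit b f = ennreal \<tau>" using e by auto
    with at[OF _ \<tau>0, of a] at[OF _ \<tau>0, of b] ab show False by simp
  qed
  show "f \<tau> = (if hit b f < hit a f then b else a)"
    using e at[OF _ \<tau>0, of a] at[OF _ \<tau>0, of b] by (auto simp: min_def not_less split: if_splits)
  fix t assume t: "0 \<le> t" "t < \<tau>"
  have nohit: "f s \<noteq> y" if "y = a \<or> y = b" "s \<in> {0..t}" for s y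
  proof
    assume "f s = y"
    then have "hit y f \<le> ennreal t"
      using hitting_time_le_iff[where X = coord and \<omega> = f and t = t and y = y] c t that by auto
    then have "exit_time a b f \<le> ennreal t" using that(1) by (auto simp: min_le_iff_disj)
    then have "ennreal \<tau> \<le> ennreal t" unfolding e .
    then show False using t by simp
  qed
  have c': "continuous_on {0..t} f" by (rule continuous_on_subset[OF c]) auto
  show "a < f t \<and> f t < b"
  proof (rule ccontr)
    assume "\<not> ?thesis"
    then consider "f t \<le> a" | "b \<le> f t" by linarith
    then show False
    proof cases
      case 1
      from IVT2'[of f t a 0] 1 ab t c' obtain s where "0 \<le> s" "s \<le> t" "f s = a" by auto
      then show False using nohit[of a s] by auto
    next
      case 2
      from IVT'[of f 0 b t] 2 ab t c' obtain s where "0 \<le> s" "s \<le> t" "f s = b" by auto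
      then show False using nohit[of b s] by auto
    qed
  qed
qed

lemma hit_shift:
  assumes f: "f \<in> space path_space" and t: "t \<ge> 0" and before: "\<And>s. 0 \<le> s \<Longrightarrow> s < t \<Longrightarrow> f s \<noteq> y"
  shows "hit y f = ennreal t + hit y (shift t f)"
proof -
  have c: "continuous_on {0..} f" using f by (rule path_space_continuous)
  have "shift t f \<in> space path_space" using c t by (intro path_after_in_path_space)
  then have c': "continuous_on {0..} (shift t f)" by (rule path_space_continuous)
  show ?thesis
    using c'
  proof (cases rule: hitting_time_cases[where X = coord and \<omega> = "shift t f" and y = y])
    case never
    have "f s \<noteq> y" if "s \<ge> 0" for s
      using before[of s] never(2)[of "s - t"] that by (cases "s < t") (auto simp: path_after_def)
    note never_hit = this
    have "hit y f = \<infinity>"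
      using c
    proof (cases rule: hitting_time_cases[where X = coord and \<omega> = f and y = y])
      case (at s)
      then show ?thesis using never_hit[of s] by simp
    qed simp
    then show ?thesis using never by simp
  next
    case (at u)
    have hu: "f (t + u) = y" using at by (simp add: path_after_def)
    have lt: "f s \<noteq> y" if "0 \<le> s" "s < t + u" for s
      using before[of s] at(4)[of "s - t"] that by (cases "s < t") (auto simp: path_after_def)
    have "hit y f = ennreal (t + u)"
      using c
    proof (cases rule: hitting_time_cases[where X = coord and \<omega> = f and y = y])
      case never
      then show ?thesis using never(2)[of "t + u"] hu at(1) t by auto
    next
      case (at s)
      then have "s = t + u"
        using lt[of s] at(4)[of "t + u"] hu \<open>u \<ge> 0\<close> t by (meson add_nonneg_nonneg linorder_neqE_linordered_idom)
      then show ?thesis using at by simp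
    qed
    then show ?thesis using at t by (simp add: ennreal_plus)
  qed
qed

lemma ennreal_add_min: "min (c + a) (c + b) = c + min a (b :: ennreal)"
  by (auto simp: min_def intro: antisym add_left_mono)

text \<open>
  The Laplace variable of a random time, with \<open>e\<^sup>-\<^sup>\<infinity> = 0\<close>.
\<close>

definition discount :: "real \<Rightarrow> ennreal \<Rightarrow> real" where
  "discount l t = (if t = \<infinity> then 0 else exp (- l * enn2real t))"

lemma measurable_discount [measurable]: "discount l \<in> borel_measurable borel"
  unfolding discount_def by measurable

lemma discount_range: "l \<ge> 0 \<Longrightarrow> 0 \<le> discount l t \<and> discount l t \<le> 1"
  by (auto simp: discount_def)

lemma discount_add: "t \<ge> 0 \<Longrightarrow> discount l (ennreal t + u) = exp (- l * t) * discount l u"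
  by (cases u) (auto simp: discount_def ennreal_plus[symmetric] ring_distribs mult_exp_exp simp del: ennreal_plus)

locale skew_bessel_diffusion =
  fixes M :: "'a measure" and P :: "real \<Rightarrow> 'a measure" and X :: "real \<Rightarrow> 'a \<Rightarrow> real" and \<nu> \<beta> :: real
  assumes \<nu>: "-1 < \<nu>" "\<nu> < 0" and \<beta>: "0 < \<beta>" "\<beta> < 1"
    and skew: "skew_two_sided_bessel \<nu> \<beta> M P X"

sublocale skew_bessel_diffusion \<subseteq> diffusion M P X
  by unfold_locales (use skew in \<open>simp add: skew_two_sided_bessel_def\<close>)

context skew_bessel_diffusion
begin

definition \<alpha> :: real where "\<alpha> = - \<nu>"

lemma \<alpha>: "0 < \<alpha>" "\<alpha> < 1" using \<nu> by (auto simp: \<alpha>_def)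

abbreviation "S \<equiv> skew_bessel_scale \<nu> \<beta>"

lemma law_exit_above:
  assumes "a < x" "x < b"
  shows "measure (law x) {f \<in> space path_space. hit b f < hit a f} = (S x - S a) / (S b - S a)"
proof -
  have [measurable]: "{f \<in> space path_space. hit b f < hit a f} \<in> sets path_space"
    using measurable_hit by measurable
  have "measure (law x) {f \<in> space path_space. hit b f < hit a f}
     = measure (P x) {\<omega> \<in> space M. hitting_time X b \<omega> < hitting_time X a \<omega>}"
    unfolding law_def using measurable_space[OF measurable_path[of 0]]
    by (subst measure_distr[OF measurable_path_P]) (auto simp: hitting_time_law intro!: arg_cong[of _ _ "measure (P x)"])
  also have "\<dots> = (S x - S a) / (S b - S a)"
    using skew assms unfolding skew_two_sided_bessel_def has_scale_function_def by auto
  finally show ?thesis .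
qed

lemma law_exit_time:
  assumes "a < x" "x < b"
  shows "(\<integral>\<^sup>+f. exit_time a b f \<partial>law x)
    = (\<integral>\<^sup>+y\<in>{a<..<b}. ennreal (green_function S a b x y) \<partial>skew_bessel_speed \<nu> \<beta>)"
proof -
  have m: "exit_time a b \<in> borel_measurable path_space"
    using measurable_hit by measurable
  have "(\<integral>\<^sup>+f. exit_time a b f \<partial>law x) = (\<integral>\<^sup>+\<omega>. exit_time a b (path_after X 0 \<omega>) \<partial>P x)"
    unfolding law_def by (rule nn_integral_distr[OF measurable_path_P]) (use m in simp)
  also have "\<dots> = (\<integral>\<^sup>+\<omega>. min (hitting_time X a \<omega>) (hitting_time X b \<omega>) \<partial>P x)"
    by (simp add: hitting_time_law)
  also have "\<dots> = (\<integral>\<^sup>+y\<in>{a<..<b}. ennreal (green_function S a b x y) \<partial>skew_bessel_speed \<nu> \<beta>)"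
    using skew assms unfolding skew_two_sided_bessel_def has_speed_measure_def by auto
  finally show ?thesis .
qed

lemma AE_exit_finite:
  assumes "(\<integral>\<^sup>+f. exit_time a b f \<partial>law x) \<le> ennreal c"
  shows "AE f in law x. exit_time a b f < \<infinity>"
proof -
  have "exit_time a b \<in> borel_measurable (law x)"
    using measurable_hit by (simp add: measurable_cong_sets[OF sets_law refl])
  moreover have "(\<integral>\<^sup>+f. exit_time a b f \<partial>law x) \<noteq> \<infinity>"
    using assms by (auto simp: top_unique)
  ultimately have "AE f in law x. exit_time a b f \<noteq> \<infinity>"
    by (rule nn_integral_PInf_AE)
  then show ?thesis by eventually_elim (simp add: less_top)
qed

lemma integral_exit_value:
  assumes x: "a < x" "x < b" and fin: "AE f in law x. exit_time a b f < \<infinity>"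
    and H[measurable]: "H \<in> borel_measurable borel"
  shows "(\<integral>f. H (f (enn2real (exit_time a b f))) \<partial>law x)
    = (S x - S a) / (S b - S a) * H b + (1 - (S x - S a) / (S b - S a)) * H a"
proof -
  interpret L: prob_space "law x" by (rule prob_law)
  note [measurable] = measurable_hit
  define U where "U = {f \<in> space path_space. hit b f < hit a f}"
  have U[measurable]: "U \<in> sets path_space" unfolding U_def by measurable
  have "(\<lambda>f. f (enn2real (exit_time a b f))) \<in> borel_measurable path_space"
    by (rule measurable_coord_at) auto
  from measurable_compose[OF this H]
  have m: "(\<lambda>f. H (f (enn2real (exit_time a b f)))) \<in> borel_measurable (law x)"
    by (simp add: measurable_cong_sets[OF sets_law refl])
  have "(\<integral>f. H (f (enn2real (exit_time a b f))) \<partial>law x) = (\<integral>f. H a + (H b - H a) * indicator U f \<partial>law x)"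
  proof (rule integral_cong_AE[OF m])
    show "AE f in law x. H (f (enn2real (exit_time a b f))) = H a + (H b - H a) * indicator U f"
      using fin start_law AE_space
    proof eventually_elim
      case (elim f)
      then show ?case using exit_path(2)[of f a b] x by (auto simp: U_def)
    qed
  qed simp
  also have "\<dots> = H a + (H b - H a) * measure (law x) U"
  proof -
    have "integrable (law x) (indicator U :: _ \<Rightarrow> real)"
      by (rule integrable_real_indicator) (use L.emeasure_finite[of U] in \<open>auto simp: less_top[symmetric]\<close>)
    moreover have "measure (law x) (space path_space) = 1" using L.prob_space by simp
    ultimately show ?thesis by (subst Bochner_Integration.integral_add) auto
  qed
  also have "measure (law x) U = (S x - S a) / (S b - S a)"
    unfolding U_def by (rule law_exit_above[OF x])
  also have "H a + (H b - H a) * p = p * H b + (1 - p) * H a" for p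
    by (simp add: algebra_simps)
  finally show ?thesis .
qed

text \<open>
  The sign \<open>s\<close> selects the half-line; \<open>a\<close>, \<open>x\<close> and \<open>b\<close> are distances from the origin.
\<close>

lemma one_sided_exit_time:
  assumes s: "s = 1 \<or> s = -1" and ord: "0 \<le> a" "a < x" "x < b"
  shows "(\<integral>\<^sup>+f. exit_time (s * a) (s * b) f \<partial>law (s * x)) = ennreal (mean_exit_time \<alpha> a x b)"
  using s
proof
  assume "s = 1"
  then show ?thesis
    using law_exit_time[OF ord(2,3)] skew_bessel_exit_time_pos[OF \<nu> \<beta> ord] by (simp add: \<alpha>_def)
next
  assume "s = -1"
  then show ?thesis
    using law_exit_time[of "-b" "-x" "-a"] skew_bessel_exit_time_neg[OF \<nu> \<beta> ord] ord
    by (simp add: \<alpha>_def min.commute)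
qed

lemma AE_one_sided_exit:
  assumes s: "s = 1 \<or> s = -1" and ord: "0 \<le> a" "a < x" "x < b"
  shows "AE f in law (s * x). f \<in> space path_space \<and> exit_time (s * a) (s * b) f < \<infinity> \<and>
    f (enn2real (exit_time (s * a) (s * b) f)) \<in> {s * a, s * b} \<and>
    (\<forall>t\<ge>0. t < enn2real (exit_time (s * a) (s * b) f) \<longrightarrow> a < s * f t \<and> s * f t < b)"
proof -
  have "AE f in law (s * x). exit_time (s * a) (s * b) f < \<infinity>"
    by (rule AE_exit_finite[of _ _ _ "mean_exit_time \<alpha> a x b"]) (simp add: one_sided_exit_time[OF assms])
  with start_law[of "s * x"] AE_space[of "law (s * x)"] show ?thesis
  proof eventually_elim
    case (elim f)
    then have f: "f \<in> space path_space" by simp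
    from s show ?case
    proof
      assume [simp]: "s = 1"
      have fin: "exit_time a b f < \<infinity>" and f0: "a < f 0" "f 0 < b" using elim ord by auto
      show ?thesis
        using fin exit_path(2)[OF f f0 fin] exit_path(4)[OF f f0 fin] f by (simp split: if_splits)
    next
      assume [simp]: "s = -1"
      have e: "exit_time (- a) (- b) f = exit_time (- b) (- a) f" by (rule min.commute)
      have fin: "exit_time (- b) (- a) f < \<infinity>" and f0: "- b < f 0" "f 0 < - a" using elim ord by (auto simp: e)
      have "a < - f t \<and> - f t < b" if "0 \<le> t" "t < enn2real (exit_time (- b) (- a) f)" for t
        using exit_path(4)[OF f f0 fin that] by auto
      then show ?thesis
        using fin exit_path(2)[OF f f0 fin] f by (simp add: e split: if_splits)
    qed
  qed
qed

lemma one_sided_exit_value: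
  assumes s: "s = 1 \<or> s = -1" and ord: "0 \<le> a" "a < x" "x < b"
    and H: "H \<in> borel_measurable borel"
  shows "(\<integral>f. H (f (enn2real (exit_time (s * a) (s * b) f))) \<partial>law (s * x)) = exit_mean \<alpha> (\<lambda>y. H (s * y)) a x b"
proof -
  have fin: "AE f in law (s * x). exit_time (s * a) (s * b) f < \<infinity>"
    using AE_one_sided_exit[OF s ord] by eventually_elim auto
  have AB: "a powr (2 * \<alpha>) < b powr (2 * \<alpha>)" using ord \<alpha> by (intro powr_less_mono2) auto
  from s show ?thesis
  proof
    assume s: "s = 1"
    define c where "c = 4 * \<beta> * \<alpha>"
    have c: "c > 0" using \<alpha> \<beta> by (simp add: c_def)
    have "(S x - S a) / (S b - S a) = (x powr (2 * \<alpha>) / c - a powr (2 * \<alpha>) / c) / (b powr (2 * \<alpha>) / c - a powr (2 * \<alpha>) / c)"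
      using ord skew_bessel_scale_pos[OF \<nu> \<beta>] by (simp add: \<alpha>_def c_def)
    also have "\<dots> = upper_exit_prob \<alpha> a x b"
      using AB c by (simp add: upper_exit_prob_def divide_simps)
    moreover have "AE f in law x. exit_time a b f < \<infinity>" using fin by (simp only: s mult_1)
    ultimately show ?thesis
      using integral_exit_value[OF ord(2,3) _ H] s by (simp add: exit_mean_def)
  next
    assume s: "s = -1"
    define c where "c = 4 * (1 - \<beta>) * \<alpha>"
    have c: "c > 0" using \<alpha> \<beta> by (simp add: c_def)
    have "(S (-x) - S (-b)) / (S (-a) - S (-b)) = (b powr (2 * \<alpha>) / c - x powr (2 * \<alpha>) / c) / (b powr (2 * \<alpha>) / c - a powr (2 * \<alpha>) / c)"
      using ord skew_bessel_scale_neg[OF \<nu> \<beta>] by (simp add: \<alpha>_def c_def)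
    also have "\<dots> = 1 - upper_exit_prob \<alpha> a x b"
      using AB c by (simp add: upper_exit_prob_def divide_simps)
    moreover have "AE f in law (- x). exit_time (- b) (- a) f < \<infinity>"
      using fin by (simp only: s mult_minus1 min.commute)
    ultimately show ?thesis
      using integral_exit_value[of "-b" "-x" "-a", OF _ _ _ H] s ord
      by (simp add: exit_mean_def min.commute)
  qed
qed

lemma integral_one_sided_exit_time:
  assumes s: "s = 1 \<or> s = -1" and ord: "0 \<le> a" "a < x" "x < b"
  shows "has_bochner_integral (law (s * x)) (\<lambda>f. enn2real (exit_time (s * a) (s * b) f)) (mean_exit_time \<alpha> a x b)"
proof (rule has_bochner_integral_nn_integral)
  note [measurable] = measurable_hit
  show "(\<lambda>f. enn2real (exit_time (s * a) (s * b) f)) \<in> borel_measurable (law (s * x))"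
    by measurable
  show "0 \<le> mean_exit_time \<alpha> a x b" using mean_exit_time_pos[OF \<alpha> ord] by simp
  have "(\<integral>\<^sup>+f. ennreal (enn2real (exit_time (s * a) (s * b) f)) \<partial>law (s * x))
     = (\<integral>\<^sup>+f. exit_time (s * a) (s * b) f \<partial>law (s * x))"
    by (rule nn_integral_cong_AE) (use AE_one_sided_exit[OF assms] in eventually_elim, auto)
  then show "(\<integral>\<^sup>+f. ennreal (enn2real (exit_time (s * a) (s * b) f)) \<partial>law (s * x)) = ennreal (mean_exit_time \<alpha> a x b)"
    using one_sided_exit_time[OF assms] by simp
qed simp

text \<open>
  Write half the square of the exit time \<open>\<tau>\<close> as the integral over \<open>t\<close> of \<open>(\<tau> - t)\<^sup>+\<close>. By the Markov property at
  the fixed time \<open>t\<close>, the mean of \<open>(\<tau> - t)\<^sup>+\<close> is at most the probability of \<open>\<tau> > t\<close> times the largest mean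
  exit time of the interval.
\<close>

lemma one_sided_exit_time_second_moment:
  assumes s: "s = 1 \<or> s = -1" and ord: "0 \<le> a" "a < x" "x < b"
  shows "(\<integral>\<^sup>+f. ennreal ((enn2real (exit_time (s * a) (s * b) f))\<^sup>2 / 2) \<partial>law (s * x))
    \<le> ennreal ((b\<^sup>2 - a\<^sup>2) / (2 - 2 * \<alpha>) * mean_exit_time \<alpha> a x b)"
proof -
  define K where "K = (b\<^sup>2 - a\<^sup>2) / (2 - 2 * \<alpha>)"
  have "a\<^sup>2 \<le> b\<^sup>2" using ord by (intro power_mono) auto
  then have K: "K \<ge> 0" using \<alpha> by (simp add: K_def)
  let ?T = "exit_time (s * a) (s * b)"
  note [measurable] = measurable_hit
  interpret L: prob_space "law (s * x)" by (rule prob_law)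
  interpret LL: pair_sigma_finite "law (s * x)" lborel ..
  have tri: "ennreal (r\<^sup>2 / 2) = (\<integral>\<^sup>+t. ennreal (r - t) * indicator {0..r} t \<partial>lborel)" if "r \<ge> 0" for r :: real
  proof -
    have "(\<integral>\<^sup>+t. ennreal (r - t) * indicator {0..r} t \<partial>lborel) = ennreal ((r * r - r\<^sup>2 / 2) - (r * 0 - 0\<^sup>2 / 2))"
      using that by (intro nn_integral_FTC_Icc) (auto intro!: derivative_eq_intros)
    then show ?thesis by (simp add: power2_eq_square)
  qed
  have ind: "indicator {0..enn2real (?T f)} t = (indicator {p. 0 \<le> snd p \<and> snd p \<le> enn2real (?T (fst p))} (f, t) :: ennreal)" for f t
    by (auto simp: indicator_def)
  have step: "(\<integral>\<^sup>+f. ennreal (enn2real (?T f) - t) * indicator {0..enn2real (?T f)} t \<partial>law (s * x))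
     \<le> ennreal K * (\<integral>\<^sup>+f. indicator {0..enn2real (?T f)} t \<partial>law (s * x))" for t
  proof (cases "t \<ge> 0")
    case False
    then show ?thesis by simp
  next
    case True
    have T: "stopping_time history (\<lambda>f. ennreal t)" by (rule stopping_time_const)
    \<comment> \<open>The event that the exit has not happened by time \<open>t\<close>, which is in the past of the constant time \<open>t\<close>.\<close>
    define A where "A = {f \<in> space path_space. ennreal t < ?T f}"
    have A0: "A \<in> sets (history (ennreal t))"
      using stopping_timeD2[OF stopping_time_exit[of "s * a" "s * b"], of "ennreal t"]
      unfolding A_def by (simp add: pred_def)
    have A: "A \<in> sets (past (\<lambda>f. ennreal t))"
    proof (rule filtration.sets_pre_sigmaI[OF filtration_natural T])
      fix u
      show "{\<omega> \<in> A. ennreal t \<le> u} \<in> sets (history u)"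
      proof (cases "ennreal t \<le> u")
        case True
        then show ?thesis using filtration.sets_F_mono[OF filtration_natural True] A0 by auto
      qed simp
    qed
    have "(\<integral>\<^sup>+f. ennreal (enn2real (?T f) - t) * indicator {0..enn2real (?T f)} t \<partial>law (s * x))
       \<le> (\<integral>\<^sup>+f. indicator A f * (?T (shift (enn2real (ennreal t)) f) * indicator {f. ennreal t < \<infinity>} f) \<partial>law (s * x))"
    proof (rule nn_integral_mono_AE)
      show "AE f in law (s * x). ennreal (enn2real (?T f) - t) * indicator {0..enn2real (?T f)} t
          \<le> indicator A f * (?T (shift (enn2real (ennreal t)) f) * indicator {f. ennreal t < \<infinity>} f)"
        using AE_one_sided_exit[OF assms]
      proof eventually_elim
        case (elim f)
        show ?case
        proof (cases "t < enn2real (?T f)")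
          case less: True
          have fT: "ennreal (enn2real (?T f)) = ?T f" using elim by simp
          have "ennreal t < ennreal (enn2real (?T f))"
            using less True by (simp add: ennreal_lessI)
          then have "ennreal t < ?T f" by (simp only: fT)
          then have inA: "f \<in> A" using elim by (simp add: A_def)
          have "f u \<noteq> s * y" if "y = a \<or> y = b" "0 \<le> u" "u < t" for u y
            using elim less that s by auto
          then have "hit (s * a) f = ennreal t + hit (s * a) (shift t f)" "hit (s * b) f = ennreal t + hit (s * b) (shift t f)"
            using elim True by (auto intro!: hit_shift)
          then have "?T f = ennreal t + ?T (shift t f)" by (simp add: ennreal_add_min)
          moreover have "ennreal (enn2real (?T f) - t) = ennreal (enn2real (?T f)) - ennreal t"
            using True by (rule ennreal_minus[symmetric])
          then have "ennreal (enn2real (?T f) - t) = ?T f - ennreal t" by (simp only: fT)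
          ultimately have "ennreal (enn2real (?T f) - t) = ?T (shift t f)"
            by (simp add: ennreal_add_diff_cancel_left)
          then show ?thesis using inA True less by simp
        next
          case False
          then show ?thesis by (cases "t = enn2real (?T f)") auto
        qed
      qed
    qed
    also have "\<dots> = (\<integral>\<^sup>+f. indicator A f * ((\<integral>\<^sup>+g. ?T g \<partial>law (f (enn2real (ennreal t)))) * indicator {f. ennreal t < \<infinity>} f) \<partial>law (s * x))"
      by (rule strong_Markov_nn_integral[OF T]) (use A in measurable)
    also have "\<dots> \<le> (\<integral>\<^sup>+f. ennreal K * indicator {0..enn2real (?T f)} t \<partial>law (s * x))"
    proof (rule nn_integral_mono_AE)
      show "AE f in law (s * x). indicator A f * ((\<integral>\<^sup>+g. ?T g \<partial>law (f (enn2real (ennreal t)))) * indicator {f. ennreal t < \<infinity>} f)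
          \<le> ennreal K * indicator {0..enn2real (?T f)} t"
        using AE_one_sided_exit[OF assms]
      proof eventually_elim
        case (elim f)
        show ?case
        proof (cases "f \<in> A")
          case inA: True
          have fT: "ennreal (enn2real (?T f)) = ?T f" using elim by simp
          have less: "t < enn2real (?T f)"
          proof -
            have "ennreal t < ?T f" using inA by (simp add: A_def)
            then have "ennreal t < ennreal (enn2real (?T f))" by (simp only: fT)
            then show ?thesis using True by (simp add: ennreal_less_iff)
          qed
          have ff: "a < s * f t" "s * f t < b" using elim less True by auto
          have ss: "s * (s * f t) = f t" using s by auto
          have "(\<integral>\<^sup>+g. ?T g \<partial>law (f t)) = ennreal (mean_exit_time \<alpha> a (s * f t) b)"
            using one_sided_exit_time[OF s ord(1) ff] unfolding ss .
          also have "\<dots> \<le> ennreal K"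
            unfolding K_def using mean_exit_time_le(2)[OF \<alpha> ord(1) ff] by (rule ennreal_leI)
          finally show ?thesis using inA less True by simp
        qed simp
      qed
    qed
    also have "\<dots> = ennreal K * (\<integral>\<^sup>+f. indicator {0..enn2real (?T f)} t \<partial>law (s * x))"
      unfolding ind by (rule nn_integral_cmult) measurable
    finally show ?thesis .
  qed
  have "(\<integral>\<^sup>+f. ennreal ((enn2real (?T f))\<^sup>2 / 2) \<partial>law (s * x))
     = (\<integral>\<^sup>+f. \<integral>\<^sup>+t. ennreal (enn2real (?T f) - t) * indicator {0..enn2real (?T f)} t \<partial>lborel \<partial>law (s * x))"
    by (intro nn_integral_cong tri) simp
  also have "\<dots> = (\<integral>\<^sup>+t. \<integral>\<^sup>+f. ennreal (enn2real (?T f) - t) * indicator {0..enn2real (?T f)} t \<partial>law (s * x) \<partial>lborel)"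
    unfolding ind by (rule LL.Fubini'[symmetric]) measurable
  also have "\<dots> \<le> (\<integral>\<^sup>+t. ennreal K * (\<integral>\<^sup>+f. indicator {0..enn2real (?T f)} t \<partial>law (s * x)) \<partial>lborel)"
    by (rule nn_integral_mono) (rule step)
  also have "\<dots> = ennreal K * (\<integral>\<^sup>+t. \<integral>\<^sup>+f. indicator {0..enn2real (?T f)} t \<partial>law (s * x) \<partial>lborel)"
    unfolding ind by (rule nn_integral_cmult) measurable
  also have "(\<integral>\<^sup>+t. \<integral>\<^sup>+f. indicator {0..enn2real (?T f)} t \<partial>law (s * x) \<partial>lborel)
     = (\<integral>\<^sup>+f. \<integral>\<^sup>+t. indicator {0..enn2real (?T f)} t \<partial>lborel \<partial>law (s * x))"
    unfolding ind by (rule LL.Fubini') measurable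
  also have "\<dots> = (\<integral>\<^sup>+f. ?T f \<partial>law (s * x))"
    by (rule nn_integral_cong_AE) (use AE_one_sided_exit[OF assms] in eventually_elim, auto)
  also have "\<dots> = ennreal (mean_exit_time \<alpha> a x b)" by (rule one_sided_exit_time[OF assms])
  finally show ?thesis using ennreal_mult'[OF K, of "mean_exit_time \<alpha> a x b"] unfolding K_def by (simp only:)
qed

end

section \<open>The Laplace transform of the hitting time of the origin\<close>

context skew_bessel_diffusion
begin

definition hit_transform :: "real \<Rightarrow> real \<Rightarrow> real" where
  "hit_transform l y = (\<integral>f. discount l (hit 0 f) \<partial>law y)"

lemma measurable_discount_hit [measurable]: "(\<lambda>f. discount l (hit y f)) \<in> borel_measurable path_space"
  using measurable_hit by measurable

lemma measurable_integral_law: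
  assumes "G \<in> borel_measurable path_space"
  shows "(\<lambda>y. \<integral>f. (G f :: real) \<partial>law y) \<in> borel_measurable borel"
  by (rule measurable_compose[OF measurable_prob_algebraD[OF kernel_law] integral_measurable_subprob_algebra[OF assms]])

lemma integrable_law_bounded:
  fixes G :: "(real \<Rightarrow> real) \<Rightarrow> real"
  assumes "G \<in> borel_measurable path_space" "AE f in law y. \<bar>G f\<bar> \<le> B"
  shows "integrable (law y) G"
proof -
  interpret prob_space "law y" by (rule prob_law)
  show ?thesis using assms by (intro integrable_const_bound[of _ B]) auto
qed

lemma integral_law_range:
  fixes G :: "(real \<Rightarrow> real) \<Rightarrow> real"
  assumes G: "G \<in> borel_measurable path_space" and B: "\<And>f. f \<in> space path_space \<Longrightarrow> 0 \<le> G f \<and> G f \<le> B"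
  shows "0 \<le> (\<integral>f. G f \<partial>law y)" "(\<integral>f. G f \<partial>law y) \<le> B"
proof -
  interpret prob_space "law y" by (rule prob_law)
  show "0 \<le> (\<integral>f. G f \<partial>law y)" using B by (intro Bochner_Integration.integral_nonneg) auto
  have "integrable (law y) G"
    by (rule integrable_law_bounded[where B = B, OF G]) (use B in auto)
  then show "(\<integral>f. G f \<partial>law y) \<le> B" using B by (intro integral_le_const) auto
qed

lemma hit_transform_range: "l \<ge> 0 \<Longrightarrow> 0 \<le> hit_transform l y" "l \<ge> 0 \<Longrightarrow> hit_transform l y \<le> 1"
  unfolding hit_transform_def
  using integral_law_range[OF measurable_discount_hit discount_range, of l] by auto

lemma measurable_hit_transform [measurable]: "hit_transform l \<in> borel_measurable borel"
  unfolding hit_transform_def[abs_def] by (intro measurable_integral_law) measurable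

lemma hit_transform_0: "hit_transform l 0 = 1"
proof -
  interpret prob_space "law 0" by (rule prob_law)
  have "hit_transform l 0 = (\<integral>f. 1 \<partial>law 0)"
    unfolding hit_transform_def
  proof (rule integral_cong_AE)
    show "AE f in law 0. discount l (hit 0 f) = 1"
      using start_law[of 0] AE_space
    proof eventually_elim
      case (elim f)
      then have "hit 0 f \<le> ennreal 0"
        using hitting_time_le_iff[where X = coord and \<omega> = f and t = 0 and y = 0] path_space_continuous[of f] by auto
      then show ?case by (simp add: discount_def)
    qed
  qed measurable
  then show ?thesis using prob_space by simp
qed

lemma measurable_past_exit:
  "(\<lambda>f. h (exit_time a b f) :: real) \<in> borel_measurable (past (exit_time a b))" if "h \<in> borel_measurable borel"
  by (rule measurable_compose[OF filtration.measurable_stopping_time_pre_sigma[OF filtration_natural stopping_time_exit] that])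

text \<open>
  The origin is not in \<open>(a, b)\<close>, so it is hit only after the exit, and the two durations add up.
\<close>

lemma hit_transform_exit:
  assumes s: "s = 1 \<or> s = -1" and ord: "0 \<le> a" "a < x" "x < b" and l: "l > 0"
  shows "hit_transform l (s * x) =
    (\<integral>f. exp (- l * enn2real (exit_time (s * a) (s * b) f))
        * hit_transform l (f (enn2real (exit_time (s * a) (s * b) f))) \<partial>law (s * x))"
proof -
  let ?T = "exit_time (s * a) (s * b)"
  note [measurable] = measurable_hit
  have sh[measurable]: "(\<lambda>f. shift (enn2real (?T f)) f) \<in> path_space \<rightarrow>\<^sub>M path_space"
    by (rule measurable_shift) auto
  have at[measurable]: "(\<lambda>f. f (enn2real (?T f))) \<in> borel_measurable path_space"
    by (rule measurable_coord_at) auto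
  have ind: "(\<lambda>f. indicator {f. ?T f < \<infinity>} f :: real) \<in> borel_measurable path_space"
  proof -
    have "(\<lambda>f. indicator {f \<in> space path_space. ?T f < \<infinity>} f :: real) \<in> borel_measurable path_space" by measurable
    then show ?thesis by (rule measurable_cong[THEN iffD1, rotated]) (auto simp: indicator_def)
  qed
  note [measurable] = ind
  have "hit_transform l (s * x) = (\<integral>f. exp (- l * enn2real (?T f)) *
      (discount l (hit 0 (shift (enn2real (?T f)) f)) * indicator {f. ?T f < \<infinity>} f) \<partial>law (s * x))"
    unfolding hit_transform_def
  proof (rule integral_cong_AE)
    show "AE f in law (s * x). discount l (hit 0 f) = exp (- l * enn2real (?T f)) *
      (discount l (hit 0 (shift (enn2real (?T f)) f)) * indicator {f. ?T f < \<infinity>} f)"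
      using AE_one_sided_exit[OF s ord]
    proof eventually_elim
      case (elim f)
      have "f t \<noteq> 0" if "0 \<le> t" "t < enn2real (?T f)" for t
        using elim that ord by auto
      then have "hit 0 f = ennreal (enn2real (?T f)) + hit 0 (shift (enn2real (?T f)) f)"
        using elim by (intro hit_shift) auto
      then have "discount l (hit 0 f) = exp (- l * enn2real (?T f)) * discount l (hit 0 (shift (enn2real (?T f)) f))"
        by (simp only: discount_add enn2real_nonneg)
      then show ?case using elim by simp
    qed
  qed measurable
  also have "\<dots> = (\<integral>f. exp (- l * enn2real (?T f)) *
      ((\<integral>g. discount l (hit 0 g) \<partial>law (f (enn2real (?T f)))) * indicator {f. ?T f < \<infinity>} f) \<partial>law (s * x))"
  proof (rule strong_Markov_integral[OF stopping_time_exit])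
    show "(\<lambda>f. exp (- l * enn2real (?T f))) \<in> borel_measurable (past ?T)"
      by (rule measurable_past_exit[of "\<lambda>t. exp (- l * enn2real t)"]) measurable
    show "0 \<le> discount l (hit 0 f) \<and> discount l (hit 0 f) \<le> 1" for f
      using l by (intro discount_range) simp
  qed auto
  also have "\<dots> = (\<integral>f. exp (- l * enn2real (?T f)) * hit_transform l (f (enn2real (?T f))) \<partial>law (s * x))"
    unfolding hit_transform_def[symmetric]
  proof (rule integral_cong_AE)
    show "AE f in law (s * x). exp (- l * enn2real (?T f)) *
      (hit_transform l (f (enn2real (?T f))) * indicator {f. ?T f < \<infinity>} f)
      = exp (- l * enn2real (?T f)) * hit_transform l (f (enn2real (?T f)))"
      using AE_one_sided_exit[OF s ord] by eventually_elim auto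
  qed measurable
  finally show ?thesis .
qed

lemma one_minus_exp_ge: "1 - exp (- x) \<ge> x - x\<^sup>2 / 2" if "x \<ge> 0" for x :: real
proof -
  define g where "g y = y - y\<^sup>2 / 2 + exp (- y)" for y :: real
  have "g x \<le> g 0"
  proof (rule DERIV_nonpos_imp_nonincreasing[OF that])
    fix y :: real assume "0 \<le> y" "y \<le> x"
    have "(g has_real_derivative 1 - y - exp (- y)) (at y)"
      unfolding g_def by (auto intro!: derivative_eq_intros)
    moreover have "1 - y - exp (- y) \<le> 0" using exp_ge_add_one_self[of "- y"] by simp
    ultimately show "\<exists>d. (g has_real_derivative d) (at y) \<and> d \<le> 0" by blast
  qed
  then show ?thesis by (simp add: g_def)
qed

text \<open>
  The mean of \<open>1 - e\<^sup>-\<^sup>l\<^sup>\<tau>\<close> is \<open>l\<close> times the mean of \<open>\<tau>\<close>, up to a relative error controlled by the second moment.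
\<close>

lemma discounted_exit_bounds:
  assumes s: "s = 1 \<or> s = -1" and ord: "0 \<le> a" "a < x" "x < b" and l: "l > 0"
  shows "(\<integral>f. 1 - exp (- l * enn2real (exit_time (s * a) (s * b) f)) \<partial>law (s * x)) \<le> l * mean_exit_time \<alpha> a x b"
    and "l * mean_exit_time \<alpha> a x b * (1 - l * (b\<^sup>2 - a\<^sup>2) / (2 - 2 * \<alpha>))
      \<le> (\<integral>f. 1 - exp (- l * enn2real (exit_time (s * a) (s * b) f)) \<partial>law (s * x))"
proof -
  let ?T = "\<lambda>f. enn2real (exit_time (s * a) (s * b) f)"
  note [measurable] = measurable_hit
  define K where "K = (b\<^sup>2 - a\<^sup>2) / (2 - 2 * \<alpha>)"
  have "a\<^sup>2 \<le> b\<^sup>2" using ord by (intro power_mono) auto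
  then have K: "K \<ge> 0" using \<alpha> by (simp add: K_def)
  define e where "e = mean_exit_time \<alpha> a x b"
  have e: "e > 0" unfolding e_def by (rule mean_exit_time_pos[OF \<alpha> ord])
  have I1: "has_bochner_integral (law (s * x)) ?T e"
    unfolding e_def by (rule integral_one_sided_exit_time[OF s ord])
  have i1: "integrable (law (s * x)) ?T" "(\<integral>f. ?T f \<partial>law (s * x)) = e"
    using I1 by (auto simp: has_bochner_integral_iff)
  have m2: "(\<integral>\<^sup>+f. ennreal ((?T f)\<^sup>2 / 2) \<partial>law (s * x)) \<le> ennreal (K * e)"
    using one_sided_exit_time_second_moment[OF s ord] unfolding K_def e_def .
  have i2: "integrable (law (s * x)) (\<lambda>f. (?T f)\<^sup>2 / 2)"
    by (rule integrableI_bounded) (use m2 in \<open>auto simp: less_top[symmetric] top_unique\<close>)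
  have "ennreal (\<integral>f. (?T f)\<^sup>2 / 2 \<partial>law (s * x)) \<le> ennreal (K * e)"
    using m2 nn_integral_eq_integral[OF i2] by simp
  then have s2: "(\<integral>f. (?T f)\<^sup>2 / 2 \<partial>law (s * x)) \<le> K * e"
    using K e by (subst (asm) ennreal_le_iff) auto
  have i3: "integrable (law (s * x)) (\<lambda>f. 1 - exp (- l * ?T f))"
    by (rule integrable_law_bounded[where B = 1]) (use l in \<open>auto simp: mult_nonneg_nonneg\<close>)
  have "(\<integral>f. 1 - exp (- l * ?T f) \<partial>law (s * x)) \<le> (\<integral>f. l * ?T f \<partial>law (s * x))"
  proof (rule integral_mono[OF i3])
    show "integrable (law (s * x)) (\<lambda>f. l * ?T f)" using i1 by auto
    show "1 - exp (- l * ?T f) \<le> l * ?T f" for f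
      using exp_ge_add_one_self[of "- (l * ?T f)"] by simp
  qed
  then show "(\<integral>f. 1 - exp (- l * ?T f) \<partial>law (s * x)) \<le> l * mean_exit_time \<alpha> a x b"
    using i1 by (simp add: e_def)
  have "(\<integral>f. l * ?T f - l\<^sup>2 * ((?T f)\<^sup>2 / 2) \<partial>law (s * x)) \<le> (\<integral>f. 1 - exp (- l * ?T f) \<partial>law (s * x))"
  proof (rule integral_mono[OF _ i3])
    show "integrable (law (s * x)) (\<lambda>f. l * ?T f - l\<^sup>2 * ((?T f)\<^sup>2 / 2))"
      using i1 i2 by (intro Bochner_Integration.integrable_diff integrable_mult_right)
    show "l * ?T f - l\<^sup>2 * ((?T f)\<^sup>2 / 2) \<le> 1 - exp (- l * ?T f)" for f
      using one_minus_exp_ge[of "l * ?T f"] l by (simp add: power_mult_distrib)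
  qed
  moreover have "(\<integral>f. l * ?T f - l\<^sup>2 * ((?T f)\<^sup>2 / 2) \<partial>law (s * x)) = l * e - l\<^sup>2 * (\<integral>f. (?T f)\<^sup>2 / 2 \<partial>law (s * x))"
    using i1 i2 by (subst Bochner_Integration.integral_diff) (auto simp del: times_divide_eq_right)
  moreover have "l\<^sup>2 * (\<integral>f. (?T f)\<^sup>2 / 2 \<partial>law (s * x)) \<le> l\<^sup>2 * (K * e)"
    by (rule mult_left_mono[OF s2]) simp
  moreover have "l * e - l\<^sup>2 * (K * e) = l * e * (1 - l * K)"
    by (simp add: power2_eq_square algebra_simps)
  ultimately have "l * e * (1 - l * K) \<le> (\<integral>f. 1 - exp (- l * ?T f) \<partial>law (s * x))" by linarith
  then show "l * mean_exit_time \<alpha> a x b * (1 - l * (b\<^sup>2 - a\<^sup>2) / (2 - 2 * \<alpha>))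
      \<le> (\<integral>f. 1 - exp (- l * ?T f) \<partial>law (s * x))"
    unfolding K_def e_def by simp
qed

lemma hit_transform_killed_harmonic:
  assumes s: "s = 1 \<or> s = -1" and l: "l > 0"
  shows "killed_harmonic \<alpha> l (\<lambda>x. hit_transform l (s * x))"
  unfolding killed_harmonic_def
proof (intro conjI allI impI)
  show "0 \<le> hit_transform l (s * x)" "hit_transform l (s * x) \<le> 1" for x
    using l by (auto intro!: hit_transform_range)
  show "hit_transform l (s * 0) = 1" by (simp add: hit_transform_0)
  fix a x b :: real assume ord: "0 \<le> a" "a < x" "x < b"
  let ?T = "\<lambda>f. enn2real (exit_time (s * a) (s * b) f)"
  let ?v = "hit_transform l"
  note [measurable] = measurable_hit
  have at[measurable]: "(\<lambda>f. f (?T f)) \<in> borel_measurable path_space"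
    by (rule measurable_coord_at) auto
  have vr: "0 \<le> ?v y" "?v y \<le> 1" for y using l by (auto intro!: hit_transform_range)
  define J where "J = (\<integral>f. (1 - exp (- l * ?T f)) * ?v (f (?T f)) \<partial>law (s * x))"
  have ex: "0 \<le> 1 - exp (- l * ?T f)" "1 - exp (- l * ?T f) \<le> 1" for f
    using l by (auto simp: mult_nonneg_nonneg)
  have "integrable (law (s * x)) (\<lambda>f. ?v (f (?T f)))"
    by (rule integrable_law_bounded[where B = 1]) (auto simp: vr)
  moreover have "integrable (law (s * x)) (\<lambda>f. exp (- l * ?T f) * ?v (f (?T f)))"
    by (rule integrable_law_bounded[where B = 1]) (use l vr in \<open>auto simp: abs_mult mult_nonneg_nonneg intro!: mult_le_one\<close>)
  ultimately have "J = (\<integral>f. ?v (f (?T f)) \<partial>law (s * x)) - (\<integral>f. exp (- l * ?T f) * ?v (f (?T f)) \<partial>law (s * x))"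
    unfolding J_def by (subst Bochner_Integration.integral_diff[symmetric]) (auto simp: left_diff_distrib)
  also have "\<dots> = exit_mean \<alpha> (\<lambda>x. ?v (s * x)) a x b - ?v (s * x)"
    unfolding hit_transform_exit[OF s ord l, symmetric]
    by (subst one_sided_exit_value[OF s ord]) auto
  finally have J: "exit_mean \<alpha> (\<lambda>x. ?v (s * x)) a x b - ?v (s * x) = J" ..
  have iJ: "integrable (law (s * x)) (\<lambda>f. (1 - exp (- l * ?T f)) * ?v (f (?T f)))"
    by (rule integrable_law_bounded[where B = 1]) (use ex vr in \<open>auto simp: abs_mult intro!: mult_le_one\<close>)
  have i1: "integrable (law (s * x)) (\<lambda>f. 1 - exp (- l * ?T f))"
    by (rule integrable_law_bounded[where B = 1]) (use ex in \<open>auto\<close>)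
  have "min (?v (s * a)) (?v (s * b)) * (\<integral>f. 1 - exp (- l * ?T f) \<partial>law (s * x)) \<le> J"
  proof -
    have "(\<integral>f. (1 - exp (- l * ?T f)) * min (?v (s * a)) (?v (s * b)) \<partial>law (s * x)) \<le> J"
      unfolding J_def
    proof (rule integral_mono_AE)
      show "AE f in law (s * x). (1 - exp (- l * ?T f)) * min (?v (s * a)) (?v (s * b)) \<le> (1 - exp (- l * ?T f)) * ?v (f (?T f))"
        using AE_one_sided_exit[OF s ord]
        by eventually_elim (intro mult_left_mono ex, auto)
    qed (use iJ i1 in auto)
    then show ?thesis by (simp add: mult.commute)
  qed
  moreover have "min (?v (s * a)) (?v (s * b)) * (l * mean_exit_time \<alpha> a x b * (1 - l * (b\<^sup>2 - a\<^sup>2) / (2 - 2 * \<alpha>)))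
     \<le> min (?v (s * a)) (?v (s * b)) * (\<integral>f. 1 - exp (- l * ?T f) \<partial>law (s * x))"
    using vr by (intro mult_left_mono discounted_exit_bounds[OF s ord l]) auto
  ultimately show "l * mean_exit_time \<alpha> a x b * (min (?v (s * a)) (?v (s * b)) * (1 - l * (b\<^sup>2 - a\<^sup>2) / (2 - 2 * \<alpha>)))
      \<le> exit_mean \<alpha> (\<lambda>x. ?v (s * x)) a x b - ?v (s * x)"
    unfolding J by (simp only: mult_ac)
  have "J \<le> max (?v (s * a)) (?v (s * b)) * (\<integral>f. 1 - exp (- l * ?T f) \<partial>law (s * x))"
  proof -
    have "J \<le> (\<integral>f. (1 - exp (- l * ?T f)) * max (?v (s * a)) (?v (s * b)) \<partial>law (s * x))"
      unfolding J_def
    proof (rule integral_mono_AE)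
      show "AE f in law (s * x). (1 - exp (- l * ?T f)) * ?v (f (?T f)) \<le> (1 - exp (- l * ?T f)) * max (?v (s * a)) (?v (s * b))"
        using AE_one_sided_exit[OF s ord]
        by eventually_elim (intro mult_left_mono ex, auto)
    qed (use iJ i1 in auto)
    then show ?thesis by (simp add: mult.commute)
  qed
  also have "\<dots> \<le> max (?v (s * a)) (?v (s * b)) * (l * mean_exit_time \<alpha> a x b)"
    using vr[of "s * a"] by (intro mult_left_mono discounted_exit_bounds[OF s ord l]) auto
  finally show "exit_mean \<alpha> (\<lambda>x. ?v (s * x)) a x b - ?v (s * x)
      \<le> l * mean_exit_time \<alpha> a x b * max (?v (s * a)) (?v (s * b))"
    unfolding J by (simp only: mult_ac)
qed

end

section \<open>The occupation clock of a path\<close>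

abbreviation occ :: "real \<Rightarrow> (real \<Rightarrow> real) \<Rightarrow> real" where
  "occ \<equiv> occupation_nonneg coord"

lemma integral_split_shift:
  fixes h :: "real \<Rightarrow> real"
  assumes int: "integrable lborel (\<lambda>u. indicator {0..} u * h u)" and T: "T \<ge> 0"
  shows "(\<integral>u. indicator {0..} u * h u \<partial>lborel)
    = (\<integral>u. indicator {0..T} u * h u \<partial>lborel) + (\<integral>u. indicator {0..} u * h (T + u) \<partial>lborel)"
proof -
  have mul: "integrable lborel (\<lambda>u. indicator A u * (indicator {0..} u * h u))" if "A \<in> sets borel" for A
    using that by (intro integrable_real_mult_indicator[OF _ int, unfolded mult.commute[of _ "indicator _ _"]]) auto
  have eq1: "indicator {0..T} u * h u = indicator {0..T} u * (indicator {0..} u * h u)"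
    and eq2: "indicator {T<..} u * h u = indicator {T<..} u * (indicator {0..} u * h u)" for u
    using T by (auto simp: indicator_def)
  have i1: "integrable lborel (\<lambda>u. indicator {0..T} u * h u)" "integrable lborel (\<lambda>u. indicator {T<..} u * h u)"
    unfolding eq1 eq2 by (rule mul, simp)+
  have "(\<integral>u. indicator {0..} u * h u \<partial>lborel) = (\<integral>u. indicator {0..T} u * h u + indicator {T<..} u * h u \<partial>lborel)"
    using T by (intro Bochner_Integration.integral_cong) (auto simp: indicator_def)
  also have "\<dots> = (\<integral>u. indicator {0..T} u * h u \<partial>lborel) + (\<integral>u. indicator {T<..} u * h u \<partial>lborel)"
    by (rule Bochner_Integration.integral_add[OF i1])
  also have "(\<integral>u. indicator {T<..} u * h u \<partial>lborel) = (\<integral>u. indicator {0<..} u * h (T + u) \<partial>lborel)"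
    using lborel_integral_real_affine[of 1 "\<lambda>u. indicator {T<..} u * h u" T] by (simp add: indicator_def)
  also have "\<dots> = (\<integral>u. indicator {0..} u * h (T + u) \<partial>lborel)"
  proof (rule integral_cong_AE)
    have "integrable lborel (\<lambda>u. indicator {T<..} (T + 1 * u) * h (T + 1 * u))"
      by (rule lborel_integrable_real_affine[OF i1(2)]) simp
    then have m: "(\<lambda>u. indicator {0<..} u * h (T + u)) \<in> borel_measurable lborel"
      by (auto simp: indicator_def dest: borel_measurable_integrable)
    show "(\<lambda>u. indicator {0<..} u * h (T + u)) \<in> borel_measurable lborel" by (rule m)
    have "(\<lambda>u. indicator {0<..} u * h (T + u) + indicator {0} u * h T) \<in> borel_measurable lborel"
      by (intro borel_measurable_add m) auto
    moreover have "(\<lambda>u. indicator {0<..} u * h (T + u) + indicator {0} u * h T) = (\<lambda>u. indicator {0..} u * h (T + u))"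
      by (auto simp: fun_eq_iff indicator_def)
    ultimately show "(\<lambda>u. indicator {0..} u * h (T + u)) \<in> borel_measurable lborel" by simp
    show "AE u in lborel. indicator {0<..} u * h (T + u) = indicator {0..} u * h (T + u)"
      using AE_lborel_singleton[of "0::real"] by eventually_elim (auto simp: indicator_def)
  qed
  finally show ?thesis .
qed

lemma borel_measurable_path:
  assumes "f \<in> space path_space"
  shows "(\<lambda>u. f (max 0 u)) \<in> borel_measurable borel"
proof (rule borel_measurable_continuous_onI)
  show "continuous_on UNIV (\<lambda>u. f (max 0 u))"
    by (rule continuous_on_compose2[OF path_space_continuous[OF assms]]) (auto intro!: continuous_intros)
qed

lemma occ_set_measurable:
  assumes "f \<in> space path_space"
  shows "{s \<in> {0..t}. 0 \<le> f s} \<in> sets borel"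
proof -
  note [measurable] = borel_measurable_path[OF assms]
  have "{s \<in> space borel. s \<in> {0..t} \<and> 0 \<le> f (max 0 s)} \<in> sets borel" by measurable
  also have "{s \<in> space borel. s \<in> {0..t} \<and> 0 \<le> f (max 0 s)} = {s \<in> {0..t}. 0 \<le> f s}"
    by auto
  finally show ?thesis .
qed

lemma emeasure_occ_set_finite:
  assumes "f \<in> space path_space"
  shows "emeasure lborel {s \<in> {0..t}. 0 \<le> f s} < \<infinity>"
proof -
  have "emeasure lborel {s \<in> {0..t}. 0 \<le> f s} \<le> emeasure lborel {0..t}"
    by (rule emeasure_mono) auto
  also have "\<dots> < \<infinity>" by (cases "0 \<le> t") auto
  finally show ?thesis .
qed

lemma occ_nonneg: "0 \<le> occ t f"
  by (simp add: occupation_nonneg_def)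

lemma occ_le: "occ t f \<le> t" if "t \<ge> 0" "f \<in> space path_space"
proof -
  have "measure lborel {s \<in> {0..t}. 0 \<le> f s} \<le> measure lborel {0..t}"
    by (rule measure_mono_fmeasurable) (use that occ_set_measurable in \<open>auto simp: fmeasurable_def\<close>)
  then show ?thesis using that by (simp add: occupation_nonneg_def)
qed

lemma occ_integral:
  assumes f: "f \<in> space path_space"
  shows "integrable lborel (\<lambda>u. indicator {0..} u * (indicator {0..t} u * indicator {0..} (f (max 0 u)) :: real))"
    and "occ t f = (\<integral>u. indicator {0..} u * (indicator {0..t} u * indicator {0..} (f (max 0 u))) \<partial>lborel)"
proof -
  have eq: "indicator {0..} u * (indicator {0..t} u * indicator {0..} (f (max 0 u)) :: real)
      = indicator {s \<in> {0..t}. 0 \<le> f s} u" for u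
    by (auto simp: indicator_def)
  show "integrable lborel (\<lambda>u. indicator {0..} u * (indicator {0..t} u * indicator {0..} (f (max 0 u)) :: real))"
    unfolding eq using occ_set_measurable[OF f] emeasure_occ_set_finite[OF f]
    by (intro integrable_real_indicator) auto
  show "occ t f = (\<integral>u. indicator {0..} u * (indicator {0..t} u * indicator {0..} (f (max 0 u))) \<partial>lborel)"
    unfolding eq by (simp add: occupation_nonneg_def)
qed

lemma shift_in_path_space: "f \<in> space path_space \<Longrightarrow> t \<ge> 0 \<Longrightarrow> shift t f \<in> space path_space"
  by (rule path_after_in_path_space[where X = coord]) (rule path_space_continuous)

lemma occ_add:
  assumes f: "f \<in> space path_space" and T: "T \<ge> 0" and t: "t \<ge> 0"
  shows "occ (T + t) f = occ T f + occ t (shift T f)"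
proof -
  have "occ (T + t) f = (\<integral>u. indicator {0..T} u * (indicator {0..T + t} u * indicator {0..} (f (max 0 u))) \<partial>lborel)
      + (\<integral>u. indicator {0..} u * (indicator {0..T + t} (T + u) * indicator {0..} (f (max 0 (T + u)))) \<partial>lborel)"
    unfolding occ_integral(2)[OF f] by (rule integral_split_shift[OF occ_integral(1)[OF f] T])
  also have "(\<integral>u. indicator {0..T} u * (indicator {0..T + t} u * indicator {0..} (f (max 0 u))) \<partial>lborel) = occ T f"
    unfolding occ_integral(2)[OF f] by (rule Bochner_Integration.integral_cong) (use t in \<open>auto simp: indicator_def\<close>)
  also have "(\<integral>u. indicator {0..} u * (indicator {0..T + t} (T + u) * indicator {0..} (f (max 0 (T + u)))) \<partial>lborel) = occ t (shift T f)"
    unfolding occ_integral(2)[OF shift_in_path_space[OF f T]]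
    by (rule Bochner_Integration.integral_cong) (use T t in \<open>auto simp: indicator_def path_after_def max_def\<close>)
  finally show ?thesis .
qed

lemma measurable_occ:
  "(\<lambda>p. occ (fst p) (snd p)) \<in> borel_measurable (borel \<Otimes>\<^sub>M path_space)"
proof -
  let ?N = "borel \<Otimes>\<^sub>M path_space"
  have [measurable]: "(\<lambda>q. snd (fst q) (max 0 (snd q))) \<in> borel_measurable (?N \<Otimes>\<^sub>M lborel)"
    by (rule measurable_coord_at) auto
  define Q where "Q = {q \<in> space (?N \<Otimes>\<^sub>M lborel). 0 \<le> snd q \<and> snd q \<le> fst (fst q) \<and> 0 \<le> snd (fst q) (max 0 (snd q))}"
  have "Q \<in> sets (?N \<Otimes>\<^sub>M lborel)" unfolding Q_def by measurable
  from lborel.measurable_emeasure_Pair[OF this]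
  have "(\<lambda>p. enn2real (emeasure lborel (Pair p -` Q))) \<in> borel_measurable ?N" by measurable
  moreover have "enn2real (emeasure lborel (Pair p -` Q)) = occ (fst p) (snd p)" if "p \<in> space ?N" for p
  proof -
    have "Pair p -` Q = {s \<in> {0..fst p}. 0 \<le> snd p s}"
      using that by (auto simp: Q_def space_pair_measure)
    then show ?thesis by (simp add: occupation_nonneg_def measure_def)
  qed
  ultimately show ?thesis by (subst (asm) measurable_cong) auto
qed

lemma measurable_occ': "T \<in> borel_measurable N \<Longrightarrow> F \<in> N \<rightarrow>\<^sub>M path_space \<Longrightarrow> (\<lambda>x. occ (T x) (F x)) \<in> borel_measurable N"
  using measurable_compose[OF _ measurable_occ, of "\<lambda>x. (T x, F x)" N] by simp

text \<open>
  The accumulated killing up to time \<open>t\<close> at rate \<open>c\<close> on \<open>[0, \<infinity>)\<close> and rate \<open>d\<close> on \<open>(-\<infinity>, 0)\<close>.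
\<close>

definition clock :: "real \<Rightarrow> real \<Rightarrow> real \<Rightarrow> (real \<Rightarrow> real) \<Rightarrow> real" where
  "clock c d t f = c * occ t f + d * (t - occ t f)"

text \<open>
  The mean lifetime, for a given path, of a particle that moves along the path and is killed according to the clock.
\<close>

definition lifetime :: "real \<Rightarrow> real \<Rightarrow> (real \<Rightarrow> real) \<Rightarrow> real" where
  "lifetime c d f = (\<integral>t. indicator {0..} t * exp (- clock c d t f) \<partial>lborel)"

lemma clock_add:
  "f \<in> space path_space \<Longrightarrow> T \<ge> 0 \<Longrightarrow> t \<ge> 0 \<Longrightarrow> clock c d (T + t) f = clock c d T f + clock c d t (shift T f)"
  unfolding clock_def by (simp add: occ_add algebra_simps)

lemma clock_bounds:
  assumes "f \<in> space path_space" "t \<ge> 0"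
  shows "min c d * t \<le> clock c d t f" "clock c d t f \<le> max c d * t"
proof -
  have o: "0 \<le> occ t f" "0 \<le> t - occ t f" using occ_nonneg occ_le[OF assms(2,1)] by auto
  have "min c d * occ t f + min c d * (t - occ t f) \<le> clock c d t f"
    unfolding clock_def using o by (intro add_mono mult_right_mono) auto
  then show "min c d * t \<le> clock c d t f" by (simp add: algebra_simps)
  have "clock c d t f \<le> max c d * occ t f + max c d * (t - occ t f)"
    unfolding clock_def using o by (intro add_mono mult_right_mono) auto
  then show "clock c d t f \<le> max c d * t" by (simp add: algebra_simps)
qed

lemma measurable_clock:
  "T \<in> borel_measurable N \<Longrightarrow> F \<in> N \<rightarrow>\<^sub>M path_space \<Longrightarrow> (\<lambda>x. clock c d (T x) (F x)) \<in> borel_measurable N"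
proof -
  assume [measurable]: "T \<in> borel_measurable N" and F: "F \<in> N \<rightarrow>\<^sub>M path_space"
  have [measurable]: "(\<lambda>x. occ (T x) (F x)) \<in> borel_measurable N"
    by (rule measurable_occ'[OF _ F]) measurable
  show ?thesis unfolding clock_def by measurable
qed

lemma measurable_lifetime: "lifetime c d \<in> borel_measurable path_space"
proof -
  have [measurable]: "(\<lambda>p. clock c d (snd p) (fst p)) \<in> borel_measurable (path_space \<Otimes>\<^sub>M lborel)"
    by (rule measurable_clock) auto
  show ?thesis
    unfolding lifetime_def[abs_def]
    by (rule lborel.borel_measurable_lebesgue_integral) (simp add: split_beta', measurable)
qed

lemma integral_Icc_exp:
  fixes l T :: real
  assumes "T \<ge> 0" and l: "l > 0"
  shows "(\<integral>t. indicator {0..T} t * exp (- l * t) \<partial>lborel) = (1 - exp (- l * T)) / l"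
proof -
  have "(\<integral>t. exp (- l * t) * indicator {0..T} t \<partial>lborel) = (- exp (- l * T) / l) - (- exp (- l * 0) / l)"
    by (rule integral_FTC_Icc_real[where F = "\<lambda>t. - exp (- l * t) / l" and f = "\<lambda>t. exp (- l * t)" and a = 0 and b = T])
       (use assms in \<open>auto intro!: derivative_eq_intros\<close>)
  then show ?thesis by (simp add: mult.commute[of "indicator _ _"] diff_divide_distrib)
qed

context
  fixes c d :: real
  assumes cd: "c > 0" "d > 0"
begin

lemma integrable_lifetime:
  assumes f: "f \<in> space path_space"
  shows "integrable lborel (\<lambda>t. indicator {0..} t * exp (- clock c d t f))"
proof (rule Bochner_Integration.integrable_bound)
  show "integrable lborel (\<lambda>t. indicator {0..} t * (exp (- min c d * t) * t ^ 0) :: real)"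
    using has_bochner_integral_power_exp[of "min c d" 0] cd by (auto simp: has_bochner_integral_iff)
  have [measurable]: "(\<lambda>t. clock c d t f) \<in> borel_measurable borel"
    by (rule measurable_clock) (use f in auto)
  show "(\<lambda>t. indicator {0..} t * exp (- clock c d t f)) \<in> borel_measurable lborel" by measurable
  show "AE t in lborel. norm (indicator {0..} t * exp (- clock c d t f))
      \<le> norm (indicator {0..} t * (exp (- min c d * t) * t ^ 0) :: real)"
    using clock_bounds(1)[OF f, of _ c d] by (auto simp: indicator_def)
qed

lemma lifetime_range:
  assumes f: "f \<in> space path_space"
  shows "0 \<le> lifetime c d f" "lifetime c d f \<le> 1 / min c d"
proof -
  show "0 \<le> lifetime c d f"
    unfolding lifetime_def by (intro Bochner_Integration.integral_nonneg) auto
  have "lifetime c d f \<le> (\<integral>t. indicator {0..} t * (exp (- min c d * t) * t ^ 0) \<partial>lborel)"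
    unfolding lifetime_def
  proof (rule integral_mono[OF integrable_lifetime[OF f]])
    show "integrable lborel (\<lambda>t. indicator {0..} t * (exp (- min c d * t) * t ^ 0) :: real)"
      using has_bochner_integral_power_exp[of "min c d" 0] cd by (auto simp: has_bochner_integral_iff)
    show "indicator {0..} t * exp (- clock c d t f) \<le> indicator {0..} t * (exp (- min c d * t) * t ^ 0)" for t
      using clock_bounds(1)[OF f, of t c d] by (auto simp: indicator_def)
  qed
  then show "lifetime c d f \<le> 1 / min c d"
    using has_bochner_integral_power_exp[of "min c d" 0] cd by (auto simp: has_bochner_integral_iff)
qed

lemma lifetime_shift:
  assumes f: "f \<in> space path_space" and T: "T \<ge> 0"
  shows "lifetime c d f = (\<integral>t. indicator {0..T} t * exp (- clock c d t f) \<partial>lborel)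
      + exp (- clock c d T f) * lifetime c d (shift T f)"
proof -
  have "lifetime c d f = (\<integral>t. indicator {0..T} t * exp (- clock c d t f) \<partial>lborel)
      + (\<integral>t. indicator {0..} t * exp (- clock c d (T + t) f) \<partial>lborel)"
    unfolding lifetime_def by (rule integral_split_shift[OF integrable_lifetime[OF f] T])
  also have "(\<integral>t. indicator {0..} t * exp (- clock c d (T + t) f) \<partial>lborel)
      = (\<integral>t. exp (- clock c d T f) * (indicator {0..} t * exp (- clock c d t (shift T f))) \<partial>lborel)"
    by (rule Bochner_Integration.integral_cong)
       (auto simp: indicator_def clock_add[OF f T] exp_add[symmetric])
  also have "\<dots> = exp (- clock c d T f) * lifetime c d (shift T f)"
    unfolding lifetime_def by simp
  finally show ?thesis .
qed

text \<open>
  Forgetting the path up to time \<open>T\<close> removes at most the time \<open>T\<close> itself, and the killing during this time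
  has probability at most \<open>max c d * T\<close> and costs at most the remaining mean lifetime \<open>1 / min c d\<close>.
\<close>

lemma lifetime_shift_diff:
  assumes f: "f \<in> space path_space" and T: "T \<ge> 0"
  shows "\<bar>lifetime c d f - lifetime c d (shift T f)\<bar> \<le> (1 + max c d / min c d) * T"
proof -
  define I where "I = (\<integral>t. indicator {0..T} t * exp (- clock c d t f) \<partial>lborel)"
  have "I \<le> (\<integral>t. indicator {0..T} t \<partial>lborel)"
    unfolding I_def
  proof (rule integral_mono)
    have "integrable lborel (\<lambda>t. (indicator {0..} t * exp (- clock c d t f)) * indicator {0..T} t)"
      by (rule integrable_real_mult_indicator[OF _ integrable_lifetime[OF f]]) simp
    also have "(\<lambda>t. (indicator {0..} t * exp (- clock c d t f)) * indicator {0..T} t)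
        = (\<lambda>t. indicator {0..T} t * exp (- clock c d t f))"
      by (auto simp: fun_eq_iff indicator_def)
    finally show "integrable lborel (\<lambda>t. indicator {0..T} t * exp (- clock c d t f))" .
    show "integrable lborel (indicator {0..T} :: real \<Rightarrow> real)"
      by (rule integrable_real_indicator) (use T in auto)
    show "indicator {0..T} t * exp (- clock c d t f) \<le> indicator {0..T} t" for t
    proof (cases "t \<in> {0..T}")
      case True
      then have "0 \<le> min c d * t" using cd by auto
      also have "\<dots> \<le> clock c d t f" using clock_bounds[OF f] True by auto
      finally show ?thesis using True by simp
    qed simp
  qed
  then have I: "I \<le> T" using T by simp
  have I0: "0 \<le> I" unfolding I_def by (intro Bochner_Integration.integral_nonneg) auto
  define L where "L = lifetime c d (shift T f)"
  have L: "0 \<le> L" "L \<le> 1 / min c d" unfolding L_def using lifetime_range[OF shift_in_path_space[OF f T]] by auto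
  define k where "k = clock c d T f"
  have k: "0 \<le> k" "k \<le> max c d * T"
  proof -
    have "0 \<le> min c d * T" using cd T by auto
    then show "0 \<le> k" "k \<le> max c d * T" using clock_bounds[OF f T, of c d] by (auto simp: k_def)
  qed
  have "(1 - exp (- k)) * L \<le> (max c d * T) * (1 / min c d)"
    using L k exp_ge_add_one_self[of "- k"] by (intro mult_mono) auto
  moreover have "0 \<le> (1 - exp (- k)) * L" using L k by auto
  moreover have "lifetime c d f - L = I - (1 - exp (- k)) * L"
    unfolding lifetime_shift[OF f T] L_def[symmetric] I_def k_def by (simp add: algebra_simps)
  ultimately have "\<bar>lifetime c d f - L\<bar> \<le> T + (max c d * T) * (1 / min c d)" using I I0 by linarith
  also have "\<dots> = (1 + max c d / min c d) * T" by (simp add: algebra_simps)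
  finally show ?thesis unfolding L_def .
qed

end

lemma sign_before_hit_zero:
  assumes f: "f \<in> space path_space" and s: "s = 1 \<or> s = -1" and f0: "s * f 0 > 0" and t: "t \<ge> 0" "ennreal t < hit 0 f"
  shows "s * f t > 0"
proof (rule ccontr)
  assume neg: "\<not> ?thesis"
  have "continuous_on {0..t} (\<lambda>u. s * f u)"
    by (intro continuous_intros continuous_on_subset[OF path_space_continuous[OF f]]) auto
  from IVT2'[OF _ _ _ this, of 0] neg f0 t obtain u where "0 \<le> u" "u \<le> t" "s * f u = 0" by auto
  then have "hit 0 f \<le> ennreal t"
    using s hitting_time_le_iff[where X = coord and \<omega> = f and t = t and y = 0] path_space_continuous[OF f] t by auto
  then show False using t by simp
qed

text \<open>
  Before the origin is hit only one of the two rates is active. The time of the hit belongs to \<open>[0, \<infinity>)\<close> even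
  for a path coming from the negative side, but it is a single instant.
\<close>

lemma clock_before_hit_zero:
  assumes f: "f \<in> space path_space" and s: "s = 1 \<or> s = -1" and f0: "s * f 0 > 0" and t: "t \<ge> 0" "ennreal t \<le> hit 0 f"
  shows "clock c d t f = (if s = 1 then c else d) * t"
proof -
  have pos: "s * f u > 0" if "0 \<le> u" "u < t" for u
  proof (rule sign_before_hit_zero[OF f s f0 that(1)])
    have "ennreal u < ennreal t" using that by (simp add: ennreal_lessI)
    then show "ennreal u < hit 0 f" using t by simp
  qed
  show ?thesis
  proof (cases "s = 1")
    case True
    have "f t \<ge> 0" if "t > 0"
    proof (rule ccontr)
      assume "\<not> f t \<ge> 0"
      moreover have "continuous_on {0..t} f"
        by (rule continuous_on_subset[OF path_space_continuous[OF f]]) auto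
      ultimately obtain u where u: "0 \<le> u" "u \<le> t" "f u = 0"
        using IVT2'[of f t 0 0] f0 t True by auto
      then have "u < t" using \<open>\<not> f t \<ge> 0\<close> by (cases "u = t") auto
      then show False using pos[of u] u by simp
    qed
    then have "{u \<in> {0..t}. 0 \<le> f u} = {0..t}"
      using pos True f0 t by (force simp: less_le)
    then have "occ t f = t" using t by (simp add: occupation_nonneg_def)
    then show ?thesis using True by (simp add: clock_def)
  next
    case False
    then have s: "s = -1" using s by simp
    have "{u \<in> {0..t}. 0 \<le> f u} \<subseteq> {t}"
    proof
      fix u assume "u \<in> {u \<in> {0..t}. 0 \<le> f u}"
      then show "u \<in> {t}" using pos[of u] s by (cases "u = t") auto
    qed
    then have "occ t f \<le> measure lborel {t}"
      unfolding occupation_nonneg_def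
      by (rule measure_mono_fmeasurable) (use occ_set_measurable[OF f] in \<open>auto simp: fmeasurable_def\<close>)
    then have "occ t f = 0" using occ_nonneg[of t f] by simp
    then show ?thesis using s by (simp add: clock_def)
  qed
qed

lemma lifetime_before_hit_zero:
  assumes cd: "c > 0" "d > 0"
    and f: "f \<in> space path_space" and s: "s = 1 \<or> s = -1" and f0: "s * f 0 > 0"
  defines "l \<equiv> (if s = 1 then c else d)" and "T \<equiv> hit 0 f"
  shows "lifetime c d f = (1 - discount l T) / l
     + discount l T * (lifetime c d (shift (enn2real T) f) * indicator {f. hit 0 f < \<infinity>} f)"
proof -
  have l: "l > 0" using cd by (simp add: l_def)
  have ck: "clock c d t f = l * t" if "0 \<le> t" "ennreal t \<le> T" for t
    unfolding l_def using clock_before_hit_zero[OF f s f0 that(1)] that(2) by (simp add: T_def)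
  show ?thesis
  proof (cases "T = \<infinity>")
    case True
    have "lifetime c d f = (\<integral>t. indicator {0..} t * (exp (- l * t) * t ^ 0) \<partial>lborel)"
      unfolding lifetime_def
      by (rule Bochner_Integration.integral_cong) (use ck True in \<open>auto simp: indicator_def\<close>)
    also have "\<dots> = 1 / l"
      using has_bochner_integral_power_exp[OF l, of 0] by (simp add: has_bochner_integral_iff)
    finally show ?thesis using True by (simp add: discount_def)
  next
    case False
    define r where "r = enn2real T"
    have r: "r \<ge> 0" "ennreal r = T" using False by (auto simp: r_def less_top)
    have "(\<integral>t. indicator {0..r} t * exp (- clock c d t f) \<partial>lborel) = (\<integral>t. indicator {0..r} t * exp (- l * t) \<partial>lborel)"
    proof (rule Bochner_Integration.integral_cong)
      fix t
      show "indicator {0..r} t * exp (- clock c d t f) = indicator {0..r} t * exp (- l * t)"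
      proof (cases "t \<in> {0..r}")
        case True
        then have "ennreal t \<le> T" unfolding r(2)[symmetric] by (intro ennreal_leI) auto
        then show ?thesis using ck[of t] True by simp
      qed simp
    qed simp
    also have "\<dots> = (1 - exp (- l * r)) / l" by (rule integral_Icc_exp[OF r(1) l])
    finally have "lifetime c d f = (1 - exp (- l * r)) / l + exp (- l * r) * lifetime c d (shift r f)"
      using lifetime_shift[OF cd f r(1)] ck[of r] r by simp
    moreover have "discount l T = exp (- l * r)" using False by (simp add: discount_def r_def)
    moreover have "indicator {f. hit 0 f < \<infinity>} f = (1 :: real)" using False by (simp add: T_def less_top)
    ultimately show ?thesis by (simp add: r_def)
  qed
qed

section \<open>Moments of the occupation time\<close>

lemma at_hit:
  assumes "f \<in> space path_space" "hit y f < \<infinity>"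
  shows "f (enn2real (hit y f)) = y"
  using path_space_continuous[OF assms(1)]
proof (cases rule: hitting_time_cases[where X = coord and \<omega> = f and y = y])
  case (at s)
  then show ?thesis by simp
qed (use assms in simp)

context skew_bessel_diffusion
begin

definition mean_lifetime :: "real \<Rightarrow> real \<Rightarrow> real \<Rightarrow> real" where
  "mean_lifetime c d y = (\<integral>f. lifetime c d f \<partial>law y)"

lemma measurable_mean_lifetime: "mean_lifetime c d \<in> borel_measurable borel"
  unfolding mean_lifetime_def[abs_def] by (rule measurable_integral_law[OF measurable_lifetime])

lemma measurable_indicator_finite:
  assumes "stopping_time history T"
  shows "(\<lambda>f. indicator {f. T f < \<infinity>} f :: real) \<in> borel_measurable path_space"
proof -
  note [measurable] = measurable_stopping[OF assms]
  have "(\<lambda>f. indicator {f \<in> space path_space. T f < \<infinity>} f :: real) \<in> borel_measurable path_space" by measurable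
  then show ?thesis by (rule measurable_cong[THEN iffD1, rotated]) (auto simp: indicator_def)
qed

context
  fixes c d :: real
  assumes cd: "c > 0" "d > 0"
begin

text \<open>
  The particle is either killed before it reaches the origin, or it starts afresh there.
\<close>

lemma mean_lifetime_off_origin:
  assumes s: "s = 1 \<or> s = -1" and x: "x > 0"
  defines "l \<equiv> (if s = 1 then c else d)"
  shows "mean_lifetime c d (s * x) = (1 - hit_transform l (s * x)) / l + hit_transform l (s * x) * mean_lifetime c d 0"
proof -
  interpret L: prob_space "law (s * x)" by (rule prob_law)
  let ?T = "hit 0" and ?s = "\<lambda>f. shift (enn2real (hit 0 f)) f"
  have l: "l > 0" using cd by (simp add: l_def)
  note [measurable] = measurable_hit measurable_indicator_finite[OF stopping_time_hit] measurable_lifetime measurable_mean_lifetime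
  have sh[measurable]: "?s \<in> path_space \<rightarrow>\<^sub>M path_space"
    by (rule measurable_shift) auto
  have at[measurable]: "(\<lambda>f. f (enn2real (?T f))) \<in> borel_measurable path_space"
    by (rule measurable_coord_at) auto
  have LR: "0 \<le> lifetime c d f \<and> lifetime c d f \<le> 1 / min c d" if "f \<in> space path_space" for f
    using lifetime_range[OF cd that] by simp
  have dr: "0 \<le> discount l t \<and> discount l t \<le> 1" for t using l by (intro discount_range) simp
  have "mean_lifetime c d (s * x) = (\<integral>f. (1 - discount l (?T f)) / l
      + discount l (?T f) * (lifetime c d (?s f) * indicator {f. ?T f < \<infinity>} f) \<partial>law (s * x))"
    unfolding mean_lifetime_def
  proof (rule integral_cong_AE)
    show "AE f in law (s * x). lifetime c d f = (1 - discount l (?T f)) / l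
      + discount l (?T f) * (lifetime c d (?s f) * indicator {f. ?T f < \<infinity>} f)"
      using start_law AE_space
    proof eventually_elim
      case (elim f)
      then have "s * f 0 > 0" using s x by auto
      then show ?case
        using lifetime_before_hit_zero[OF cd _ s, of f] elim unfolding l_def by simp
    qed
  qed measurable
  also have "\<dots> = (\<integral>f. (1 - discount l (?T f)) / l \<partial>law (s * x))
     + (\<integral>f. discount l (?T f) * (lifetime c d (?s f) * indicator {f. ?T f < \<infinity>} f) \<partial>law (s * x))"
  proof (rule Bochner_Integration.integral_add)
    show "integrable (law (s * x)) (\<lambda>f. (1 - discount l (?T f)) / l)"
      by (rule integrable_law_bounded[where B = "1 / l"]) (use dr l in \<open>auto simp: divide_right_mono\<close>)
    have "\<bar>discount l (?T f) * (lifetime c d (?s f) * indicator {f. ?T f < \<infinity>} f)\<bar> \<le> 1 / min c d"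
      if f: "f \<in> space path_space" for f
    proof -
      have "0 \<le> lifetime c d (?s f)" "lifetime c d (?s f) \<le> 1 / min c d"
        using LR[OF shift_in_path_space[OF f]] by auto
      then have "discount l (?T f) * lifetime c d (?s f) \<le> 1 * (1 / min c d)"
        using dr by (intro mult_mono) auto
      then show ?thesis using dr[of "?T f"] \<open>0 \<le> lifetime c d (?s f)\<close> cd by (auto simp: indicator_def abs_mult)
    qed
    then show "integrable (law (s * x)) (\<lambda>f. discount l (?T f) * (lifetime c d (?s f) * indicator {f. ?T f < \<infinity>} f))"
      by (intro integrable_law_bounded[where B = "1 / min c d"]) auto
  qed
  also have "(\<integral>f. (1 - discount l (?T f)) / l \<partial>law (s * x)) = (1 - hit_transform l (s * x)) / l"
  proof -
    have "integrable (law (s * x)) (\<lambda>f. discount l (?T f))"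
      by (rule integrable_law_bounded[where B = 1]) (use dr in auto)
    moreover have "measure (law (s * x)) (space path_space) = 1" using L.prob_space by simp
    ultimately show ?thesis by (simp add: hit_transform_def Bochner_Integration.integral_diff)
  qed
  also have "(\<integral>f. discount l (?T f) * (lifetime c d (?s f) * indicator {f. ?T f < \<infinity>} f) \<partial>law (s * x))
     = (\<integral>f. discount l (?T f) * (mean_lifetime c d (f (enn2real (?T f))) * indicator {f. ?T f < \<infinity>} f) \<partial>law (s * x))"
    unfolding mean_lifetime_def
  proof (rule strong_Markov_integral[OF stopping_time_hit _ measurable_lifetime _ LR])
    show "(\<lambda>f. discount l (?T f)) \<in> borel_measurable (past ?T)"
      by (rule measurable_compose[OF filtration.measurable_stopping_time_pre_sigma[OF filtration_natural stopping_time_hit] measurable_discount])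
  qed (use dr in auto)
  also have "\<dots> = (\<integral>f. discount l (?T f) * mean_lifetime c d 0 \<partial>law (s * x))"
  proof (rule Bochner_Integration.integral_cong)
    fix f assume f: "f \<in> space (law (s * x))"
    show "discount l (?T f) * (mean_lifetime c d (f (enn2real (?T f))) * indicator {f. ?T f < \<infinity>} f)
        = discount l (?T f) * mean_lifetime c d 0"
    proof (cases "?T f < \<infinity>")
      case True
      then show ?thesis using at_hit[of f 0] f by simp
    next
      case False
      then have "?T f = \<infinity>" using top.not_eq_extremum[of "?T f"] by auto
      then show ?thesis by (simp add: discount_def)
    qed
  qed simp
  also have "\<dots> = hit_transform l (s * x) * mean_lifetime c d 0"
    by (simp add: hit_transform_def)
  finally show ?thesis .
qed

text \<open>
  The renewal step: the mean lifetimes at \<open>0\<close> and after the exit from \<open>(-e, e)\<close> differ by a multiple of the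
  mean exit time, and \<open>\<beta>\<close> is the probability of leaving at \<open>e\<close>.
\<close>

lemma mean_lifetime_origin:
  assumes e: "e > 0"
  shows "\<bar>mean_lifetime c d 0 - (\<beta> * mean_lifetime c d e + (1 - \<beta>) * mean_lifetime c d (- e))\<bar>
    \<le> (1 + max c d / min c d) * (e\<^sup>2 / (- \<nu> * (1 + \<nu>)))"
proof -
  interpret L: prob_space "law 0" by (rule prob_law)
  let ?T = "exit_time (-e) e" and ?s = "\<lambda>f. shift (enn2real (exit_time (-e) e f)) f"
  note [measurable] = measurable_hit measurable_indicator_finite[OF stopping_time_exit] measurable_lifetime measurable_mean_lifetime
  have sh[measurable]: "?s \<in> path_space \<rightarrow>\<^sub>M path_space"
    by (rule measurable_shift) auto
  have at[measurable]: "(\<lambda>f. f (enn2real (?T f))) \<in> borel_measurable path_space"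
    by (rule measurable_coord_at) auto
  have LR: "0 \<le> lifetime c d f \<and> lifetime c d f \<le> 1 / min c d" if "f \<in> space path_space" for f
    using lifetime_range[OF cd that] by simp
  define K where "K = e\<^sup>2 / (- \<nu> * (1 + \<nu>))"
  have K: "K \<ge> 0" unfolding K_def
    by (rule divide_nonneg_pos[OF zero_le_power2 mult_pos_pos]) (use \<nu> in auto)
  have m: "(\<integral>\<^sup>+f. ?T f \<partial>law 0) \<le> ennreal K"
    using law_exit_time[of "-e" 0 e] skew_bessel_exit_time_origin[OF \<nu> \<beta> e] e by (simp add: K_def)
  have fin: "AE f in law 0. ?T f < \<infinity>" by (rule AE_exit_finite[OF m])
  have "(\<integral>\<^sup>+f. ennreal (enn2real (?T f)) \<partial>law 0) = (\<integral>\<^sup>+f. ?T f \<partial>law 0)"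
    by (rule nn_integral_cong_AE) (use fin in eventually_elim, auto)
  then have m': "(\<integral>\<^sup>+f. ennreal (enn2real (?T f)) \<partial>law 0) \<le> ennreal K" using m by simp
  have iT: "integrable (law 0) (\<lambda>f. enn2real (?T f))"
    by (rule integrableI_bounded) (use m' in \<open>auto simp: less_top[symmetric] top_unique\<close>)
  have ET: "(\<integral>f. enn2real (?T f) \<partial>law 0) \<le> K"
    using m' nn_integral_eq_integral[OF iT] K by simp
  have iL: "integrable (law 0) (lifetime c d)"
    by (rule integrable_law_bounded[where B = "1 / min c d"]) (use LR in auto)
  have iLs: "integrable (law 0) (\<lambda>f. lifetime c d (?s f))"
    by (rule integrable_law_bounded[where B = "1 / min c d"]) (use LR[OF shift_in_path_space] in auto)
  have "(\<integral>f. lifetime c d (?s f) \<partial>law 0) = (\<integral>f. 1 * (lifetime c d (?s f) * indicator {f. ?T f < \<infinity>} f) \<partial>law 0)"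
    by (rule integral_cong_AE, measurable) (use fin in eventually_elim, auto)
  also have "\<dots> = (\<integral>f. 1 * (mean_lifetime c d (f (enn2real (?T f))) * indicator {f. ?T f < \<infinity>} f) \<partial>law 0)"
    unfolding mean_lifetime_def
    by (rule strong_Markov_integral[OF stopping_time_exit _ measurable_lifetime _ LR]) auto
  also have "\<dots> = (\<integral>f. mean_lifetime c d (f (enn2real (?T f))) \<partial>law 0)"
    by (rule integral_cong_AE, measurable) (use fin in eventually_elim, auto)
  also have "\<dots> = (S 0 - S (-e)) / (S e - S (-e)) * mean_lifetime c d e
      + (1 - (S 0 - S (-e)) / (S e - S (-e))) * mean_lifetime c d (-e)"
    by (rule integral_exit_value[OF _ _ fin measurable_mean_lifetime]) (use e in auto)
  also have "(S 0 - S (-e)) / (S e - S (-e)) = \<beta>"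
  proof -
    define E where "E = e powr (2 * \<alpha>)"
    have "E > 0" using e by (simp add: E_def)
    have S: "S 0 = 0" "S e = E / (4 * \<beta> * \<alpha>)" "S (- e) = - (E / (4 * (1 - \<beta>) * \<alpha>))"
      using skew_bessel_scale_pos[OF \<nu> \<beta>, of 0] skew_bessel_scale_pos[OF \<nu> \<beta>, of e]
        skew_bessel_scale_neg[OF \<nu> \<beta>, of e] e by (auto simp: E_def \<alpha>_def)
    have "S e - S (- e) = E / (4 * \<beta> * (1 - \<beta>) * \<alpha>)"
      unfolding S using \<beta> \<alpha> by (simp add: divide_simps) (simp add: algebra_simps)
    moreover have "S 0 - S (- e) = E / (4 * (1 - \<beta>) * \<alpha>)" by (simp add: S)
    ultimately have "(S 0 - S (-e)) / (S e - S (-e)) = (E / (4 * (1 - \<beta>) * \<alpha>)) / (E / (4 * \<beta> * (1 - \<beta>) * \<alpha>))"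
      by (simp only:)
    also have "\<dots> = \<beta>" using \<beta> \<alpha> \<open>E > 0\<close> by (simp add: divide_simps)
    finally show ?thesis .
  qed
  finally have V: "(\<integral>f. lifetime c d (?s f) \<partial>law 0) = \<beta> * mean_lifetime c d e + (1 - \<beta>) * mean_lifetime c d (- e)" .
  have "\<bar>mean_lifetime c d 0 - (\<integral>f. lifetime c d (?s f) \<partial>law 0)\<bar> = \<bar>\<integral>f. lifetime c d f - lifetime c d (?s f) \<partial>law 0\<bar>"
    unfolding mean_lifetime_def using iL iLs by simp
  also have "\<dots> \<le> (\<integral>f. \<bar>lifetime c d f - lifetime c d (?s f)\<bar> \<partial>law 0)"
    using integral_norm_bound[of "law 0" "\<lambda>f. lifetime c d f - lifetime c d (?s f)"] by simp
  also have "\<dots> \<le> (\<integral>f. (1 + max c d / min c d) * enn2real (?T f) \<partial>law 0)"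
  proof (rule integral_mono)
    show "integrable (law 0) (\<lambda>f. \<bar>lifetime c d f - lifetime c d (?s f)\<bar>)"
      using iL iLs by (intro integrable_abs Bochner_Integration.integrable_diff)
    show "integrable (law 0) (\<lambda>f. (1 + max c d / min c d) * enn2real (?T f))"
      using iT by (rule integrable_mult_right)
    fix f assume "f \<in> space (law 0)"
    then show "\<bar>lifetime c d f - lifetime c d (?s f)\<bar> \<le> (1 + max c d / min c d) * enn2real (?T f)"
      by (intro lifetime_shift_diff[OF cd]) auto
  qed
  also have "\<dots> = (1 + max c d / min c d) * (\<integral>f. enn2real (?T f) \<partial>law 0)" by simp
  also have "\<dots> \<le> (1 + max c d / min c d) * K"
    using ET cd by (intro mult_left_mono) auto
  finally show ?thesis unfolding V K_def .
qed

text \<open>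
  Insert the values of \<open>V (\<plusminus>e)\<close> into the renewal step. What remains is a combination of \<open>1 - v\<close> on the two sides
  that is \<open>O(e\<^sup>2)\<close>; divided by \<open>e\<^sup>2\<^sup>\<alpha>\<close>, it tends both to \<open>0\<close> and to a linear expression in \<open>V 0\<close>.
\<close>

lemma mean_lifetime_at_zero:
  "mean_lifetime c d 0 = (\<beta> * c powr (\<alpha> - 1) + (1 - \<beta>) * d powr (\<alpha> - 1)) / (\<beta> * c powr \<alpha> + (1 - \<beta>) * d powr \<alpha>)"
proof -
  define V where "V = mean_lifetime c d 0"
  obtain k where k: "k > 0" and rate: "\<And>l g. l > 0 \<Longrightarrow> killed_harmonic \<alpha> l g \<Longrightarrow>
      ((\<lambda>x. (1 - g x) / x powr (2 * \<alpha>)) \<longlongrightarrow> k * l powr \<alpha>) (at_right 0)"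
    using killed_harmonic_rate[OF \<alpha> hit_transform_killed_harmonic[of 1 1]] by auto
  have r1: "((\<lambda>x. (1 - hit_transform c x) / x powr (2 * \<alpha>)) \<longlongrightarrow> k * c powr \<alpha>) (at_right 0)"
    using rate[OF cd(1) hit_transform_killed_harmonic[of 1 c]] cd by simp
  have r2: "((\<lambda>x. (1 - hit_transform d (- x)) / x powr (2 * \<alpha>)) \<longlongrightarrow> k * d powr \<alpha>) (at_right 0)"
    using rate[OF cd(2) hit_transform_killed_harmonic[of "-1" d]] cd by simp
  \<comment> \<open>The difference between the two sides of the renewal step, divided by \<open>x\<^sup>2\<^sup>\<alpha>\<close>.\<close>
  define R where "R x = \<beta> * ((1 - hit_transform c x) / x powr (2 * \<alpha>)) * (V - 1 / c)
      + (1 - \<beta>) * ((1 - hit_transform d (- x)) / x powr (2 * \<alpha>)) * (V - 1 / d)" for x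
  have lim1: "(R \<longlongrightarrow> \<beta> * (k * c powr \<alpha>) * (V - 1 / c) + (1 - \<beta>) * (k * d powr \<alpha>) * (V - 1 / d)) (at_right 0)"
    unfolding R_def by (intro tendsto_intros r1 r2)
  define C where "C = (1 + max c d / min c d) / (- \<nu> * (1 + \<nu>))"
  have bound: "\<bar>R x\<bar> \<le> C * x powr (2 - 2 * \<alpha>)" if x: "x > 0" for x
  proof -
    have "R x * x powr (2 * \<alpha>) = V - (\<beta> * mean_lifetime c d x + (1 - \<beta>) * mean_lifetime c d (- x))"
    proof -
      have 1: "mean_lifetime c d x = (1 - hit_transform c x) / c + hit_transform c x * V"
        using mean_lifetime_off_origin[of 1 x] x by (simp add: V_def)
      have 2: "mean_lifetime c d (- x) = (1 - hit_transform d (- x)) / d + hit_transform d (- x) * V"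
        using mean_lifetime_off_origin[of "-1" x] x by (simp add: V_def)
      have "R x * x powr (2 * \<alpha>) = \<beta> * (1 - hit_transform c x) * (V - 1 / c) + (1 - \<beta>) * (1 - hit_transform d (- x)) * (V - 1 / d)"
        unfolding R_def using x by (simp add: distrib_right)
      also have "\<dots> = V - (\<beta> * mean_lifetime c d x + (1 - \<beta>) * mean_lifetime c d (- x))"
        unfolding 1 2 by (simp add: algebra_simps diff_divide_distrib)
      finally show ?thesis .
    qed
    moreover have "\<bar>R x\<bar> * x powr (2 * \<alpha>) = \<bar>R x * x powr (2 * \<alpha>)\<bar>" by (simp add: abs_mult)
    ultimately have "\<bar>R x\<bar> * x powr (2 * \<alpha>) = \<bar>V - (\<beta> * mean_lifetime c d x + (1 - \<beta>) * mean_lifetime c d (- x))\<bar>"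
      by simp
    also have "\<dots> \<le> C * x\<^sup>2"
      using mean_lifetime_origin[OF x] unfolding V_def C_def by simp
    also have "x\<^sup>2 = x powr (2 - 2 * \<alpha>) * x powr (2 * \<alpha>)"
      using x by (simp flip: powr_add)
    finally have "\<bar>R x\<bar> * x powr (2 * \<alpha>) \<le> (C * x powr (2 - 2 * \<alpha>)) * x powr (2 * \<alpha>)" by (simp add: mult.assoc)
    then show ?thesis using x by simp
  qed
  have "(R \<longlongrightarrow> 0) (at_right 0)"
  proof (rule Lim_null_comparison)
    show "eventually (\<lambda>x. norm (R x) \<le> C * x powr (2 - 2 * \<alpha>)) (at_right 0)"
      using bound by (intro eventually_at_rightI[of 0 1]) auto
    have "((\<lambda>x. C * x powr (2 - 2 * \<alpha>)) \<longlongrightarrow> C * 0 powr (2 - 2 * \<alpha>)) (at_right 0)"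
      by (intro tendsto_intros tendsto_powr') (use \<alpha> in \<open>auto intro: eventually_at_rightI[of 0 1]\<close>)
    then show "((\<lambda>x. C * x powr (2 - 2 * \<alpha>)) \<longlongrightarrow> 0) (at_right 0)" by simp
  qed
  with lim1 have "\<beta> * (k * c powr \<alpha>) * (V - 1 / c) + (1 - \<beta>) * (k * d powr \<alpha>) * (V - 1 / d) = 0"
    by (intro tendsto_unique[of "at_right (0::real)"]) auto
  moreover have "\<beta> * (k * c powr \<alpha>) * (V - 1 / c) + (1 - \<beta>) * (k * d powr \<alpha>) * (V - 1 / d)
      = k * (V * (\<beta> * c powr \<alpha> + (1 - \<beta>) * d powr \<alpha>) - (\<beta> * (c powr \<alpha> / c) + (1 - \<beta>) * (d powr \<alpha> / d)))"
    by (simp add: divide_inverse algebra_simps)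
  ultimately have "k * (V * (\<beta> * c powr \<alpha> + (1 - \<beta>) * d powr \<alpha>) - (\<beta> * (c powr \<alpha> / c) + (1 - \<beta>) * (d powr \<alpha> / d))) = 0"
    by simp
  then have "V * (\<beta> * c powr \<alpha> + (1 - \<beta>) * d powr \<alpha>) = \<beta> * c powr (\<alpha> - 1) + (1 - \<beta>) * d powr (\<alpha> - 1)"
    using k cd by (simp add: powr_diff)
  moreover have "\<beta> * c powr \<alpha> + (1 - \<beta>) * d powr \<alpha> > 0"
    using \<beta> cd by (intro add_pos_pos mult_pos_pos) auto
  ultimately show ?thesis unfolding V_def by (simp add: field_simps)
qed

end

definition occ_moment :: "nat \<Rightarrow> real \<Rightarrow> real" where
  "occ_moment n t = (\<integral>f. occ t f ^ n \<partial>law 0)"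

lemma measurable_occ_fixed [measurable]: "occ t \<in> borel_measurable path_space"
  using measurable_occ'[of "\<lambda>_. t" path_space "\<lambda>f. f"] by simp

lemma occ_power_le: "t \<ge> 0 \<Longrightarrow> f \<in> space path_space \<Longrightarrow> 0 \<le> occ t f ^ n \<and> occ t f ^ n \<le> t ^ n"
  using occ_nonneg[of t f] occ_le[of t f] by (auto intro!: power_mono)

lemma occ_moment_range: "t \<ge> 0 \<Longrightarrow> 0 \<le> occ_moment n t" "t \<ge> 0 \<Longrightarrow> occ_moment n t \<le> t ^ n"
  unfolding occ_moment_def using integral_law_range[of "\<lambda>f. occ t f ^ n" "t ^ n" 0] occ_power_le by auto

text \<open>
  The occupation time is Lipschitz in \<open>t\<close>, path by path, and locally bounded.
\<close>

lemma occ_moment_continuous: "continuous_on {0..} (occ_moment n)"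
  unfolding continuous_on_sequentially comp_def
proof (intro allI ballI impI, elim conjE)
  fix t and u :: "nat \<Rightarrow> real" assume t: "t \<in> {0..}" and u: "\<forall>k. u k \<in> {0..}" and lim: "u \<longlonglongrightarrow> t"
  interpret L: prob_space "law 0" by (rule prob_law)
  obtain B where B: "\<And>k. \<bar>u k\<bar> \<le> B"
    using convergent_imp_Bseq[OF convergentI[OF lim]] by (auto simp: Bseq_def)
  have "B \<ge> 0" using B[of 0] by linarith
  have lip: "\<bar>occ r f - occ q f\<bar> \<le> \<bar>r - q\<bar>" if "f \<in> space path_space" "r \<ge> 0" "q \<ge> 0" for f r q
  proof -
    have *: "0 \<le> occ r f - occ q f \<and> occ r f - occ q f \<le> r - q" if "r \<ge> q" "q \<ge> 0" for r q
    proof -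
      have "occ (q + (r - q)) f = occ q f + occ (r - q) (shift q f)"
        using that \<open>f \<in> _\<close> by (intro occ_add) auto
      moreover have "0 \<le> occ (r - q) (shift q f)" "occ (r - q) (shift q f) \<le> r - q"
        using occ_nonneg occ_le[of "r - q"] shift_in_path_space[OF \<open>f \<in> _\<close>] that by auto
      ultimately show ?thesis by simp
    qed
    show ?thesis using *[of q r] *[of r q] that by (cases "r \<ge> q") auto
  qed
  show "(\<lambda>k. occ_moment n (u k)) \<longlonglongrightarrow> occ_moment n t"
    unfolding occ_moment_def
  proof (rule integral_dominated_convergence[where w = "\<lambda>_. B ^ n"])
    show "AE f in law 0. (\<lambda>k. occ (u k) f ^ n) \<longlonglongrightarrow> occ t f ^ n"
      using AE_space
    proof eventually_elim
      case (elim f)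
      have "(\<lambda>k. occ (u k) f - occ t f) \<longlonglongrightarrow> 0"
      proof (rule Lim_null_comparison)
        show "eventually (\<lambda>k. norm (occ (u k) f - occ t f) \<le> \<bar>u k - t\<bar>) sequentially"
          using lip[of f] elim t u by auto
        show "(\<lambda>k. \<bar>u k - t\<bar>) \<longlonglongrightarrow> 0" using lim by (intro tendsto_rabs_zero) (simp add: LIM_zero)
      qed
      then show ?case by (intro tendsto_power) (simp add: LIM_zero_iff)
    qed
    fix k
    show "AE f in law 0. norm (occ (u k) f ^ n) \<le> B ^ n"
      using AE_space
    proof eventually_elim
      case (elim f)
      have "occ (u k) f ^ n \<le> (u k) ^ n" "0 \<le> occ (u k) f ^ n" using occ_power_le[of "u k" f n] u elim by auto
      moreover have "(u k) ^ n \<le> B ^ n" using B[of k] u by (intro power_mono) auto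
      ultimately show ?case by simp
    qed
  qed auto
qed

lemma measurable_occ_pair [measurable]:
  "(\<lambda>p. occ (snd p) (fst p)) \<in> borel_measurable (law y \<Otimes>\<^sub>M lborel)"
  by (rule measurable_occ') auto

lemma integrable_discounted_power:
  assumes l: "l > 0"
  shows "integrable (law 0 \<Otimes>\<^sub>M lborel) (\<lambda>p. indicator {0..} (snd p) * (exp (- l * snd p) * snd p ^ n) :: real)"
    and "(\<integral>p. indicator {0..} (snd p) * (exp (- l * snd p) * snd p ^ n) \<partial>(law 0 \<Otimes>\<^sub>M lborel)) = fact n / l ^ Suc n"
proof -
  interpret L: prob_space "law 0" by (rule prob_law)
  interpret LL: pair_sigma_finite "law 0" lborel ..
  note I = has_bochner_integral_power_exp[OF l, of n, unfolded has_bochner_integral_iff]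
  have n: "norm (indicator {0..} t * (exp (- l * t) * t ^ n)) = indicator {0..} t * (exp (- l * t) * t ^ n)" for t :: real
    by (auto simp: indicator_def abs_mult)
  show int: "integrable (law 0 \<Otimes>\<^sub>M lborel) (\<lambda>p. indicator {0..} (snd p) * (exp (- l * snd p) * snd p ^ n) :: real)"
    by (rule LL.Fubini_integrable) (use I in \<open>simp_all add: n\<close>)
  have "measure (law 0) (space path_space) = 1" using L.prob_space by simp
  then show "(\<integral>p. indicator {0..} (snd p) * (exp (- l * snd p) * snd p ^ n) \<partial>(law 0 \<Otimes>\<^sub>M lborel)) = fact n / l ^ Suc n"
    using LL.integral_fst'[OF int] I by simp
qed

lemma integrable_discounted_occ:
  assumes l: "l > 0"
  shows "integrable (law 0 \<Otimes>\<^sub>M lborel) (\<lambda>p. indicator {0..} (snd p) * (exp (- l * snd p) * occ (snd p) (fst p) ^ n))"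
proof (rule Bochner_Integration.integrable_bound[OF integrable_discounted_power(1)[OF l, of n]])
  show "AE p in law 0 \<Otimes>\<^sub>M lborel. norm (indicator {0..} (snd p) * (exp (- l * snd p) * occ (snd p) (fst p) ^ n))
     \<le> norm (indicator {0..} (snd p) * (exp (- l * snd p) * snd p ^ n) :: real)"
  proof (rule AE_I2)
    fix p :: "(real \<Rightarrow> real) \<times> real"
    assume "p \<in> space (law 0 \<Otimes>\<^sub>M lborel)"
    then have "fst p \<in> space path_space" by (auto simp: space_pair_measure)
    then show "norm (indicator {0..} (snd p) * (exp (- l * snd p) * occ (snd p) (fst p) ^ n))
     \<le> norm (indicator {0..} (snd p) * (exp (- l * snd p) * snd p ^ n) :: real)"
      using occ_power_le[of "snd p" "fst p" n] by (auto simp: indicator_def abs_mult)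
  qed
qed measurable

lemma laplace_occ_moment:
  assumes l: "l > 0"
  shows "(\<integral>t. indicator {0..} t * (exp (- l * t) * occ_moment n t) \<partial>lborel)
    = (\<integral>p. indicator {0..} (snd p) * (exp (- l * snd p) * occ (snd p) (fst p) ^ n) \<partial>(law 0 \<Otimes>\<^sub>M lborel))"
proof -
  interpret L: prob_space "law 0" by (rule prob_law)
  interpret LL: pair_sigma_finite "law 0" lborel ..
  have "(\<integral>t. (\<integral>f. indicator {0..} t * (exp (- l * t) * occ t f ^ n) \<partial>law 0) \<partial>lborel)
    = (\<integral>p. indicator {0..} (snd p) * (exp (- l * snd p) * occ (snd p) (fst p) ^ n) \<partial>(law 0 \<Otimes>\<^sub>M lborel))"
    using LL.integral_snd[of "\<lambda>f t. indicator {0..} t * (exp (- l * t) * occ t f ^ n)"]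
      integrable_discounted_occ[OF l, of n] by (simp add: split_beta')
  then show ?thesis by (simp add: occ_moment_def)
qed

text \<open>
  Expand the factor \<open>e\<^sup>-\<^sup>l\<^sup>z\<^sup>A\<close> of the killing probability, \<open>A\<close> being the occupation time. The bound \<open>A \<le> t\<close>
  dominates the \<open>n\<close>-th term by \<open>(l \<bar>z\<bar> t)\<^sup>n / n!\<close>, whose integral against \<open>e\<^sup>-\<^sup>l\<^sup>t\<close> is \<open>\<bar>z\<bar>\<^sup>n / l\<close>; this is why
  \<open>\<bar>z\<bar> < 1\<close> is the right range.
\<close>

lemma mean_lifetime_power_series:
  assumes l: "l > 0" and z: "\<bar>z\<bar> < 1"
  shows "(\<lambda>n. (- l * z) ^ n / fact n * (\<integral>t. indicator {0..} t * (exp (- l * t) * occ_moment n t) \<partial>lborel))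
    sums mean_lifetime (l * (1 + z)) l 0"
proof -
  interpret L: prob_space "law 0" by (rule prob_law)
  interpret LL: pair_sigma_finite "law 0" lborel ..
  let ?P = "law 0 \<Otimes>\<^sub>M (lborel :: real measure)"
  define F where "F n p = (- l * z) ^ n / fact n * (indicator {0..} (snd p) * (exp (- l * snd p) * occ (snd p) (fst p) ^ n))" for n p
  have iF: "integrable ?P (F n)" for n
    unfolding F_def[abs_def] by (rule integrable_mult_right[OF integrable_discounted_occ[OF l]])
  have F_sums: "(\<lambda>n. F n p) sums (indicator {0..} (snd p) * exp (- clock (l * (1 + z)) l (snd p) (fst p)))" for p
  proof -
    define o' where "o' = occ (snd p) (fst p)"
    have "(\<lambda>n. (indicator {0..} (snd p) * exp (- l * snd p)) * ((- l * z * o') ^ n /\<^sub>R fact n))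
        sums ((indicator {0..} (snd p) * exp (- l * snd p)) * exp (- l * z * o'))"
      by (intro sums_mult exp_converges)
    moreover have "(\<lambda>n. (indicator {0..} (snd p) * exp (- l * snd p)) * ((- l * z * o') ^ n /\<^sub>R fact n)) = (\<lambda>n. F n p)"
      unfolding F_def o'_def[symmetric] power_mult_distrib[of "- l * z" o']
      by (simp add: fun_eq_iff scaleR_conv_of_real divide_inverse mult_ac)
    moreover have "(indicator {0..} (snd p) * exp (- l * snd p)) * exp (- l * z * o')
        = indicator {0..} (snd p) * exp (- clock (l * (1 + z)) l (snd p) (fst p))"
    proof -
      have ck: "- clock (l * (1 + z)) l (snd p) (fst p) = - l * snd p + - l * z * o'"
        unfolding clock_def o'_def by (simp add: algebra_simps)
      show ?thesis unfolding ck exp_add by (simp only: mult.assoc)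
    qed
    ultimately show ?thesis by (simp only:)
  qed
  have normF: "norm (F n p) \<le> (l * \<bar>z\<bar>) ^ n / fact n * (indicator {0..} (snd p) * (exp (- l * snd p) * snd p ^ n))"
    if "p \<in> space ?P" for n p
  proof -
    have "fst p \<in> space path_space" using that by (auto simp: space_pair_measure)
    then show ?thesis
      using occ_power_le[of "snd p" "fst p" n] l unfolding F_def
      by (auto simp: indicator_def abs_mult power_abs abs_of_nonneg[OF occ_nonneg] intro!: mult_left_mono divide_right_mono)
  qed
  have int_normF: "(\<integral>p. norm (F n p) \<partial>?P) \<le> \<bar>z\<bar> ^ n / l" for n
  proof -
    have "(\<integral>p. norm (F n p) \<partial>?P) \<le> (\<integral>p. (l * \<bar>z\<bar>) ^ n / fact n * (indicator {0..} (snd p) * (exp (- l * snd p) * snd p ^ n)) \<partial>?P)"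
      by (intro integral_mono integrable_norm iF integrable_mult_right integrable_discounted_power(1)[OF l] normF)
    also have "\<dots> = \<bar>z\<bar> ^ n / l"
      using integrable_discounted_power(2)[OF l, of n] l by (simp add: power_mult_distrib field_simps)
    finally show ?thesis .
  qed
  have "(\<lambda>n. integral\<^sup>L ?P (F n)) sums (\<integral>p. (\<Sum>n. F n p) \<partial>?P)"
  proof (rule sums_integral[OF iF])
    show "AE p in ?P. summable (\<lambda>n. norm (F n p))"
    proof (rule AE_I2)
      fix p assume p: "p \<in> space ?P"
      have "summable (\<lambda>n. (indicator {0..} (snd p) * exp (- l * snd p)) * ((l * \<bar>z\<bar> * snd p) ^ n /\<^sub>R fact n))"
        by (intro summable_mult summable_exp_generic)
      moreover have "(indicator {0..} (snd p) * exp (- l * snd p)) * ((l * \<bar>z\<bar> * snd p) ^ n /\<^sub>R fact n)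
         = (l * \<bar>z\<bar>) ^ n / fact n * (indicator {0..} (snd p) * (exp (- l * snd p) * snd p ^ n))" for n
        by (simp add: power_mult_distrib field_simps scaleR_conv_of_real)
      ultimately have sm: "summable (\<lambda>n. (l * \<bar>z\<bar>) ^ n / fact n * (indicator {0..} (snd p) * (exp (- l * snd p) * snd p ^ n)))"
        by (simp only:)
      show "summable (\<lambda>n. norm (F n p))"
        by (rule summable_comparison_test'[OF sm, of 0]) (use normF[OF p] in simp)
    qed
    have sm: "summable (\<lambda>n. \<bar>z\<bar> ^ n * (1 / l))"
      using z by (intro summable_mult2 summable_geometric) auto
    show "summable (\<lambda>n. \<integral>p. norm (F n p) \<partial>?P)"
      by (rule summable_comparison_test'[OF sm, of 0]) (use int_normF in simp)
  qed
  moreover have "integral\<^sup>L ?P (F n) = (- l * z) ^ n / fact n * (\<integral>t. indicator {0..} t * (exp (- l * t) * occ_moment n t) \<partial>lborel)" for n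
    unfolding laplace_occ_moment[OF l] F_def by simp
  moreover have "(\<integral>p. (\<Sum>n. F n p) \<partial>?P) = mean_lifetime (l * (1 + z)) l 0"
  proof -
    have cp: "l * (1 + z) > 0" "l > 0" using l z by auto
    have sF: "(\<Sum>n. F n p) = indicator {0..} (snd p) * exp (- clock (l * (1 + z)) l (snd p) (fst p))" for p
      using F_sums by (rule sums_unique[symmetric])
    have "integrable ?P (\<lambda>p. indicator {0..} (snd p) * exp (- clock (l * (1 + z)) l (snd p) (fst p)))"
    proof (rule Bochner_Integration.integrable_bound)
      show "integrable ?P (\<lambda>p. indicator {0..} (snd p) * (exp (- min (l * (1 + z)) l * snd p) * snd p ^ 0) :: real)"
        by (rule integrable_discounted_power) (use cp in auto)
      have [measurable]: "(\<lambda>p. clock (l * (1 + z)) l (snd p) (fst p)) \<in> borel_measurable ?P"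
        by (rule measurable_clock) auto
      show "(\<lambda>p. indicator {0..} (snd p) * exp (- clock (l * (1 + z)) l (snd p) (fst p))) \<in> borel_measurable ?P"
        by measurable
      show "AE p in ?P. norm (indicator {0..} (snd p) * exp (- clock (l * (1 + z)) l (snd p) (fst p)))
          \<le> norm (indicator {0..} (snd p) * (exp (- min (l * (1 + z)) l * snd p) * snd p ^ 0) :: real)"
      proof (rule AE_I2)
        fix p :: "(real \<Rightarrow> real) \<times> real" assume "p \<in> space ?P"
        then have "fst p \<in> space path_space" by (auto simp: space_pair_measure)
        then show "norm (indicator {0..} (snd p) * exp (- clock (l * (1 + z)) l (snd p) (fst p)))
          \<le> norm (indicator {0..} (snd p) * (exp (- min (l * (1 + z)) l * snd p) * snd p ^ 0) :: real)"
          using clock_bounds(1)[of "fst p" "snd p" "l * (1 + z)" l] by (auto simp: indicator_def)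
      qed
    qed
    from LL.integral_fst'[OF this] show ?thesis
      unfolding sF mean_lifetime_def lifetime_def by simp
  qed
  ultimately show ?thesis by simp
qed

text \<open>
  By homogeneity \<open>l V 0\<close> depends on \<open>z\<close> only, and comparison of coefficients gives every moment.
\<close>

lemma laplace_occ_moment_value:
  assumes l: "l > 0" and n: "n \<ge> 1"
  defines "m \<equiv> (\<Sum>k=0..n-1. \<Sum>j=0..k.
       (-1) ^ j * fact j / fact (n - 1) * real (stirling n (k + 1)) * real (Stirling (k + 1) (j + 1))
         * \<nu> ^ k * \<beta> ^ (j + 1))"
  shows "(\<integral>t. indicator {0..} t * (exp (- l * t) * occ_moment n t) \<partial>lborel) = m * (fact n / l ^ Suc n)"
proof -
  define L where "L n = (\<integral>t. indicator {0..} t * (exp (- l * t) * occ_moment n t) \<partial>lborel)" for n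
  \<comment> \<open>The normalisation under which \<open>a n\<close> is the constant \<open>m\<close> when the moment of order \<open>n\<close> is \<open>m t\<^sup>n\<close>.\<close>
  define a where "a n = l ^ Suc n / fact n * L n" for n
  have "a n = (\<Sum>k=0..n-1. \<Sum>j=0..k.
       (-1) ^ j * fact j / fact (n - 1) * real (stirling n (k + 1)) * real (Stirling (k + 1) (j + 1))
         * (- \<alpha>) ^ k * \<beta> ^ (j + 1))"
  proof (rule occupation_generating_function_coeffs[OF \<beta> \<alpha>(1) _ n])
    fix z :: real assume z: "\<bar>z\<bar> < 1"
    have "(\<lambda>n. l * ((- l * z) ^ n / fact n * L n)) sums (l * mean_lifetime (l * (1 + z)) l 0)"
      unfolding L_def by (intro sums_mult mean_lifetime_power_series l z)
    also have "(\<lambda>n. l * ((- l * z) ^ n / fact n * L n)) = (\<lambda>n. (-1) ^ n * a n * z ^ n)"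
      unfolding a_def by (auto simp: fun_eq_iff power_mult_distrib power_minus[of "l * z"] field_simps)
    also have "l * mean_lifetime (l * (1 + z)) l 0
       = (\<beta> * (1 + z) powr (\<alpha> - 1) + (1 - \<beta>)) / (\<beta> * (1 + z) powr \<alpha> + (1 - \<beta>))"
    proof -
      have z1: "1 + z > 0" using z by auto
      have D: "\<beta> * (1 + z) powr \<alpha> + (1 - \<beta>) > 0"
        using \<beta> z1 by (intro add_pos_pos mult_pos_pos) auto
      have "mean_lifetime (l * (1 + z)) l 0
        = (\<beta> * (l * (1 + z)) powr (\<alpha> - 1) + (1 - \<beta>) * l powr (\<alpha> - 1)) / (\<beta> * (l * (1 + z)) powr \<alpha> + (1 - \<beta>) * l powr \<alpha>)"
        by (rule mean_lifetime_at_zero) (use l z1 in auto)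
      also have "\<dots> = (l powr (\<alpha> - 1) * (\<beta> * (1 + z) powr (\<alpha> - 1) + (1 - \<beta>))) / (l powr \<alpha> * (\<beta> * (1 + z) powr \<alpha> + (1 - \<beta>)))"
      proof -
        have e: "(l * (1 + z)) powr p = l powr p * (1 + z) powr p" for p
          by (rule powr_mult)
        show ?thesis unfolding e by (simp add: algebra_simps)
      qed
      also have "l powr (\<alpha> - 1) = l powr \<alpha> / l" using l by (simp add: powr_diff)
      finally show ?thesis using l by simp
    qed
    finally show "(\<lambda>n. (-1) ^ n * a n * z ^ n) sums
      ((\<beta> * (1 + z) powr (\<alpha> - 1) + (1 - \<beta>)) / (\<beta> * (1 + z) powr \<alpha> + (1 - \<beta>)))" .
  qed
  also have "\<dots> = m" unfolding m_def \<alpha>_def by simp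
  finally have "L n = m * (fact n / l ^ Suc n)" unfolding a_def using l by (simp add: field_simps)
  then show ?thesis by (simp add: L_def)
qed

lemma occ_moment_value:
  assumes n: "n \<ge> 1" and t: "t > 0"
  shows "occ_moment n t = (\<Sum>k=0..n-1. \<Sum>j=0..k.
       (-1) ^ j * fact j / fact (n - 1) * real (stirling n (k + 1)) * real (Stirling (k + 1) (j + 1))
         * \<nu> ^ k * \<beta> ^ (j + 1)) * t ^ n" (is "_ = ?m * _")
proof -
  have "occ_moment n t - ?m * t ^ n = 0"
  proof (rule laplace_transform_zero_imp_zero[where C = "1 + \<bar>?m\<bar>" and n = n, OF _ _ _ t])
    show "continuous_on {0..} (\<lambda>t. occ_moment n t - ?m * t ^ n)"
      by (intro continuous_intros occ_moment_continuous)
    show "\<bar>occ_moment n t - ?m * t ^ n\<bar> \<le> (1 + \<bar>?m\<bar>) * t ^ n" if "t \<ge> 0" for t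
    proof -
      have "\<bar>occ_moment n t - ?m * t ^ n\<bar> \<le> \<bar>occ_moment n t\<bar> + \<bar>?m * t ^ n\<bar>" by (rule abs_triangle_ineq4)
      also have "\<dots> \<le> t ^ n + \<bar>?m\<bar> * t ^ n"
        using occ_moment_range[OF that, of n] that by (intro add_mono) (auto simp: abs_mult)
      finally show ?thesis by (simp add: distrib_right)
    qed
    fix l :: real assume l: "l > 0"
    interpret LL: pair_sigma_finite "law 0" lborel
      using prob_law by (intro pair_sigma_finite.intro prob_space_imp_sigma_finite sigma_finite_lborel)
    have i1: "integrable lborel (\<lambda>t. indicator {0..} t * (exp (- l * t) * occ_moment n t))"
    proof -
      have "integrable lborel (\<lambda>t. \<integral>f. indicator {0..} t * (exp (- l * t) * occ t f ^ n) \<partial>law 0)"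
        using LL.integrable_snd[of "\<lambda>f t. indicator {0..} t * (exp (- l * t) * occ t f ^ n)"]
          integrable_discounted_occ[OF l, of n] by (simp add: split_beta')
      then show ?thesis by (simp add: occ_moment_def)
    qed
    note I = has_bochner_integral_power_exp[OF l, of n, unfolded has_bochner_integral_iff]
    have "(\<integral>t. indicator {0..} t * (exp (- l * t) * (occ_moment n t - ?m * t ^ n)) \<partial>lborel)
      = (\<integral>t. indicator {0..} t * (exp (- l * t) * occ_moment n t) - ?m * (indicator {0..} t * (exp (- l * t) * t ^ n)) \<partial>lborel)"
      by (rule Bochner_Integration.integral_cong) (auto simp: right_diff_distrib)
    also have "\<dots> = (\<integral>t. indicator {0..} t * (exp (- l * t) * occ_moment n t) \<partial>lborel)
       - (\<integral>t. ?m * (indicator {0..} t * (exp (- l * t) * t ^ n)) \<partial>lborel)"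
      by (rule Bochner_Integration.integral_diff[OF i1 integrable_mult_right]) (use I in auto)
    also have "(\<integral>t. ?m * (indicator {0..} t * (exp (- l * t) * t ^ n)) \<partial>lborel)
       = ?m * (\<integral>t. indicator {0..} t * (exp (- l * t) * t ^ n) \<partial>lborel)"
      by (rule integral_mult_right_zero)
    also have "(\<integral>t. indicator {0..} t * (exp (- l * t) * t ^ n) \<partial>lborel) = fact n / l ^ Suc n"
      using I by simp
    also have "(\<integral>t. indicator {0..} t * (exp (- l * t) * occ_moment n t) \<partial>lborel) = ?m * (fact n / l ^ Suc n)"
      by (rule laplace_occ_moment_value[OF l n])
    finally show "(\<integral>t. indicator {0..} t * (exp (- l * t) * (occ_moment n t - ?m * t ^ n)) \<partial>lborel) = 0"
      by simp
  qed
  then show ?thesis by simp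
qed

lemma occupation_law: "(\<integral>\<omega>. occupation_nonneg X t \<omega> ^ n \<partial>P 0) = occ_moment n t"
proof -
  have "occ_moment n t = (\<integral>\<omega>. occ t (path_after X 0 \<omega>) ^ n \<partial>P 0)"
    unfolding occ_moment_def law_def by (rule integral_distr[OF measurable_path_P]) simp
  moreover have "occ t (path_after X 0 \<omega>) = occupation_nonneg X t \<omega>" for \<omega>
    unfolding occupation_nonneg_def by (rule arg_cong[of _ _ "measure lborel"]) (auto simp: path_after_apply)
  ultimately show ?thesis by simp
qed

end

theorem theorem6p4:
  fixes \<nu> \<beta> :: real and M :: "'a measure" and P :: "real \<Rightarrow> 'a measure"
    and X :: "real \<Rightarrow> 'a \<Rightarrow> real" and n :: nat
  assumes "-1 < \<nu>" and "\<nu> < 0" and "0 < \<beta>" and "\<beta> < 1"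
    and "skew_two_sided_bessel \<nu> \<beta> M P X"
    and "n \<ge> 1"
  shows "(\<integral>\<omega>. occupation_nonneg X 1 \<omega> ^ n \<partial>P 0) =
    (\<Sum>k=0..n-1. \<Sum>j=0..k.
       (-1) ^ j * fact j / fact (n - 1) * real (stirling n (k + 1)) * real (Stirling (k + 1) (j + 1))
         * \<nu> ^ k * \<beta> ^ (j + 1))"
proof -
  interpret skew_bessel_diffusion M P X \<nu> \<beta>
    by unfold_locales (fact assms)+
  show ?thesis
    using occ_moment_value[OF assms(6), of 1] unfolding occupation_law by simp
qed

end
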